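(* Let $1\le p<\infty$, $r,s\in\mathbb{N}$ with $s\le 2r$, and let $f\in L_p(\mathbb{R}^d)$ satisfy $f\in\ell_p(X_\sigma)$ for all $\sigma>0$. Suppose that for all $\sigma>0$ the operator $G_\sigma$ satisfies $(A_1)$, $(A_2)$ and $(A_3)$ (with this $s$). If $$\omega_s(f,\sigma^{-1})_p=o\big(\|f_{\gamma/\sigma,r}-f\|_{\ell_p(X_\sigma)}\big)\quad\text{as }\sigma\to\infty,$$ then $\|f-G_\sigma f\|_p$ and $\|f_{\gamma/\sigma,r}-f\|_{\ell_p(X_\sigma)}$ are of the same order as $\sigma\to\infty$; that is, there exist constants $c,C>0$ and $\sigma_0>0$ such that for all $\sigma\ge\sigma_0$ $$c\,\|f_{\gamma/\sigma,r}-f\|_{\ell_p(X_\sigma)}\le\|f-G_\sigma f\|_p\le C\,\|f_{\gamma/\sigma,r}-f\|_{\ell_p(X_\sigma)} .$$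
   Context: $L_p(\mathbb{R}^d)$, $1\le p<\infty$, is the space of finite-valued measurable $f:\mathbb{R}^d\to\mathbb{R}$ with $\|f\|_p=(\int_{\mathbb{R}^d}|f|^p)^{1/p}<\infty$; functions equal almost everywhere are NOT identified (each function has a definite value at each point). $|f|_{W_p^s}=\sum_{|\alpha|_1=s}\|D^\alpha f\|_p$. Sampling points: for each $\sigma>0$, $X_\sigma\subset\mathbb{R}^d$ is a finite or infinite set with $\min_{\xi\ne\xi'\in X_\sigma}|\xi-\xi'|>2\gamma/\sigma$, where $\gamma\in(0,1]$ is independent of $\sigma$. $\|f\|_{\ell_p(X_\sigma)}=\big(\sigma^{-d}\sum_{\xi\in X_\sigma}|f(\xi)|^p\big)^{1/p}$, and $f\in\ell_p(X_\sigma)$ means this is finite. Band-limited functions: $\mathcal{B}_p^\sigma(\mathbb{R}^d)=\{\varphi\in L_p(\mathbb{R}^d)\cap L_1(\mathbb{R}^d):\operatorname{supp}\widehat\varphi\subset[-\sigma,\sigma]^d\}$, with $\widehat\varphi(x)=\int_{\mathbb{R}^d}\varphi(y)e^{-2\pi i(x,y)}dy$. Sampling operator: $G_\sigma f(x)=\sum_{\xi\in X_\sigma}f(\xi)\psi_{\xi,\sigma}(x)$ with given kernel functions $\psi_{\xi,\sigma}$. Assumptions, with positive constants $\kappa_i$ independent of $\sigma$ and of the function: $(A_1)$ $\|G_\sigma f\|_p\le\kappa_1\|f\|_{\ell_p(X_\sigma)}$ for all $f\in L_p(\mathbb{R}^d)\cap\ell_p(X_\sigma)$; $(A_2)$ $\kappa_2\|f\|_{\ell_p(X_\sigma)}\le\|G_\sigma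 f\|_p$ for all $f\in L_p(\mathbb{R}^d)\cap\ell_p(X_\sigma)$; $(A_3)$ for the given $s\in\mathbb{N}$ there is $\lambda\in(0,1]$ (independent of $\sigma$) such that $\|g-G_\sigma g\|_p\le\kappa_3\sigma^{-s}|g|_{W_p^s}$ for all $g\in\mathcal{B}_p^{\lambda\sigma}(\mathbb{R}^d)$. Modulus of smoothness: $\omega_s(f,\delta)_p=\sup_{|h|<\delta}\|\Delta_h^sf\|_p$, $\Delta_h^sf(x)=\sum_{\nu=0}^s\binom{s}{\nu}(-1)^\nu f(x+(s-\nu)h)$. Averaged operator: $f_{\delta,r}(x)=-\frac{2}{\binom{2r}{r}}\sum_{j=1}^r(-1)^j\binom{2r}{r-j}f_{\delta j/r}(x)$, where $f_\delta(x)=\frac1{|B_\delta|}\int_{B_\delta(x)}f(y)\,dy$ and $B_\delta(x)$ is the open Euclidean ball of radius $\delta$ centred at $x$, $B_\delta=B_\delta(0)$. *)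

theory Defs
  imports "HOL-Analysis.Analysis" "HOL-Library.Landau_Symbols"
begin

text \<open>Functions are genuine Lebesgue measurable functions, not classes modulo null sets, so
  that their values at sampling points make sense. The norms below are real-valued and have
  their intended value only on the corresponding spaces.\<close>

definition Lp :: "real \<Rightarrow> (real ^ 'd \<Rightarrow> real) set" where
  "Lp p = {f. f \<in> borel_measurable lebesgue \<and> integrable lebesgue (\<lambda>x. \<bar>f x\<bar> powr p)}"

definition Lp_norm :: "real \<Rightarrow> (real ^ 'd \<Rightarrow> real) \<Rightarrow> real" where
  "Lp_norm p f = (LINT x|lebesgue. \<bar>f x\<bar> powr p) powr (1 / p)"

definition partial_deriv :: "'d \<Rightarrow> (real ^ 'd \<Rightarrow> real) \<Rightarrow> real ^ 'd \<Rightarrow> real" where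
  "partial_deriv i f x = deriv (\<lambda>t. f (x + t *\<^sub>R axis i 1)) 0"

text \<open>Mixed partial derivative for a multi-index. The derivatives are taken in the order of the
  library enumeration of the coordinates; for smooth functions, the only ones it is applied to,
  the order is immaterial.\<close>

definition multi_deriv :: "('d::finite \<Rightarrow> nat) \<Rightarrow> (real ^ 'd \<Rightarrow> real) \<Rightarrow> real ^ 'd \<Rightarrow> real" where
  "multi_deriv \<alpha> f =
     foldr (\<lambda>i. partial_deriv i ^^ \<alpha> i) (map (from_nat_into (UNIV :: 'd set)) [0..<CARD('d)]) f"

definition sobolev_seminorm :: "real \<Rightarrow> nat \<Rightarrow> (real ^ 'd \<Rightarrow> real) \<Rightarrow> real" where
  "sobolev_seminorm p s f =
     (\<Sum>\<alpha> \<in> {\<alpha> :: 'd \<Rightarrow> nat. (\<Sum>i\<in>UNIV. \<alpha> i) = s}. Lp_norm p (multi_deriv \<alpha> f))"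

definition lp_sample :: "real \<Rightarrow> (real ^ 'd) set \<Rightarrow> (real ^ 'd \<Rightarrow> real) set" where
  "lp_sample p X = {f. (\<lambda>\<xi>. \<bar>f \<xi>\<bar> powr p) summable_on X}"

definition lp_sample_norm ::
  "real \<Rightarrow> real \<Rightarrow> (real ^ 'd) set \<Rightarrow> (real ^ 'd \<Rightarrow> real) \<Rightarrow> real" where
  "lp_sample_norm p \<sigma> X f =
     (\<sigma> powr (- real CARD('d)) * (\<Sum>\<^sub>\<infinity>\<xi>\<in>X. \<bar>f \<xi>\<bar> powr p)) powr (1 / p)"

text \<open>For an infinite set, the minimum distance is read as a bound on all pairwise distances.\<close>

definition separated :: "real \<Rightarrow> (real ^ 'd) set \<Rightarrow> bool" where
  "separated \<rho> X \<longleftrightarrow> (\<forall>\<xi>\<in>X. \<forall>\<xi>'\<in>X. \<xi> \<noteq> \<xi>' \<longrightarrow> dist \<xi> \<xi>' > \<rho>)"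

definition fourier :: "(real ^ 'd \<Rightarrow> real) \<Rightarrow> real ^ 'd \<Rightarrow> complex" where
  "fourier \<phi> x =
     (LINT y|lebesgue. complex_of_real (\<phi> y) * exp (- 2 * of_real pi * \<i> * of_real (x \<bullet> y)))"

text \<open>A band-limited integrable function agrees almost everywhere with a smooth function. Since
  values at sampling points matter, the members of the band-limited space are required to be
  that continuous (hence smooth) representative. Without this requirement the assumptions on
  the sampling operator contradict each other: the function that is 1 at one sampling point
  and 0 elsewhere would be band-limited with vanishing Sobolev seminorm.\<close>

definition bandlimited :: "real \<Rightarrow> real \<Rightarrow> (real ^ 'd \<Rightarrow> real) set" where
  "bandlimited p \<sigma> =
     {\<phi>. \<phi> \<in> Lp p \<inter> Lp 1 \<and> continuous_on UNIV \<phi> \<and>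
         closure {x. fourier \<phi> x \<noteq> 0} \<subseteq> cbox (vec (- \<sigma>)) (vec \<sigma>)}"

definition sampling_op ::
  "(real ^ 'd) set \<Rightarrow> (real ^ 'd \<Rightarrow> real ^ 'd \<Rightarrow> real) \<Rightarrow>
   (real ^ 'd \<Rightarrow> real) \<Rightarrow> real ^ 'd \<Rightarrow> real" where
  "sampling_op X \<psi> f x = (\<Sum>\<^sub>\<infinity>\<xi>\<in>X. f \<xi> * \<psi> \<xi> x)"

text \<open>The sampling series of every admissible function converges almost everywhere
  (unconditionally, the sampling points being unordered) and defines a function in
  \<open>Lp p\<close>. The norm inequalities for the sampling operator presuppose this; it must be stated
  because \<open>infsum\<close> and the Bochner integral are 0 where undefined.\<close>

definition sampling_defined ::
  "real \<Rightarrow> (real ^ 'd) set \<Rightarrow> (real ^ 'd \<Rightarrow> real ^ 'd \<Rightarrow> real) \<Rightarrow> bool" where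
  "sampling_defined p X \<psi> \<longleftrightarrow>
     (\<forall>f \<in> Lp p \<inter> lp_sample p X.
        (AE x in lebesgue. (\<lambda>\<xi>. f \<xi> * \<psi> \<xi> x) summable_on X) \<and> sampling_op X \<psi> f \<in> Lp p)"

definition cond_A1 ::
  "real \<Rightarrow> real \<Rightarrow> real \<Rightarrow> (real ^ 'd) set \<Rightarrow> (real ^ 'd \<Rightarrow> real ^ 'd \<Rightarrow> real) \<Rightarrow> bool" where
  "cond_A1 \<kappa> p \<sigma> X \<psi> \<longleftrightarrow>
     (\<forall>f \<in> Lp p \<inter> lp_sample p X. Lp_norm p (sampling_op X \<psi> f) \<le> \<kappa> * lp_sample_norm p \<sigma> X f)"

definition cond_A2 ::
  "real \<Rightarrow> real \<Rightarrow> real \<Rightarrow> (real ^ 'd) set \<Rightarrow> (real ^ 'd \<Rightarrow> real ^ 'd \<Rightarrow> real) \<Rightarrow> bool" where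
  "cond_A2 \<kappa> p \<sigma> X \<psi> \<longleftrightarrow>
     (\<forall>f \<in> Lp p \<inter> lp_sample p X. \<kappa> * lp_sample_norm p \<sigma> X f \<le> Lp_norm p (sampling_op X \<psi> f))"

text \<open>Both norms are finite here: by Bernstein's inequality all derivatives of a band-limited
  \<open>g\<close> lie in \<open>Lp p\<close>, and by the Plancherel--Polya inequality \<open>g\<close> lies in \<open>lp_sample p X\<close> for
  separated \<open>X\<close>.\<close>

definition cond_A3 ::
  "real \<Rightarrow> real \<Rightarrow> nat \<Rightarrow> real \<Rightarrow> real \<Rightarrow> (real ^ 'd) set \<Rightarrow>
   (real ^ 'd \<Rightarrow> real ^ 'd \<Rightarrow> real) \<Rightarrow> bool" where
  "cond_A3 \<kappa> lam s p \<sigma> X \<psi> \<longleftrightarrow>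
     (\<forall>g \<in> bandlimited p (lam * \<sigma>).
        Lp_norm p (\<lambda>x. g x - sampling_op X \<psi> g x)
          \<le> \<kappa> * \<sigma> powr (- real s) * sobolev_seminorm p s g)"

definition fin_diff :: "nat \<Rightarrow> real ^ 'd \<Rightarrow> (real ^ 'd \<Rightarrow> real) \<Rightarrow> real ^ 'd \<Rightarrow> real" where
  "fin_diff s h f x =
     (\<Sum>\<nu> = 0..s. real (s choose \<nu>) * (- 1) ^ \<nu> * f (x + real (s - \<nu>) *\<^sub>R h))"

definition modulus :: "real \<Rightarrow> nat \<Rightarrow> (real ^ 'd \<Rightarrow> real) \<Rightarrow> real \<Rightarrow> real" where
  "modulus p s f \<delta> = (SUP h \<in> {h. norm h < \<delta>}. Lp_norm p (fin_diff s h f))"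

definition ball_avg :: "real \<Rightarrow> (real ^ 'd \<Rightarrow> real) \<Rightarrow> real ^ 'd \<Rightarrow> real" where
  "ball_avg \<delta> f x =
     1 / measure lebesgue (ball (0 :: real ^ 'd) \<delta>) * (LINT y:ball x \<delta>|lebesgue. f y)"

definition averaged :: "real \<Rightarrow> nat \<Rightarrow> (real ^ 'd \<Rightarrow> real) \<Rightarrow> real ^ 'd \<Rightarrow> real" where
  "averaged \<delta> r f x =
     - (2 / real (2 * r choose r)) *
       (\<Sum>j = 1..r. (- 1) ^ j * real (2 * r choose (r - j)) * ball_avg (\<delta> * real j / real r) f x)"

end

theory Submission
  imports Defs "HOL-Probability.Characteristic_Functions" "HOL-Probability.Sinc_Integral"
begin

text \<open>Let \<open>\<omega>\<close> be the modulus of smoothness of \<open>f\<close> at \<open>1 / \<sigma>\<close>, and let \<open>F\<close> be the averaged function. There is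
  a band-limited \<open>g\<close> such that the norm of \<open>f - g\<close>, the Sobolev seminorm of \<open>g\<close> divided by \<open>\<sigma> ^ s\<close>, and
  the sampled norm of \<open>g - F\<close> are all bounded by a constant times \<open>\<omega>\<close>. In
  \<open>f - G f = (f - g) + (g - G g) + G (g - f)\<close> the first two terms are then negligible, and by the two-sided
  bound on \<open>G\<close> the third is comparable to the sampled norm of \<open>g - f\<close>, hence to that of \<open>F - f\<close>.

  The approximant \<open>g\<close> is a linear combination of convolutions of \<open>f\<close> (truncated, to make it integrable)
  with dilations of a product kernel. The factors of the kernel are normalised Fourier transforms of
  \<open>(1 - t\<^sup>2) ^ (s + 2)\<close> on \<open>[-1, 1]\<close>. The coefficients are chosen such that both the error and every
  derivative of order \<open>s\<close> are kernel averages of differences of order \<open>s\<close>.\<close>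

subsection \<open>Bounds on p-norms\<close>

text \<open>The obstacle is that the sampled norm sees single values of \<open>f\<close> while the
  p-norm does not: closeness of \<open>g\<close> to \<open>f\<close> in \<open>Lp p\<close> says
  nothing about the samples of \<open>g - f\<close>. The averaged function is the bridge, since it
  does not change with \<open>f\<close> on null sets and samples of convolutions are controlled by
  the p-norm. Write T for the operator producing \<open>g\<close> and A for averaging. Because they
  commute, g - A f = T (f - A f) + A (T f - f). The outer operators are bounded from the p-norm to
  the sampled norm, and both brackets have the size of the modulus. For the first bracket,
  \<open>s \<le> 2 * r\<close> lets a difference of order \<open>2 * r\<close> be bounded by one of
  order \<open>s\<close>, and \<open>\<gamma> \<le> 1\<close> keeps the averaging radius within
  \<open>1 / \<sigma>\<close>. Decay of order \<open>s + 2\<close> is chosen because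
  \<open>s\<close> powers pay for the growth of differences with long steps and two are left for
  integrability. For p > 1 a function in \<open>Lp p\<close> need not be integrable, but a
  band-limited one must be; the truncation error is arbitrary and is sent to 0 for each
  \<open>\<sigma>\<close> separately.\<close>

text \<open>The bound includes finiteness of the norm, so the junk values of the real-valued norms do not
  arise. Over \<open>sample_measure\<close> below it bounds the sampled norm.\<close>

definition pnorm_le :: "'a measure \<Rightarrow> real \<Rightarrow> ('a \<Rightarrow> real) \<Rightarrow> real \<Rightarrow> bool" where
  "pnorm_le M p f c \<longleftrightarrow> 0 \<le> c \<and> f \<in> borel_measurable M \<and>
     (\<integral>\<^sup>+ x. ennreal (\<bar>f x\<bar> powr p) \<partial>M) \<le> ennreal (c powr p)"

section \<open>Convexity of powers and Minkowski's inequality\<close>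

lemma abs_le_one_plus_powr:
  fixes y p :: real
  assumes "1 \<le> p"
  shows "\<bar>y\<bar> \<le> 1 + \<bar>y\<bar> powr p"
proof (cases "\<bar>y\<bar> \<le> 1")
  case True
  then show ?thesis using powr_ge_zero[of "\<bar>y\<bar>" p] by linarith
next
  case False
  then have "\<bar>y\<bar> powr 1 \<le> \<bar>y\<bar> powr p" using assms by (intro powr_mono) auto
  then show ?thesis using False by simp
qed

text \<open>Convexity: the graph lies above its tangent at \<open>c\<close>. Averaged or integrated,
  this one inequality yields both Minkowski's and Jensen's inequality. At \<open>t = 0\<close>,
  outside the open half-line where the tangent argument runs, the left side is (1 - p) c^p, which is
  not positive.\<close>

lemma powr_tangent:
  fixes p t c :: real
  assumes "1 \<le> p" "0 \<le> t" "0 < c"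
  shows "c powr p + p * c powr (p - 1) * (t - c) \<le> t powr p"
proof (cases "t = 0")
  case True
  have "c powr p = c powr (p - 1) * c"
    using assms by (simp add: powr_diff)
  then have "c powr p + p * c powr (p - 1) * (0 - c) = (1 - p) * c powr p"
    by (simp add: algebra_simps)
  also have "\<dots> \<le> 0" using assms by (simp add: mult_nonpos_nonneg)
  finally show ?thesis using True by simp
next
  case False
  have "(p * c powr (p - 1)) * (t - c) \<le> t powr p - c powr p"
  proof (rule convex_on_imp_above_tangent[OF powr_convex[OF \<open>1 \<le> p\<close>]])
    show "((\<lambda>x. x powr p) has_real_derivative p * c powr (p - 1)) (at c within {0<..})"
      by (rule has_field_derivative_at_within[OF has_real_derivative_powr[OF \<open>0 < c\<close>]])
  qed (use assms False in \<open>auto simp: interior_open\<close>)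
  then show ?thesis by simp
qed

text \<open>Convexity for the combination of \<open>a / \<theta>\<close> and
  \<open>b / (1 - \<theta>)\<close> with weights \<open>\<theta>\<close> and
  \<open>1 - \<theta>\<close>. The weight is left free so that Minkowski's inequality can take for
  it the share of one norm bound in the sum of both, which gives constant 1.\<close>

lemma powr_add_le_convex:
  fixes p a b \<theta> :: real
  assumes "1 \<le> p" "0 \<le> a" "0 \<le> b" "0 < \<theta>" "\<theta> < 1"
  shows "(a + b) powr p \<le> \<theta> powr (1 - p) * a powr p + (1 - \<theta>) powr (1 - p) * b powr p"
proof (cases "a + b = 0")
  case True
  then show ?thesis using assms by simp
next
  case False
  define c where "c = a + b"
  have c: "0 < c" using False assms by (simp add: c_def)
  have *: "u * (c powr p + p * c powr (p - 1) * (v / u - c)) \<le> u powr (1 - p) * v powr p"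
    if "0 < u" "0 \<le> v" for u v
  proof -
    have "u * (c powr p + p * c powr (p - 1) * (v / u - c)) \<le> u * (v / u) powr p"
      using that assms c by (intro mult_left_mono powr_tangent) auto
    also have "\<dots> = u powr (1 - p) * v powr p"
      using that by (simp add: powr_divide powr_diff)
    finally show ?thesis .
  qed
  \<comment> \<open>Both tangents are taken at the mean \<open>c = a + b\<close>; their linear parts
    cancel after weighting.\<close>
  have "c powr p = \<theta> * (c powr p + p * c powr (p - 1) * (a / \<theta> - c))
      + (1 - \<theta>) * (c powr p + p * c powr (p - 1) * (b / (1 - \<theta>) - c))"
    using assms by (simp add: field_simps c_def)
  also have "\<dots> \<le> \<theta> powr (1 - p) * a powr p + (1 - \<theta>) powr (1 - p) * b powr p"
    using assms by (intro add_mono *) auto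
  finally show ?thesis by (simp add: c_def)
qed

lemma pnorm_le_nonneg: "pnorm_le M p f c \<Longrightarrow> 0 \<le> c"
  and pnorm_le_measurable: "pnorm_le M p f c \<Longrightarrow> f \<in> borel_measurable M"
  and pnorm_le_nn: "pnorm_le M p f c \<Longrightarrow> (\<integral>\<^sup>+ x. ennreal (\<bar>f x\<bar> powr p) \<partial>M) \<le> ennreal (c powr p)"
  by (auto simp: pnorm_le_def)

lemma pnorm_le_mono:
  assumes "pnorm_le M p f c" "c \<le> d" "1 \<le> p"
  shows "pnorm_le M p f d"
proof -
  have "ennreal (c powr p) \<le> ennreal (d powr p)"
    using assms by (intro ennreal_leI powr_mono2) (auto simp: pnorm_le_def)
  then show ?thesis using assms unfolding pnorm_le_def by (auto intro: order_trans)
qed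

lemma pnorm_le_cong_AE:
  assumes "pnorm_le M p f c" "AE x in M. f x = g x" "g \<in> borel_measurable M"
  shows "pnorm_le M p g c"
proof -
  have "(\<integral>\<^sup>+ x. ennreal (\<bar>g x\<bar> powr p) \<partial>M) = (\<integral>\<^sup>+ x. ennreal (\<bar>f x\<bar> powr p) \<partial>M)"
    using assms(2) by (intro nn_integral_cong_AE) auto
  then show ?thesis using assms by (auto simp: pnorm_le_def)
qed

lemma pnorm_le_zero: "pnorm_le M p (\<lambda>_. 0) 0"
  by (simp add: pnorm_le_def)

lemma pnorm_le_cmult:
  assumes "pnorm_le M p f c"
  shows "pnorm_le M p (\<lambda>x. a * f x) (\<bar>a\<bar> * c)"
proof -
  note [measurable] = pnorm_le_measurable[OF assms]
  have "(\<integral>\<^sup>+ x. ennreal (\<bar>a * f x\<bar> powr p) \<partial>M)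
      = ennreal (\<bar>a\<bar> powr p) * (\<integral>\<^sup>+ x. ennreal (\<bar>f x\<bar> powr p) \<partial>M)"
    by (subst nn_integral_cmult[symmetric]) (auto simp: abs_mult powr_mult ennreal_mult)
  also have "\<dots> \<le> ennreal (\<bar>a\<bar> powr p) * ennreal (c powr p)"
    using assms by (intro mult_left_mono pnorm_le_nn) auto
  also have "\<dots> = ennreal ((\<bar>a\<bar> * c) powr p)"
    using pnorm_le_nonneg[OF assms] by (simp add: powr_mult ennreal_mult)
  finally show ?thesis using pnorm_le_nonneg[OF assms] by (simp add: pnorm_le_def)
qed

lemma pnorm_le_uminus: "pnorm_le M p f c \<Longrightarrow> pnorm_le M p (\<lambda>x. - f x) c"
  by (simp add: pnorm_le_def)

lemma pnorm_le_0_AE: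
  assumes "pnorm_le M p f 0" "1 \<le> p"
  shows "AE x in M. f x = 0"
proof -
  note [measurable] = pnorm_le_measurable[OF assms(1)]
  have "(\<integral>\<^sup>+ x. ennreal (\<bar>f x\<bar> powr p) \<partial>M) = 0"
    using pnorm_le_nn[OF assms(1)] by simp
  then have "AE x in M. ennreal (\<bar>f x\<bar> powr p) = 0"
    by (subst (asm) nn_integral_0_iff_AE) auto
  then show ?thesis by eventually_elim (auto simp: ennreal_eq_0_iff)
qed

text \<open>Minkowski's inequality for bounds instead of norms. With weight
  \<open>a / (a + b)\<close> the convexity estimate sums to exactly \<open>(a + b) powr p\<close>. A
  bound equal to 0 would push the weight to an endpoint, but then that function vanishes almost
  everywhere.\<close>

lemma pnorm_le_add:
  assumes f: "pnorm_le M p f a" and g: "pnorm_le M p g b" and p: "1 \<le> p"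
  shows "pnorm_le M p (\<lambda>x. f x + g x) (a + b)"
proof -
  note [measurable] = pnorm_le_measurable[OF f] pnorm_le_measurable[OF g]
  have ab: "0 \<le> a" "0 \<le> b" using f g by (auto simp: pnorm_le_def)
  consider "a = 0" | "b = 0" | "0 < a" "0 < b" using ab by linarith
  then show ?thesis
  proof cases
    case 1
    have "AE x in M. g x = f x + g x" using pnorm_le_0_AE[of M p f] f p 1 by auto
    from pnorm_le_cong_AE[OF g this] 1 show ?thesis by simp
  next
    case 2
    have "AE x in M. f x = f x + g x" using pnorm_le_0_AE[of M p g] g p 2 by auto
    from pnorm_le_cong_AE[OF f this] 2 show ?thesis by simp
  next
    case 3
    define \<theta> where "\<theta> = a / (a + b)"
    have \<theta>: "0 < \<theta>" "\<theta> < 1" using 3 by (auto simp: \<theta>_def)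
    have th': "1 - \<theta> = b / (a + b)" using 3 by (simp add: \<theta>_def field_simps)
    have "(\<integral>\<^sup>+ x. ennreal (\<bar>f x + g x\<bar> powr p) \<partial>M)
        \<le> (\<integral>\<^sup>+ x. ennreal (\<theta> powr (1 - p)) * ennreal (\<bar>f x\<bar> powr p)
              + ennreal ((1 - \<theta>) powr (1 - p)) * ennreal (\<bar>g x\<bar> powr p) \<partial>M)"
    proof (intro nn_integral_mono)
      fix x
      have "\<bar>f x + g x\<bar> powr p \<le> (\<bar>f x\<bar> + \<bar>g x\<bar>) powr p"
        using p by (intro powr_mono2) auto
      also have "\<dots> \<le> \<theta> powr (1 - p) * \<bar>f x\<bar> powr p + (1 - \<theta>) powr (1 - p) * \<bar>g x\<bar> powr p"
        using p \<theta> by (intro powr_add_le_convex) auto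
      finally show "ennreal (\<bar>f x + g x\<bar> powr p) \<le> ennreal (\<theta> powr (1 - p)) * ennreal (\<bar>f x\<bar> powr p)
              + ennreal ((1 - \<theta>) powr (1 - p)) * ennreal (\<bar>g x\<bar> powr p)"
        by (simp add: ennreal_mult[symmetric] ennreal_plus[symmetric] ennreal_leI del: ennreal_plus)
    qed
    also have "\<dots> = ennreal (\<theta> powr (1 - p)) * (\<integral>\<^sup>+ x. ennreal (\<bar>f x\<bar> powr p) \<partial>M)
              + ennreal ((1 - \<theta>) powr (1 - p)) * (\<integral>\<^sup>+ x. ennreal (\<bar>g x\<bar> powr p) \<partial>M)"
      by (simp add: nn_integral_add nn_integral_cmult)
    also have "\<dots> \<le> ennreal (\<theta> powr (1 - p)) * ennreal (a powr p)
              + ennreal ((1 - \<theta>) powr (1 - p)) * ennreal (b powr p)"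
      using f g by (intro add_mono mult_left_mono pnorm_le_nn) auto
    also have "\<dots> = ennreal (\<theta> powr (1 - p) * a powr p + (1 - \<theta>) powr (1 - p) * b powr p)"
      by (simp add: ennreal_mult)
    also have "\<theta> powr (1 - p) * a powr p + (1 - \<theta>) powr (1 - p) * b powr p = (a + b) powr p"
    proof -
      have *: "(u / t) powr (1 - p) * u powr p = u * t powr (p - 1)" if "0 < u" "0 < t" for u t
        using that by (simp add: powr_divide powr_diff)
      have "(a + b) * (a + b) powr (p - 1) = (a + b) powr p"
        using 3 by (simp add: powr_diff)
      then show ?thesis
        using 3 unfolding th' unfolding \<theta>_def by (simp add: * distrib_right)
    qed
    finally show ?thesis using ab by (simp add: pnorm_le_def)
  qed
qed

lemma pnorm_le_diff:
  assumes "pnorm_le M p f a" "pnorm_le M p g b" "1 \<le> p"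
  shows "pnorm_le M p (\<lambda>x. f x - g x) (a + b)"
  using pnorm_le_add[OF assms(1) pnorm_le_uminus[OF assms(2)] assms(3)] by simp

lemma pnorm_le_sum:
  assumes "1 \<le> p" "\<And>i. i \<in> I \<Longrightarrow> pnorm_le M p (f i) (c i)"
  shows "pnorm_le M p (\<lambda>x. \<Sum>i\<in>I. f i x) (\<Sum>i\<in>I. c i)"
  using assms(2)
proof (induction I rule: infinite_finite_induct)
  case (insert i I)
  then show ?case using assms(1) by (auto intro!: pnorm_le_add)
qed (auto intro: pnorm_le_zero)

lemma pnorm_le_lincomb:
  assumes "1 \<le> p" "\<And>i. i \<in> I \<Longrightarrow> pnorm_le M p (f i) c"
  shows "pnorm_le M p (\<lambda>x. \<Sum>i\<in>I. a i * f i x) ((\<Sum>i\<in>I. \<bar>a i\<bar>) * c)"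
  unfolding sum_distrib_right using assms by (intro pnorm_le_sum pnorm_le_cmult)

lemma pnorm_le_integrable:
  assumes "pnorm_le M p f c"
  shows "integrable M (\<lambda>x. \<bar>f x\<bar> powr p)"
proof -
  note [measurable] = pnorm_le_measurable[OF assms]
  show ?thesis using pnorm_le_nn[OF assms]
    by (intro integrableI_bounded) (auto simp: less_top[symmetric] top_unique)
qed

text \<open>Passage between the extended integral, in which all estimates are made, and the real
  expression behind \<open>Lp_norm\<close> and \<open>lp_sample_norm\<close>. Integrability has to
  be carried along because the real integral is 0 without it.\<close>

lemma pnorm_le_iff_integral:
  assumes "1 \<le> p"
  shows "pnorm_le M p f c \<longleftrightarrow> 0 \<le> c \<and> f \<in> borel_measurable M \<and> integrable M (\<lambda>x. \<bar>f x\<bar> powr p)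
    \<and> (LINT x|M. \<bar>f x\<bar> powr p) powr (1 / p) \<le> c" (is "?l \<longleftrightarrow> ?r")
proof -
  have *: "(LINT x|M. \<bar>f x\<bar> powr p) powr (1 / p) \<le> c \<longleftrightarrow> (LINT x|M. \<bar>f x\<bar> powr p) \<le> c powr p" if "0 \<le> c"
  proof -
    let ?I = "LINT x|M. \<bar>f x\<bar> powr p"
    have I: "0 \<le> ?I" by simp
    show ?thesis
      using powr_mono2[of p "?I powr (1 / p)" c] powr_mono2[of "1 / p" ?I "c powr p"] assms that I
      by (auto simp: powr_powr)
  qed
  show ?thesis
  proof
    assume l: ?l
    have "ennreal (LINT x|M. \<bar>f x\<bar> powr p) \<le> ennreal (c powr p)"
      using l pnorm_le_integrable[OF l] by (subst nn_integral_eq_integral[symmetric]) (auto simp: pnorm_le_def)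
    then show ?r using * l pnorm_le_integrable[OF l] by (auto simp: pnorm_le_def)
  next
    assume r: ?r
    then show ?l using *
      by (auto simp: pnorm_le_def nn_integral_eq_integral ennreal_leI)
  qed
qed

lemma pnorm_le_lebesgue_iff:
  "1 \<le> p \<Longrightarrow> pnorm_le lebesgue p f c \<longleftrightarrow> f \<in> Lp p \<and> Lp_norm p f \<le> c"
  by (subst pnorm_le_iff_integral) (auto simp: Lp_def Lp_norm_def intro: order_trans[OF powr_ge_zero])

text \<open>The spaces of the theorem live over the completed measure, whereas Fubini's theorem and
  affine substitution are applied on \<open>lborel\<close>. For Borel functions the bounds
  agree.\<close>

lemma pnorm_le_lebesgue_lborel:
  fixes f :: "'a::euclidean_space \<Rightarrow> real"
  assumes "f \<in> borel_measurable borel"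
  shows "pnorm_le lebesgue p f c \<longleftrightarrow> pnorm_le lborel p f c"
  using assms by (auto simp: pnorm_le_def nn_integral_completion measurable_completion)

text \<open>The normalising factor is put into the measure, so the sampled norm becomes one more
  p-norm and Minkowski's inequality applies to it without a second proof.\<close>

definition sample_measure :: "real \<Rightarrow> (real ^ 'd) set \<Rightarrow> (real ^ 'd) measure" where
  "sample_measure \<sigma> X = density (count_space X) (\<lambda>_. ennreal (\<sigma> powr (- real CARD('d))))"

lemma nn_integral_sample_measure:
  fixes X :: "(real ^ 'd) set"
  shows "(\<integral>\<^sup>+ x. f x \<partial>sample_measure \<sigma> X)
     = ennreal (\<sigma> powr (- real CARD('d))) * (\<integral>\<^sup>+ x. f x \<partial>count_space X)"
  unfolding sample_measure_def by (simp add: nn_integral_density nn_integral_cmult)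

lemma pnorm_le_sample_iff:
  fixes X :: "(real ^ 'd) set"
  assumes "1 \<le> p" "0 < \<sigma>"
  shows "pnorm_le (sample_measure \<sigma> X) p f c \<longleftrightarrow> f \<in> lp_sample p X \<and> lp_sample_norm p \<sigma> X f \<le> c"
proof -
  let ?s = "\<sigma> powr (- real CARD('d))" and ?g = "\<lambda>x. \<bar>f x\<bar> powr p"
  have f: "f \<in> borel_measurable (sample_measure \<sigma> X)"
    by (simp add: sample_measure_def)
  have 1: "integrable (sample_measure \<sigma> X) ?g \<longleftrightarrow> integrable (count_space X) ?g"
    using assms unfolding sample_measure_def
    by (subst integrable_density) (auto simp: integrable_mult_left_iff)
  have 2: "integrable (count_space X) ?g \<longleftrightarrow> ?g summable_on X"
    using abs_summable_equivalent[of ?g X] by (simp add: abs_summable_on_def)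
  have 3: "(LINT x|sample_measure \<sigma> X. ?g x) = ?s * (\<Sum>\<^sub>\<infinity>\<xi>\<in>X. ?g \<xi>)" if "?g summable_on X"
  proof -
    have "Infinite_Set_Sum.abs_summable_on ?g X"
      using that abs_summable_equivalent[of ?g X] by simp
    then have "infsum ?g X = (LINT x|count_space X. ?g x)"
      by (subst infsetsum_infsum[symmetric]) (auto simp: infsetsum_def)
    then show ?thesis
      unfolding sample_measure_def by (subst integral_density) auto
  qed
  show ?thesis
    using 3 assms f
    by (subst pnorm_le_iff_integral)
       (auto simp: 1 2 lp_sample_def lp_sample_norm_def intro: order_trans[OF powr_ge_zero])
qed

text \<open>Jensen's inequality for a weight that is not normalised: the tangent inequality at the
  weighted mean of |H| is integrated against \<open>w\<close>. As the right side is an extended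
  integral, integrability of \<open>H\<close> need not be assumed, and no conjugate exponent occurs,
  so p = 1 is included.\<close>

lemma abs_integral_powr_le:
  fixes A w H :: "'a \<Rightarrow> real"
  assumes [measurable]: "A \<in> borel_measurable M" "H \<in> borel_measurable M"
    and w: "integrable M w" and Aw: "\<And>x. \<bar>A x\<bar> \<le> w x" and p: "1 \<le> p"
  shows "ennreal (\<bar>LINT x|M. A x * H x\<bar> powr p)
     \<le> ennreal ((LINT x|M. w x) powr (p - 1)) * (\<integral>\<^sup>+ x. ennreal (w x * \<bar>H x\<bar> powr p) \<partial>M)"
proof -
  define V where "V = (LINT x|M. w x)"
  have w0: "0 \<le> w x" for x using Aw[of x] by linarith
  note [measurable] = borel_measurable_integrable[OF w]
  have V0: "0 \<le> V" unfolding V_def using w0 by simp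
  show ?thesis
  proof (cases "V = 0")
    case True
    then have "AE x in M. w x = 0"
      using integral_nonneg_eq_0_iff_AE[OF w] w0 by (auto simp: V_def)
    then have "AE x in M. A x * H x = 0"
    proof eventually_elim
      case (elim x) then show ?case using Aw[of x] by simp
    qed
    then have "(LINT x|M. A x * H x) = 0"
      by (simp add: integral_eq_zero_AE)
    then show ?thesis using p by simp
  next
    case False
    with V0 have V: "0 < V" by simp
    show ?thesis
    proof (cases "(\<integral>\<^sup>+ x. ennreal (w x * \<bar>H x\<bar> powr p) \<partial>M) = \<infinity>")
      \<comment> \<open>The right side is infinite only because \<open>V\<close> is positive: 0
        times infinity is 0 in \<open>ennreal\<close>, which is why \<open>V = 0\<close> was treated
        first.\<close>
      case True
      then show ?thesis using V by (simp add: V_def[symmetric] ennreal_mult_top)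
    next
      case False
      have int: "integrable M (\<lambda>x. w x * \<bar>H x\<bar> powr p)"
        using False w0 by (intro integrableI_bounded) (auto simp: less_top[symmetric] abs_mult)
      have int1: "integrable M (\<lambda>x. w x * \<bar>H x\<bar>)"
      proof (rule Bochner_Integration.integrable_bound)
        show "integrable M (\<lambda>x. w x + w x * \<bar>H x\<bar> powr p)" using w int by simp
        have "w x * \<bar>H x\<bar> \<le> w x + w x * \<bar>H x\<bar> powr p" for x
          using mult_left_mono[OF abs_le_one_plus_powr[OF p, of "H x"] w0[of x]] by (simp add: algebra_simps)
        then show "AE x in M. norm (w x * \<bar>H x\<bar>) \<le> norm (w x + w x * \<bar>H x\<bar> powr p)"
          using w0 by (intro AE_I2) (simp add: abs_mult)
      qed measurable
      define J where "J = (LINT x|M. w x * \<bar>H x\<bar>)"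
      define Q where "Q = (LINT x|M. w x * \<bar>H x\<bar> powr p)"
      have J0: "0 \<le> J" unfolding J_def using w0 by (intro Bochner_Integration.integral_nonneg) auto
      have Q0: "0 \<le> Q" unfolding Q_def using w0 by (intro Bochner_Integration.integral_nonneg) auto
      have AH: "\<bar>A x * H x\<bar> \<le> w x * \<bar>H x\<bar>" for x
        using Aw by (simp add: abs_mult mult_right_mono)
      have "integrable M (\<lambda>x. A x * H x)"
      proof (rule Bochner_Integration.integrable_bound[OF int1])
        show "AE x in M. norm (A x * H x) \<le> norm (w x * \<bar>H x\<bar>)"
          using AH w0 by (intro AE_I2) (simp add: abs_mult)
      qed measurable
      then have "\<bar>LINT x|M. A x * H x\<bar> \<le> J"
        unfolding J_def using int1 AH integral_abs_bound[of M "\<lambda>x. A x * H x"]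
        by (intro order_trans[OF integral_abs_bound integral_mono]) auto
      then have "\<bar>LINT x|M. A x * H x\<bar> powr p \<le> J powr p" using p by (intro powr_mono2) auto
      also have "J powr p \<le> V powr (p - 1) * Q"
      proof (cases "J = 0")
        case True then show ?thesis using p Q0 by simp
      next
        case False
        \<comment> \<open>The weighted mean of |H|: at this point the linear part of the tangent
          integrates to 0.\<close>
        define c where "c = J / V"
        have c: "0 < c" using False J0 V by (simp add: c_def)
        have "V * c powr p = (LINT x|M. w x * (c powr p + p * c powr (p - 1) * (\<bar>H x\<bar> - c)))"
        proof -
          have "(\<lambda>x. w x * (c powr p + p * c powr (p - 1) * (\<bar>H x\<bar> - c)))
             = (\<lambda>x. (c powr p - p * c powr (p - 1) * c) * w x + (p * c powr (p - 1)) * (w x * \<bar>H x\<bar>))"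
            by (auto simp: algebra_simps)
          then have "(LINT x|M. w x * (c powr p + p * c powr (p - 1) * (\<bar>H x\<bar> - c)))
             = (c powr p - p * c powr (p - 1) * c) * V + (p * c powr (p - 1)) * J"
            using w int1 by (simp add: V_def J_def)
          also have "J = c * V" using V by (simp add: c_def)
          finally show ?thesis by (simp add: algebra_simps)
        qed
        also have "\<dots> \<le> Q" unfolding Q_def
        proof (rule integral_mono[OF _ int])
          have "(\<lambda>x. w x * (c powr p + p * c powr (p - 1) * (\<bar>H x\<bar> - c)))
             = (\<lambda>x. (c powr p - p * c powr (p - 1) * c) * w x + (p * c powr (p - 1)) * (w x * \<bar>H x\<bar>))"
            by (auto simp: algebra_simps)
          then show "integrable M (\<lambda>x. w x * (c powr p + p * c powr (p - 1) * (\<bar>H x\<bar> - c)))"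
            using w int1 by simp
        qed (use c p w0 in \<open>auto intro!: mult_left_mono powr_tangent\<close>)
        finally have "V powr (p - 1) * (V * c powr p) \<le> V powr (p - 1) * Q"
          by (intro mult_left_mono) auto
        moreover have "V powr (p - 1) * (V * c powr p) = J powr p"
          using V J0 by (simp add: c_def powr_divide powr_diff)
        ultimately show ?thesis by simp
      qed
      finally have "ennreal (\<bar>LINT x|M. A x * H x\<bar> powr p) \<le> ennreal (V powr (p - 1) * Q)"
        by (rule ennreal_leI)
      also have "\<dots> = ennreal (V powr (p - 1)) * (\<integral>\<^sup>+ x. ennreal (w x * \<bar>H x\<bar> powr p) \<partial>M)"
        unfolding Q_def using int w0 Q0 by (subst nn_integral_eq_integral) (auto simp: ennreal_mult Q_def)
      finally show ?thesis by (simp add: V_def)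
    qed
  qed
qed

subsection \<open>Decaying kernels and separated sets\<close>

lemma Basis_vec_real: "(Basis :: (real ^ 'd) set) = range (\<lambda>i. axis i 1)"
  by (auto simp: Basis_vec_def)

lemma inj_axis_1: "inj (\<lambda>i::'d::finite. axis i (1::real))"
  by (auto simp: inj_on_def axis_eq_axis)

text \<open>\<open>lborel\<close> is the image of the product measure indexed by
  \<open>Basis\<close>, and the axis vectors identify that index set with the coordinates. The value
  type is a general field since the formula serves both real kernels and complex Fourier
  integrals.\<close>

lemma lborel_vec_prod:
  fixes f :: "'d::finite \<Rightarrow> real \<Rightarrow> 'a::{real_normed_field,banach,second_countable_topology}"
  assumes int: "\<And>i. integrable lborel (f i)"
  shows "integrable lborel (\<lambda>v :: real ^ 'd. \<Prod>i\<in>UNIV. f i (v $ i))" (is ?I)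
    and "(LINT v|lborel. (\<Prod>i\<in>UNIV. f i ((v :: real ^ 'd) $ i))) = (\<Prod>i\<in>UNIV. (LINT t|lborel. f i t))" (is ?E)
proof -
  interpret product_sigma_finite "\<lambda>_::real ^ 'd. lborel :: real measure"
    by standard
  let ?B = "Basis :: (real ^ 'd) set"
  define j where "j = inv (\<lambda>i::'d. axis i (1::real))"
  have j [simp]: "j (axis i 1) = i" for i
    unfolding j_def by (rule inv_f_f[OF inj_axis_1])
  let ?T = "\<lambda>g. \<Sum>b\<in>?B. g b *\<^sub>R b"
  have T: "?T \<in> (\<Pi>\<^sub>M b\<in>?B. lborel) \<rightarrow>\<^sub>M borel" by measurable
  have lb: "(lborel :: (real ^ 'd) measure) = distr (\<Pi>\<^sub>M b\<in>?B. lborel) borel ?T"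
    by (rule lborel_eq)
  have comp: "?T g $ i = g (axis i 1)" for g i
  proof -
    have "?T g $ i = ?T g \<bullet> axis i 1" by (simp add: inner_axis)
    also have "\<dots> = g (axis i 1)"
      by (rule inner_sum_left_Basis) (auto simp: Basis_vec_real)
    finally show ?thesis .
  qed
  have eq: "(\<Prod>i\<in>UNIV. f i (?T g $ i)) = (\<Prod>b\<in>?B. f (j b) (g b))" for g
    unfolding comp by (simp add: Basis_vec_real prod.reindex[OF inj_axis_1])
  have [measurable]: "f i \<in> borel_measurable borel" for i
    using borel_measurable_integrable[OF int[of i]] by simp
  have m: "(\<lambda>v :: real ^ 'd. \<Prod>i\<in>UNIV. f i (v $ i)) \<in> borel_measurable borel"
    by measurable
  have "integrable (\<Pi>\<^sub>M b\<in>?B. lborel) (\<lambda>g. \<Prod>b\<in>?B. f (j b) (g b))"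
    by (rule product_integrable_prod) (auto intro: int)
  then show ?I
    unfolding lb by (subst integrable_distr_eq[OF T m]) (simp only: eq)
  have "(LINT v|lborel. (\<Prod>i\<in>UNIV. f i ((v :: real ^ 'd) $ i)))
      = (LINT g|(\<Pi>\<^sub>M b\<in>?B. lborel). (\<Prod>b\<in>?B. f (j b) (g b)))"
    unfolding lb by (subst integral_distr[OF T m]) (simp only: eq)
  also have "\<dots> = (\<Prod>b\<in>?B. (LINT t|lborel. f (j b) t))"
    by (rule product_integral_prod) (auto intro: int)
  also have "\<dots> = (\<Prod>i\<in>UNIV. (LINT t|lborel. f i t))"
    unfolding Basis_vec_real by (subst prod.reindex[OF inj_axis_1]) simp
  finally show ?E .
qed

text \<open>A product over coordinates rather than a power of the norm: it matches product kernels,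
  and exponent 2 gives integrability in every dimension.\<close>

definition decay :: "nat \<Rightarrow> real ^ 'd \<Rightarrow> real" where
  "decay k v = (\<Prod>i\<in>UNIV. 1 / (1 + \<bar>v $ i\<bar>) ^ k)"

lemma decay_pos: "0 < decay k v"
  unfolding decay_def by (intro prod_pos) auto

lemma decay_nonneg: "0 \<le> decay k v"
  using decay_pos[of k v] by simp

lemma decay_le_1: "decay k v \<le> 1"
  unfolding decay_def by (intro prod_le_1) (auto simp: divide_le_eq)

lemma decay_measurable [measurable]: "decay k \<in> borel_measurable borel"
  unfolding decay_def by measurable

lemma integrable_inverse_square:
  "2 \<le> k \<Longrightarrow> integrable lborel (\<lambda>t::real. 1 / (1 + \<bar>t\<bar>) ^ k)"
proof (rule Bochner_Integration.integrable_bound)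
  have "set_integrable lborel (einterval (-\<infinity>) \<infinity>) (\<lambda>t::real. inverse (1 + t\<^sup>2))"
    by (rule integrable_inverse_1_plus_square)
  then show "integrable lborel (\<lambda>t::real. inverse (1 + t\<^sup>2))"
    by (simp add: set_integrable_def)
  assume k: "2 \<le> k"
  have le: "norm (1 / (1 + \<bar>t\<bar>) ^ k) \<le> norm (inverse (1 + t\<^sup>2))" for t :: real
  proof -
    have "1 + t\<^sup>2 \<le> (1 + \<bar>t\<bar>)\<^sup>2" by (simp add: power2_eq_square algebra_simps)
    also have "\<dots> \<le> (1 + \<bar>t\<bar>) ^ k" using k by (intro power_increasing) auto
    finally show ?thesis by (simp add: inverse_eq_divide) (auto intro!: frac_le add_pos_nonneg)
  qed
  show "AE t in lborel. norm (1 / (1 + \<bar>t :: real\<bar>) ^ k) \<le> norm (inverse (1 + t\<^sup>2))"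
    by (rule AE_I2) (rule le)
qed measurable

lemma integrable_decay: "2 \<le> k \<Longrightarrow> integrable lborel (decay k :: real ^ 'd \<Rightarrow> real)"
  unfolding decay_def
  using lborel_vec_prod(1)[of "\<lambda>_ t. 1 / (1 + \<bar>t\<bar>) ^ k"] integrable_inverse_square by blast

text \<open>Slow variation: each factor \<open>1 + \<bar>v $ i\<bar>\<close> at most doubles under a
  shift of length at most 1. This allows point values to be replaced by averages over balls.\<close>

lemma decay_shift:
  fixes v z :: "real ^ 'd"
  assumes "norm z \<le> 1"
  shows "decay k v \<le> 2 ^ (k * CARD('d)) * decay k (v + z)"
proof -
  have "decay k v \<le> (\<Prod>i\<in>UNIV. 2 ^ k * (1 / (1 + \<bar>(v + z) $ i\<bar>) ^ k))"
    unfolding decay_def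
  proof (intro prod_mono conjI)
    fix i :: 'd
    have "\<bar>z $ i\<bar> \<le> 1" using component_le_norm_cart[of z i] assms by linarith
    then have "1 + \<bar>(v + z) $ i\<bar> \<le> 2 * (1 + \<bar>v $ i\<bar>)" by simp
    then have "(1 + \<bar>(v + z) $ i\<bar>) ^ k \<le> (2 * (1 + \<bar>v $ i\<bar>)) ^ k" by (intro power_mono) auto
    then have "(1 + \<bar>(v + z) $ i\<bar>) ^ k \<le> 2 ^ k * (1 + \<bar>v $ i\<bar>) ^ k" by (simp only: power_mult_distrib)
    then show "1 / (1 + \<bar>v $ i\<bar>) ^ k \<le> 2 ^ k * (1 / (1 + \<bar>(v + z) $ i\<bar>) ^ k)"
      by (simp add: field_simps add_pos_nonneg)
  qed auto
  also have "\<dots> = 2 ^ (k * CARD('d)) * decay k (v + z)"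
    unfolding decay_def prod.distrib by (simp add: power_mult)
  finally show ?thesis .
qed

lemma one_plus_sum_le_prod:
  fixes a :: "'i \<Rightarrow> real"
  assumes "finite I" "\<And>i. i \<in> I \<Longrightarrow> 0 \<le> a i"
  shows "1 + sum a I \<le> (\<Prod>i\<in>I. 1 + a i)"
  using assms
proof (induction I rule: finite_induct)
  case (insert i I)
  have "1 + sum a (insert i I) \<le> (1 + sum a I) + a i * (1 + sum a I)"
    using insert by (auto simp: algebra_simps intro!: mult_nonneg_nonneg sum_nonneg)
  also have "\<dots> = (1 + a i) * (1 + sum a I)" by (simp add: algebra_simps)
  also have "\<dots> \<le> (1 + a i) * (\<Prod>i\<in>I. 1 + a i)"
    using insert by (intro mult_left_mono insert.IH) auto
  finally show ?case using insert by simp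
qed simp

text \<open>Since 1 + |v| is at most the product of the factors
  \<open>1 + \<bar>v $ i\<bar>\<close>, giving up \<open>s\<close> powers in every coordinate pays
  for the power \<open>s\<close> of 1 + |v|.\<close>

lemma decay_mult_norm:
  fixes v :: "real ^ 'd"
  shows "decay (s + k) v * (1 + norm v) ^ s \<le> decay k v"
proof -
  have "1 + norm v \<le> 1 + (\<Sum>i\<in>UNIV. \<bar>v $ i\<bar>)" using norm_le_l1_cart[of v] by simp
  also have "\<dots> \<le> (\<Prod>i\<in>UNIV. 1 + \<bar>v $ i\<bar>)" by (rule one_plus_sum_le_prod) auto
  finally have "(1 + norm v) ^ s \<le> (\<Prod>i\<in>UNIV. 1 + \<bar>v $ i\<bar>) ^ s"
    by (intro power_mono) auto
  then have "decay (s + k) v * (1 + norm v) ^ s \<le> decay (s + k) v * (\<Prod>i\<in>UNIV. 1 + \<bar>v $ i\<bar>) ^ s"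
    by (intro mult_left_mono decay_nonneg)
  also have "\<dots> = decay k v"
    unfolding decay_def prod_power_distrib prod.distrib[symmetric]
    by (intro prod.cong) (auto simp: power_add)
  finally show ?thesis .
qed

lemma ennreal_mult3:
  "0 \<le> a \<Longrightarrow> 0 \<le> b \<Longrightarrow> 0 \<le> c \<Longrightarrow> ennreal a * (ennreal b * ennreal c) = ennreal (a * (b * c))"
  by (simp add: ennreal_mult)

lemma nn_integral_affine:
  fixes f :: "'a::euclidean_space \<Rightarrow> ennreal"
  assumes [measurable]: "f \<in> borel_measurable borel" and "c \<noteq> 0"
  shows "(\<integral>\<^sup>+ x. f x \<partial>lborel) = ennreal (\<bar>c\<bar> ^ DIM('a)) * (\<integral>\<^sup>+ x. f (t + c *\<^sub>R x) \<partial>lborel)"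
  by (subst lborel_affine[OF \<open>c \<noteq> 0\<close>, of t])
     (simp add: nn_integral_density nn_integral_distr nn_integral_cmult)

lemma nn_integral_translate:
  fixes f :: "'a::euclidean_space \<Rightarrow> ennreal"
  assumes [measurable]: "f \<in> borel_measurable borel"
  shows "(\<integral>\<^sup>+ x. f (x + t) \<partial>lborel) = (\<integral>\<^sup>+ x. f x \<partial>lborel)"
  by (subst nn_integral_affine[of f 1 t]) (auto simp: add.commute)

lemma pnorm_le_translate:
  fixes f :: "'a::euclidean_space \<Rightarrow> real"
  assumes f: "pnorm_le lborel p f c"
  shows "pnorm_le lborel p (\<lambda>x. f (x + t)) c"
proof -
  have [measurable]: "f \<in> borel_measurable borel" using pnorm_le_measurable[OF f] by simp
  have "(\<integral>\<^sup>+ x. ennreal (\<bar>f (x + t)\<bar> powr p) \<partial>lborel) = (\<integral>\<^sup>+ x. ennreal (\<bar>f x\<bar> powr p) \<partial>lborel)"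
    by (rule nn_integral_translate) measurable
  then show ?thesis using f by (auto simp: pnorm_le_def)
qed

text \<open>Minkowski's integral inequality. The growth of the norm in the parameter is absorbed by the
  decay of the kernel, after which Jensen's inequality and Tonelli's theorem apply.\<close>

lemma pnorm_le_integral:
  fixes A :: "real ^ 'd \<Rightarrow> real" and H :: "'b::euclidean_space \<Rightarrow> real ^ 'd \<Rightarrow> real"
  assumes [measurable]: "A \<in> borel_measurable borel" "case_prod H \<in> borel_measurable (borel \<Otimes>\<^sub>M borel)"
    and A: "\<And>v. \<bar>A v\<bar> \<le> C * decay (s + 2) v"
    and H: "\<And>v. pnorm_le lborel p (\<lambda>x. H x v) (m * (1 + norm v) ^ s)"
    and m: "0 \<le> m" and p: "1 \<le> p"
  shows "pnorm_le lborel p (\<lambda>x. LINT v|lborel. A v * H x v) (C * (LINT v|lborel. decay 2 (v :: real ^ 'd)) * m)"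
proof -
  define w where "w v = C * decay 2 v" for v :: "real ^ 'd"
  define V where "V = (LINT v|lborel. w v)"
  have C: "0 \<le> C" using A[of 0] decay_pos[of "s + 2" "0 :: real ^ 'd"]
    by (smt (verit) mult_neg_pos)
  have w0: "0 \<le> w v" for v using C by (simp add: w_def decay_nonneg)
  have intw: "integrable lborel w" unfolding w_def by (intro integrable_mult_right integrable_decay) simp
  have V0: "0 \<le> V" unfolding V_def using w0 by simp
  have [measurable]: "w \<in> borel_measurable borel" unfolding w_def by measurable
  define A' where "A' v = A v * (1 + norm v) ^ s" for v
  define H' where "H' x v = inverse ((1 + norm v) ^ s) * H x v" for x v
  have [measurable]: "A' \<in> borel_measurable borel" unfolding A'_def by measurable
  have [measurable]: "case_prod H' \<in> borel_measurable (borel \<Otimes>\<^sub>M borel)"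
    unfolding H'_def by measurable
  have pos: "0 < (1 + norm v) ^ s" for v :: "real ^ 'd" by (intro zero_less_power) (simp add: add_pos_nonneg)
  have AH: "A v * H x v = A' v * H' x v" for x v
  proof -
    have "(1 + norm v) ^ s * inverse ((1 + norm v) ^ s) = 1" 
      by (rule right_inverse[OF pos[of v, THEN less_imp_neq, symmetric]])
    then show ?thesis by (simp add: A'_def H'_def)
  qed
  have A'w: "\<bar>A' v\<bar> \<le> w v" for v
  proof -
    have "\<bar>A' v\<bar> \<le> (C * decay (s + 2) v) * (1 + norm v) ^ s"
      unfolding A'_def using pos[of v] A[of v] by (simp add: abs_mult)
    also have "\<dots> \<le> C * decay 2 v"
      using mult_left_mono[OF decay_mult_norm[of s 2 v] C] by (simp add: mult.assoc)
    finally show ?thesis by (simp add: w_def)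
  qed
  have H': "pnorm_le lborel p (\<lambda>x. H' x v) m" for v
  proof -
    have "inverse ((1 + norm v) ^ s) * (1 + norm v) ^ s = 1"
      by (rule left_inverse[OF pos[of v, THEN less_imp_neq, symmetric]])
    then have eq: "\<bar>inverse ((1 + norm v) ^ s)\<bar> * (m * (1 + norm v) ^ s) = m"
      using pos[of v] by (simp add: mult.left_commute)
    show ?thesis
      using pnorm_le_cmult[OF H[of v], of "inverse ((1 + norm v) ^ s)"] unfolding H'_def eq .
  qed
  have Vm: "V powr (p - 1) * (V * m powr p) = (V * m) powr p"
    using V0 m p by (cases "V = 0") (auto simp: powr_mult powr_diff)
  have "(\<integral>\<^sup>+ x. ennreal (\<bar>LINT v|lborel. A v * H x v\<bar> powr p) \<partial>lborel)
      \<le> (\<integral>\<^sup>+ x. ennreal (V powr (p - 1)) * (\<integral>\<^sup>+ v. ennreal (w v * \<bar>H' x v\<bar> powr p) \<partial>lborel) \<partial>lborel)"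
    unfolding AH V_def by (intro nn_integral_mono abs_integral_powr_le) (auto intro: intw A'w p)
  also have "\<dots> = ennreal (V powr (p - 1)) * (\<integral>\<^sup>+ x. (\<integral>\<^sup>+ v. ennreal (w v * \<bar>H' x v\<bar> powr p) \<partial>lborel) \<partial>lborel)"
    by (rule nn_integral_cmult) measurable
  also have "(\<integral>\<^sup>+ x. (\<integral>\<^sup>+ v. ennreal (w v * \<bar>H' x v\<bar> powr p) \<partial>lborel) \<partial>lborel)
      = (\<integral>\<^sup>+ v. (\<integral>\<^sup>+ x. ennreal (w v * \<bar>H' x v\<bar> powr p) \<partial>lborel) \<partial>lborel)"
    by (rule lborel_pair.Fubini'[symmetric]) measurable
  also have "\<dots> = (\<integral>\<^sup>+ v. ennreal (w v) * (\<integral>\<^sup>+ x. ennreal (\<bar>H' x v\<bar> powr p) \<partial>lborel) \<partial>lborel)"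
    using w0 by (simp add: ennreal_mult nn_integral_cmult)
  also have "\<dots> \<le> (\<integral>\<^sup>+ v. ennreal (w v) * ennreal (m powr p) \<partial>lborel)"
    by (intro nn_integral_mono mult_left_mono pnorm_le_nn[OF H']) auto
  also have "\<dots> = (\<integral>\<^sup>+ v. ennreal (w v) \<partial>lborel) * ennreal (m powr p)"
    by (rule nn_integral_multc) measurable
  also have "(\<integral>\<^sup>+ v. ennreal (w v) \<partial>lborel) = ennreal V"
    unfolding V_def by (rule nn_integral_eq_integral[OF intw]) (simp add: w0)
  also have "ennreal (V powr (p - 1)) * (ennreal V * ennreal (m powr p)) = ennreal ((V * m) powr p)"
    using V0 by (simp add: Vm[symmetric] ennreal_mult)
  finally have "(\<integral>\<^sup>+ x. ennreal (\<bar>LINT v|lborel. A v * H x v\<bar> powr p) \<partial>lborel) \<le> ennreal ((V * m) powr p)"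
    by (simp add: mult_left_mono)
  moreover have "V = C * (LINT v|lborel. decay 2 (v :: real ^ 'd))"
    unfolding V_def w_def by simp
  ultimately show ?thesis
    unfolding pnorm_le_def using V0 m by simp
qed

text \<open>Convolution with a reflected dilate of \<open>A\<close>, with the dilation kept inside
  \<open>f\<close>. In this form \<open>t = 0\<close> and negative \<open>t\<close> make sense, and
  integrating a finite difference in direction \<open>v\<close> against \<open>A v\<close> gives a
  linear combination of such convolutions, including the one at \<open>t = 0\<close>.\<close>

definition conv :: "real \<Rightarrow> (real ^ 'd \<Rightarrow> real) \<Rightarrow> (real ^ 'd \<Rightarrow> real) \<Rightarrow> real ^ 'd \<Rightarrow> real" where
  "conv t A f x = (LINT v|lborel. A v * f (x + t *\<^sub>R v))"

section \<open>Separated point sets and samples of convolutions\<close>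

lemma separated_disjoint_balls:
  assumes "separated (2 * \<rho>) X" "\<xi> \<in> X" "\<xi>' \<in> X" "dist \<xi> z < \<rho>" "dist \<xi>' z < \<rho>"
  shows "\<xi> = \<xi>'"
proof (rule ccontr)
  assume "\<xi> \<noteq> \<xi>'"
  then have "2 * \<rho> < dist \<xi> \<xi>'" using assms by (auto simp: separated_def)
  moreover have "dist \<xi> \<xi>' \<le> dist \<xi> z + dist \<xi>' z" by (rule dist_triangle2)
  ultimately show False using assms by simp
qed

text \<open>Disjoint open balls surround the points. Countability is what permits exchanging the sum
  over \<open>X\<close> with a Lebesgue integral.\<close>

lemma countable_separated:
  fixes X :: "(real ^ 'd) set"
  assumes "separated (2 * \<rho>) X" "0 < \<rho>"
  shows "countable X"
proof -
  have "disjoint ((\<lambda>\<xi>. ball \<xi> \<rho>) ` X)"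
    unfolding disjoint_def
  proof (intro ballI impI)
    fix A B assume AB: "A \<in> (\<lambda>\<xi>. ball \<xi> \<rho>) ` X" "B \<in> (\<lambda>\<xi>. ball \<xi> \<rho>) ` X" "A \<noteq> B"
    then obtain a b where ab: "a \<in> X" "b \<in> X" "A = ball a \<rho>" "B = ball b \<rho>" by blast
    show "A \<inter> B = {}"
    proof (rule equals0I)
      fix z assume "z \<in> A \<inter> B"
      then have "a = b" using ab by (intro separated_disjoint_balls[OF assms(1), of a b z]) auto
      then show False using AB ab by simp
    qed
  qed
  then have "countable ((\<lambda>\<xi>. ball \<xi> \<rho>) ` X)"
    by (intro countable_disjoint_open_subsets) auto
  moreover have "inj_on (\<lambda>\<xi>. ball \<xi> \<rho>) X"
  proof (rule inj_onI)
    fix \<xi> \<xi>' assume "\<xi> \<in> X" "\<xi>' \<in> X" "ball \<xi> \<rho> = ball \<xi>' \<rho>"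
    then show "\<xi> = \<xi>'"
      using separated_disjoint_balls[OF assms(1), of \<xi> \<xi>' \<xi>] \<open>0 < \<rho>\<close>
      by (metis centre_in_ball dist_self mem_ball)
  qed
  ultimately show ?thesis by (rule countable_image_inj_on)
qed

text \<open>A sum compared with an integral: as \<open>\<rho> \<le> \<tau>\<close>, slow variation
  bounds each term by a constant times its average over the ball of radius \<open>\<rho>\<close>
  around the point, and these balls are disjoint. The bound depends on the scales only through
  \<open>\<tau> / \<rho>\<close>, so it is uniform when both are proportional to
  \<open>1 / \<sigma>\<close>.\<close>

lemma sum_decay_separated:
  fixes X :: "(real ^ 'd) set"
  assumes X: "separated (2 * \<rho>) X" and \<rho>: "0 < \<rho>" "\<rho> \<le> \<tau>" and k: "2 \<le> k"
  shows "(\<integral>\<^sup>+ \<xi>. ennreal (decay k ((1 / \<tau>) *\<^sub>R (y - \<xi>))) \<partial>count_space X)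
    \<le> ennreal (2 ^ (k * CARD('d)) * (\<tau> / \<rho>) ^ CARD('d)
         * (LINT v|lborel. decay k (v :: real ^ 'd)) / unit_ball_vol (real CARD('d)))"
proof -
  define b where "b = unit_ball_vol (real CARD('d)) * \<rho> ^ CARD('d)"
  have b: "0 < b" using \<rho> by (simp add: b_def)
  have \<tau>: "0 < \<tau>" using \<rho> by simp
  define K where "K = (2::real) ^ (k * CARD('d))"
  have K: "0 < K" by (simp add: K_def)
  define D where "D z = ennreal (decay k ((1 / \<tau>) *\<^sub>R (y - z)))" for z
  have [measurable]: "D \<in> borel_measurable borel" unfolding D_def by measurable
  have ctb: "countable X" using countable_separated[OF X] \<rho> by simp
  have [measurable]: "ball \<xi> \<rho> \<in> sets borel" for \<xi> :: "real ^ 'd" by simp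
  have vol: "emeasure lborel (ball \<xi> \<rho>) = ennreal b" for \<xi> :: "real ^ 'd"
    using emeasure_ball[of \<rho> \<xi>] \<rho> by (simp add: b_def)
  have 1: "ennreal b * D \<xi> \<le> ennreal K * (\<integral>\<^sup>+ z. indicator (ball \<xi> \<rho>) z * D z \<partial>lborel)" for \<xi>
  proof -
    have "ennreal b * D \<xi> = (\<integral>\<^sup>+ z. D \<xi> * indicator (ball \<xi> \<rho>) z \<partial>lborel)"
      by (subst nn_integral_cmult_indicator) (auto simp: vol mult.commute)
    also have "\<dots> \<le> (\<integral>\<^sup>+ z. ennreal K * (indicator (ball \<xi> \<rho>) z * D z) \<partial>lborel)"
    proof (intro nn_integral_mono)
      fix z :: "real ^ 'd"
      show "D \<xi> * indicator (ball \<xi> \<rho>) z \<le> ennreal K * (indicator (ball \<xi> \<rho>) z * D z)"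
      proof (cases "z \<in> ball \<xi> \<rho>")
        case True
        have "norm ((1 / \<tau>) *\<^sub>R (\<xi> - z)) = dist \<xi> z / \<tau>"
          using \<tau> by (simp add: dist_norm divide_inverse)
        also have "\<dots> \<le> 1" using True \<rho> \<tau> by (simp add: divide_le_eq)
        finally have "decay k ((1 / \<tau>) *\<^sub>R (y - \<xi>))
            \<le> K * decay k ((1 / \<tau>) *\<^sub>R (y - \<xi>) + (1 / \<tau>) *\<^sub>R (\<xi> - z))"
          unfolding K_def by (rule decay_shift)
        also have "(1 / \<tau>) *\<^sub>R (y - \<xi>) + (1 / \<tau>) *\<^sub>R (\<xi> - z) = (1 / \<tau>) *\<^sub>R (y - z)"
          by (simp add: scaleR_add_right[symmetric])
        finally have "decay k ((1 / \<tau>) *\<^sub>R (y - \<xi>)) \<le> K * decay k ((1 / \<tau>) *\<^sub>R (y - z))" .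
        then show ?thesis
          using True K by (simp add: D_def ennreal_mult[symmetric] decay_nonneg ennreal_leI)
      qed simp
    qed
    also have "\<dots> = ennreal K * (\<integral>\<^sup>+ z. indicator (ball \<xi> \<rho>) z * D z \<partial>lborel)"
      by (rule nn_integral_cmult) measurable
    finally show ?thesis .
  qed
  \<comment> \<open>A point \<open>z\<close> lies in at most one of the balls, so the sum over
    centres has at most one nonzero term.\<close>
  have 2: "(\<integral>\<^sup>+ \<xi>. indicator (ball \<xi> \<rho>) z * D z \<partial>count_space X) \<le> D z" for z
  proof -
    have "(\<integral>\<^sup>+ \<xi>. indicator (ball \<xi> \<rho>) z * D z \<partial>count_space X)
        = (\<integral>\<^sup>+ \<xi>. indicator {\<xi> \<in> X. z \<in> ball \<xi> \<rho>} \<xi> * D z \<partial>count_space X)"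
      by (intro nn_integral_cong) (auto simp: indicator_def)
    also have "\<dots> = emeasure (count_space X) {\<xi> \<in> X. z \<in> ball \<xi> \<rho>} * D z"
      by (subst nn_integral_multc) (auto simp: nn_integral_indicator)
    also have "\<dots> \<le> 1 * D z"
    proof (rule mult_right_mono)
      have "\<xi> = \<xi>'" if "\<xi> \<in> X" "\<xi>' \<in> X" "z \<in> ball \<xi> \<rho>" "z \<in> ball \<xi>' \<rho>" for \<xi> \<xi>'
        using separated_disjoint_balls[OF X that(1,2), of z] that by simp
      then have "\<exists>\<xi>. {\<xi> \<in> X. z \<in> ball \<xi> \<rho>} \<subseteq> {\<xi>}" by blast
      then obtain \<xi> where "{\<xi> \<in> X. z \<in> ball \<xi> \<rho>} \<subseteq> {\<xi>}" by blast
      then have "{\<xi> \<in> X. z \<in> ball \<xi> \<rho>} = {} \<or> {\<xi> \<in> X. z \<in> ball \<xi> \<rho>} = {\<xi>}" by blast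
      then show "emeasure (count_space X) {\<xi> \<in> X. z \<in> ball \<xi> \<rho>} \<le> 1"
      proof (rule disjE)
        assume *: "{\<xi> \<in> X. z \<in> ball \<xi> \<rho>} = {\<xi>}"
        then have "\<xi> \<in> X" by blast
        then show ?thesis unfolding * by (simp add: emeasure_count_space)
      next
        assume *: "{\<xi> \<in> X. z \<in> ball \<xi> \<rho>} = {}"
        show ?thesis unfolding * by simp
      qed
    qed simp
    finally show ?thesis by simp
  qed
  have "ennreal b * (\<integral>\<^sup>+ \<xi>. D \<xi> \<partial>count_space X) = (\<integral>\<^sup>+ \<xi>. ennreal b * D \<xi> \<partial>count_space X)"
    by (simp add: nn_integral_cmult)
  also have "\<dots> \<le> (\<integral>\<^sup>+ \<xi>. ennreal K * (\<integral>\<^sup>+ z. indicator (ball \<xi> \<rho>) z * D z \<partial>lborel) \<partial>count_space X)"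
    by (intro nn_integral_mono 1)
  also have "\<dots> = ennreal K * (\<integral>\<^sup>+ \<xi>. (\<integral>\<^sup>+ z. indicator (ball \<xi> \<rho>) z * D z \<partial>lborel) \<partial>count_space X)"
    by (simp add: nn_integral_cmult)
  also have "(\<integral>\<^sup>+ \<xi>. (\<integral>\<^sup>+ z. indicator (ball \<xi> \<rho>) z * D z \<partial>lborel) \<partial>count_space X)
      = (\<integral>\<^sup>+ z. (\<integral>\<^sup>+ \<xi>. indicator (ball \<xi> \<rho>) z * D z \<partial>count_space X) \<partial>lborel)"
    by (rule nn_integral_count_space_nn_integral[symmetric, OF ctb]) measurable
  also have "ennreal K * \<dots> \<le> ennreal K * (\<integral>\<^sup>+ z. D z \<partial>lborel)"
    by (intro mult_left_mono nn_integral_mono 2) auto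
  also have "(\<integral>\<^sup>+ z. D z \<partial>lborel) = ennreal (\<tau> ^ CARD('d)) * (\<integral>\<^sup>+ z. ennreal (decay k (z :: real ^ 'd)) \<partial>lborel)"
    using \<tau> by (subst nn_integral_affine[of D "- \<tau>" y]) (auto simp: D_def)
  also have "(\<integral>\<^sup>+ z. ennreal (decay k (z :: real ^ 'd)) \<partial>lborel) = ennreal (LINT v|lborel. decay k (v :: real ^ 'd))"
    using k by (intro nn_integral_eq_integral integrable_decay) (auto simp: decay_nonneg)
  finally have *: "ennreal b * (\<integral>\<^sup>+ \<xi>. D \<xi> \<partial>count_space X)
      \<le> ennreal (K * (\<tau> ^ CARD('d) * (LINT v|lborel. decay k (v :: real ^ 'd))))"
    using K \<tau> by (simp add: ennreal_mult decay_nonneg)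
  have "(\<integral>\<^sup>+ \<xi>. D \<xi> \<partial>count_space X) = ennreal (1 / b) * (ennreal b * (\<integral>\<^sup>+ \<xi>. D \<xi> \<partial>count_space X))"
    using b by (simp add: mult.assoc[symmetric] ennreal_mult[symmetric])
  also have "\<dots> \<le> ennreal (1 / b) * ennreal (K * (\<tau> ^ CARD('d) * (LINT v|lborel. decay k (v :: real ^ 'd))))"
    by (intro mult_left_mono *) simp
  also have "\<dots> = ennreal (1 / b * (K * (\<tau> ^ CARD('d) * (LINT v|lborel. decay k (v :: real ^ 'd)))))"
    using b K \<tau> by (intro ennreal_mult[symmetric] mult_nonneg_nonneg) (auto simp: decay_nonneg)
  also have "1 / b * (K * (\<tau> ^ CARD('d) * (LINT v|lborel. decay k (v :: real ^ 'd))))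
     = 2 ^ (k * CARD('d)) * (\<tau> / \<rho>) ^ CARD('d)
         * (LINT v|lborel. decay k (v :: real ^ 'd)) / unit_ball_vol (real CARD('d))"
    unfolding b_def K_def by (simp add: power_divide mult_ac)
  finally show ?thesis by (simp add: D_def)
qed

text \<open>Boundedness of an operator family from the p-norm to the sampled norm. The constant is
  quantified before \<open>\<sigma>\<close> and \<open>X\<close>; this uniformity makes the
  constants of the theorem independent of \<open>\<sigma>\<close>.\<close>

definition sample_stable :: "real \<Rightarrow> real \<Rightarrow> (real \<Rightarrow> (real ^ 'd \<Rightarrow> real) \<Rightarrow> real ^ 'd \<Rightarrow> real) \<Rightarrow> bool" where
  "sample_stable p \<gamma> T \<longleftrightarrow> (\<exists>B\<ge>0. \<forall>\<sigma> X f c. 0 < \<sigma> \<longrightarrow> separated (2 * \<gamma> / \<sigma>) X \<longrightarrow>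
     pnorm_le lborel p f c \<longrightarrow> pnorm_le (sample_measure \<sigma> X) p (T \<sigma> f) (B * c))"

lemma sample_stable_lincomb:
  fixes T :: "'i \<Rightarrow> real \<Rightarrow> (real ^ 'd \<Rightarrow> real) \<Rightarrow> real ^ 'd \<Rightarrow> real"
  assumes p: "1 \<le> p" and T: "\<And>i. i \<in> I \<Longrightarrow> sample_stable p \<gamma> (T i)"
    and eq: "\<And>\<sigma> f. 0 < \<sigma> \<Longrightarrow> f \<in> borel_measurable borel \<Longrightarrow> T' \<sigma> f = (\<lambda>x. \<Sum>i\<in>I. a i * T i \<sigma> f x)"
  shows "sample_stable p \<gamma> T'"
proof -
  obtain B where B: "\<And>i. i \<in> I \<Longrightarrow> 0 \<le> B i"
    "\<And>i \<sigma> X f c. i \<in> I \<Longrightarrow> 0 < \<sigma> \<Longrightarrow> separated (2 * \<gamma> / \<sigma>) X \<Longrightarrow> pnorm_le lborel p f c \<Longrightarrow>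
      pnorm_le (sample_measure \<sigma> X) p (T i \<sigma> f) (B i * c)"
    using T unfolding sample_stable_def by metis
  show ?thesis
    unfolding sample_stable_def
  proof (intro exI[of _ "\<Sum>i\<in>I. \<bar>a i\<bar> * B i"] conjI allI impI)
    show "0 \<le> (\<Sum>i\<in>I. \<bar>a i\<bar> * B i)" using B(1) by (intro sum_nonneg) simp
    fix \<sigma> c and X :: "(real ^ 'd) set" and f :: "real ^ 'd \<Rightarrow> real"
    assume *: "0 < \<sigma>" "separated (2 * \<gamma> / \<sigma>) X" "pnorm_le lborel p f c"
    have "f \<in> borel_measurable borel" using pnorm_le_measurable[OF *(3)] by simp
    moreover have "pnorm_le (sample_measure \<sigma> X) p (\<lambda>x. \<Sum>i\<in>I. a i * T i \<sigma> f x) (\<Sum>i\<in>I. \<bar>a i\<bar> * (B i * c))"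
      using B(2) * by (intro pnorm_le_sum pnorm_le_cmult p) auto
    ultimately show "pnorm_le (sample_measure \<sigma> X) p (T' \<sigma> f) ((\<Sum>i\<in>I. \<bar>a i\<bar> * B i) * c)"
      using * by (simp add: eq sum_distrib_right mult.assoc)
  qed
qed

text \<open>This takes the place of the Plancherel--Polya inequality: band-limited functions are never
  sampled directly, only convolutions with a decaying kernel whose width is proportional to
  the mesh.\<close>

lemma sample_stable_conv:
  fixes A :: "real ^ 'd \<Rightarrow> real"
  assumes [measurable]: "A \<in> borel_measurable borel"
    and A: "\<And>v. \<bar>A v\<bar> \<le> C * decay k v" and k: "2 \<le> k"
    and p: "1 \<le> p" and \<kappa>: "0 < \<kappa>" and \<gamma>: "0 < \<gamma>"
  shows "sample_stable p \<gamma> (\<lambda>\<sigma>. conv (\<kappa> / \<sigma>) A)"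
proof -
  define d where "d = CARD('d)"
  define I where "I = (LINT v|lborel. decay k (v :: real ^ 'd))"
  \<comment> \<open>The comparison of sum and integral needs balls that are disjoint (radius at most
    \<open>\<gamma> / \<sigma>\<close>) and no larger than the kernel width
    \<open>\<kappa> / \<sigma>\<close>.\<close>
  define \<eta> where "\<eta> = min \<gamma> \<kappa>"
  define S where "S = 2 ^ (k * d) * (\<kappa> / \<eta>) ^ d * I / unit_ball_vol (real d)"
  define B' where "B' = (C * I) powr (p - 1) * (C * (S / \<kappa> ^ d))"
  have \<eta>: "0 < \<eta>" "\<eta> \<le> \<kappa>" "\<eta> \<le> \<gamma>" using \<kappa> \<gamma> by (auto simp: \<eta>_def)
  have C: "0 \<le> C" using A[of 0] decay_pos[of k "0 :: real ^ 'd"]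
    by (smt (verit) mult_neg_pos)
  have I0: "0 \<le> I" unfolding I_def by (simp add: decay_nonneg)
  have S0: "0 \<le> S" unfolding S_def using I0 \<kappa> \<eta> by simp
  have B0: "0 \<le> B'" unfolding B'_def using C S0 \<kappa> by simp
  show ?thesis
    unfolding sample_stable_def
  proof (intro exI[of _ "B' powr (1 / p)"] conjI allI impI)
    fix \<sigma> :: real and X :: "(real ^ 'd) set" and f :: "real ^ 'd \<Rightarrow> real" and c
    assume \<sigma>: "0 < \<sigma>" and X: "separated (2 * \<gamma> / \<sigma>) X" and f: "pnorm_le lborel p f c"
    define \<tau> where "\<tau> = \<kappa> / \<sigma>"
    have \<tau>: "0 < \<tau>" using \<kappa> \<sigma> by (simp add: \<tau>_def)
    have [measurable]: "f \<in> borel_measurable borel" using pnorm_le_measurable[OF f] by simp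
    have c: "0 \<le> c" using pnorm_le_nonneg[OF f] .
    have X': "separated (2 * (\<eta> / \<sigma>)) X"
    proof -
      have "2 * (\<eta> / \<sigma>) \<le> 2 * \<gamma> / \<sigma>" using \<eta> \<sigma> by (simp add: divide_right_mono)
      then show ?thesis using X unfolding separated_def by force
    qed
    have ctb: "countable X" using countable_separated[OF X'] \<eta> \<sigma> by simp
    have S: "(\<integral>\<^sup>+ \<xi>. ennreal (decay k ((1 / \<tau>) *\<^sub>R (y - \<xi>))) \<partial>count_space X) \<le> ennreal S" for y
    proof -
      have "\<eta> / \<sigma> \<le> \<tau>" using \<eta> \<sigma> by (simp add: \<tau>_def divide_right_mono)
      moreover have "\<tau> / (\<eta> / \<sigma>) = \<kappa> / \<eta>" using \<sigma> by (simp add: \<tau>_def)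
      ultimately show ?thesis
        using sum_decay_separated[OF X' _ _ k, of \<tau> y] \<eta> \<sigma> by (simp add: S_def I_def d_def)
    qed
    define F where "F y = ennreal (\<bar>f y\<bar> powr p)" for y
    have [measurable]: "F \<in> borel_measurable borel" unfolding F_def by measurable
    have 1: "ennreal (\<bar>conv \<tau> A f \<xi>\<bar> powr p) \<le> ennreal ((C * I) powr (p - 1)) *
        (ennreal (C / \<tau> ^ d) * (\<integral>\<^sup>+ y. ennreal (decay k ((1 / \<tau>) *\<^sub>R (y - \<xi>))) * F y \<partial>lborel))" for \<xi>
    proof -
      have "ennreal (\<bar>conv \<tau> A f \<xi>\<bar> powr p) \<le> ennreal ((LINT v|lborel. C * decay k (v :: real ^ 'd)) powr (p - 1)) *
          (\<integral>\<^sup>+ v. ennreal (C * decay k v * \<bar>f (\<xi> + \<tau> *\<^sub>R v)\<bar> powr p) \<partial>lborel)"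
        unfolding conv_def using A p k
        by (intro abs_integral_powr_le integrable_mult_right integrable_decay) auto
      also have "(LINT v|lborel. C * decay k (v :: real ^ 'd)) = C * I"
        by (simp add: I_def)
      also have "(\<integral>\<^sup>+ v. ennreal (C * decay k v * \<bar>f (\<xi> + \<tau> *\<^sub>R v)\<bar> powr p) \<partial>lborel)
          = (\<integral>\<^sup>+ v. ennreal C * (ennreal (decay k v) * F (\<xi> + \<tau> *\<^sub>R v)) \<partial>lborel)"
        using C by (simp add: F_def ennreal_mult decay_nonneg mult.assoc)
      also have "\<dots> = ennreal C * (\<integral>\<^sup>+ v. ennreal (decay k v) * F (\<xi> + \<tau> *\<^sub>R v) \<partial>lborel)"
        by (rule nn_integral_cmult) measurable
      also have "(\<integral>\<^sup>+ v. ennreal (decay k v) * F (\<xi> + \<tau> *\<^sub>R v) \<partial>lborel)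
          = ennreal (1 / \<tau> ^ d) * (\<integral>\<^sup>+ y. ennreal (decay k ((1 / \<tau>) *\<^sub>R (y - \<xi>))) * F y \<partial>lborel)"
        using \<tau>
        by (subst (2) nn_integral_affine[of _ \<tau> \<xi>])
           (auto simp: d_def mult.assoc[symmetric] ennreal_mult[symmetric])
      finally show ?thesis using C \<tau> by (simp add: mult.assoc[symmetric] ennreal_mult[symmetric])
    qed
    have 2: "(\<integral>\<^sup>+ \<xi>. (\<integral>\<^sup>+ y. ennreal (decay k ((1 / \<tau>) *\<^sub>R (y - \<xi>))) * F y \<partial>lborel) \<partial>count_space X)
       \<le> ennreal (S * c powr p)"
    proof -
      have "(\<integral>\<^sup>+ \<xi>. (\<integral>\<^sup>+ y. ennreal (decay k ((1 / \<tau>) *\<^sub>R (y - \<xi>))) * F y \<partial>lborel) \<partial>count_space X)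
        = (\<integral>\<^sup>+ y. (\<integral>\<^sup>+ \<xi>. ennreal (decay k ((1 / \<tau>) *\<^sub>R (y - \<xi>))) * F y \<partial>count_space X) \<partial>lborel)"
        by (rule nn_integral_count_space_nn_integral[symmetric, OF ctb]) measurable
      also have "\<dots> = (\<integral>\<^sup>+ y. (\<integral>\<^sup>+ \<xi>. ennreal (decay k ((1 / \<tau>) *\<^sub>R (y - \<xi>))) \<partial>count_space X) * F y \<partial>lborel)"
        by (intro nn_integral_cong nn_integral_multc) simp
      also have "\<dots> \<le> (\<integral>\<^sup>+ y. ennreal S * F y \<partial>lborel)"
        by (intro nn_integral_mono mult_right_mono S) simp
      also have "\<dots> = ennreal S * (\<integral>\<^sup>+ y. F y \<partial>lborel)"
        by (rule nn_integral_cmult) measurable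
      also have "\<dots> \<le> ennreal S * ennreal (c powr p)"
        unfolding F_def by (intro mult_left_mono pnorm_le_nn[OF f]) simp
      finally show ?thesis using S0 by (simp add: ennreal_mult)
    qed
    have "(\<integral>\<^sup>+ \<xi>. ennreal (\<bar>conv \<tau> A f \<xi>\<bar> powr p) \<partial>count_space X)
       \<le> (\<integral>\<^sup>+ \<xi>. ennreal ((C * I) powr (p - 1)) * (ennreal (C / \<tau> ^ d) *
          (\<integral>\<^sup>+ y. ennreal (decay k ((1 / \<tau>) *\<^sub>R (y - \<xi>))) * F y \<partial>lborel)) \<partial>count_space X)"
      by (intro nn_integral_mono 1)
    also have "\<dots> = ennreal ((C * I) powr (p - 1)) * (ennreal (C / \<tau> ^ d) *
          (\<integral>\<^sup>+ \<xi>. (\<integral>\<^sup>+ y. ennreal (decay k ((1 / \<tau>) *\<^sub>R (y - \<xi>))) * F y \<partial>lborel) \<partial>count_space X))"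
      by (simp add: nn_integral_cmult)
    also have "\<dots> \<le> ennreal ((C * I) powr (p - 1)) * (ennreal (C / \<tau> ^ d) * ennreal (S * c powr p))"
      by (intro mult_left_mono 2) auto
    also have "\<dots> = ennreal ((C * I) powr (p - 1) * (C / \<tau> ^ d * (S * c powr p)))"
      using C \<tau> S0 by (intro ennreal_mult3) auto
    finally have 3: "(\<integral>\<^sup>+ \<xi>. ennreal (\<bar>conv \<tau> A f \<xi>\<bar> powr p) \<partial>count_space X)
       \<le> ennreal ((C * I) powr (p - 1) * (C / \<tau> ^ d * (S * c powr p)))" .
    have "(\<integral>\<^sup>+ \<xi>. ennreal (\<bar>conv \<tau> A f \<xi>\<bar> powr p) \<partial>sample_measure \<sigma> X)
       \<le> ennreal (\<sigma> powr (- real d)) * ennreal ((C * I) powr (p - 1) * (C / \<tau> ^ d * (S * c powr p)))"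
      unfolding nn_integral_sample_measure d_def[symmetric] by (intro mult_left_mono 3) simp
    also have "\<dots> = ennreal (\<sigma> powr (- real d) * ((C * I) powr (p - 1) * (C / \<tau> ^ d * (S * c powr p))))"
      using C \<tau> S0 by (intro ennreal_mult''[symmetric]) simp
    \<comment> \<open>The weight of the sample measure cancels against the Jacobian
      \<open>1 / \<tau> ^ d\<close> of the dilation \<open>\<tau> = \<kappa> / \<sigma>\<close>: no
      power of \<open>\<sigma>\<close> survives.\<close>
    also have "\<sigma> powr (- real d) * ((C * I) powr (p - 1) * (C / \<tau> ^ d * (S * c powr p))) = B' * c powr p"
      using \<sigma> \<kappa> by (simp add: B'_def \<tau>_def powr_minus powr_realpow field_simps)
    also have "\<dots> = (B' powr (1 / p) * c) powr p"
      using B0 c p by (simp add: powr_mult powr_powr)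
    finally show "pnorm_le (sample_measure \<sigma> X) p (conv (\<kappa> / \<sigma>) A f) (B' powr (1 / p) * c)"
      unfolding pnorm_le_def using c by (simp add: \<tau>_def sample_measure_def)
  qed simp
qed

subsection \<open>Finite differences and ball averages\<close>

text \<open>Finite differences are iterates of this operator, so the facts on changing step and
  order become inductions over commuting operators instead of manipulations of binomial
  sums.\<close>

definition diff_op :: "'a \<Rightarrow> ('a::real_vector \<Rightarrow> real) \<Rightarrow> 'a \<Rightarrow> real" where
  "diff_op h F x = F (x + h) - F x"

lemma fin_diff_eq_sum:
  "fin_diff s h f x = (\<Sum>i\<le>s. (- 1) ^ (s - i) * real (s choose i) * f (x + real i *\<^sub>R h))"
  unfolding fin_diff_def atLeast0AtMost
  by (rule sum.reindex_bij_witness[of _ "\<lambda>i. s - i" "\<lambda>i. s - i"])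
     (auto simp: binomial_symmetric[symmetric])

lemma fin_diff_Suc: "fin_diff (Suc s) h f x = fin_diff s h f (x + h) - fin_diff s h f x"
proof -
  let ?c = "\<lambda>n i. (- 1) ^ (n - i) * real (n choose i)"
  let ?f = "\<lambda>i. f (x + real i *\<^sub>R h)"
  have "fin_diff (Suc s) h f x = ?c (Suc s) 0 * ?f 0 + (\<Sum>i\<le>s. ?c (Suc s) (Suc i) * ?f (Suc i))"
    unfolding fin_diff_eq_sum by (subst sum.atMost_Suc_shift) simp
  also have "(\<Sum>i\<le>s. ?c (Suc s) (Suc i) * ?f (Suc i))
      = (\<Sum>i\<le>s. ?c s i * ?f (Suc i)) + (\<Sum>i\<le>s. (- 1) ^ (s - i) * real (s choose Suc i) * ?f (Suc i))"
    by (simp add: sum.distrib[symmetric] algebra_simps)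
  also have "(\<Sum>i\<le>s. (- 1) ^ (s - i) * real (s choose Suc i) * ?f (Suc i))
      = - (\<Sum>i<s. ?c s (Suc i) * ?f (Suc i))"
  proof -
    have "(\<Sum>i\<le>s. (- 1) ^ (s - i) * real (s choose Suc i) * ?f (Suc i))
      = (\<Sum>i<s. (- 1) ^ (s - i) * real (s choose Suc i) * ?f (Suc i))"
      by (simp add: lessThan_Suc_atMost[symmetric])
    also have "\<dots> = - (\<Sum>i<s. ?c s (Suc i) * ?f (Suc i))"
      unfolding sum_negf[symmetric]
    proof (intro sum.cong refl)
      fix i assume "i \<in> {..<s}"
      then have "s - i = Suc (s - Suc i)" by auto
      then show "(- 1) ^ (s - i) * real (s choose Suc i) * ?f (Suc i) = - (?c s (Suc i) * ?f (Suc i))"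
        by simp
    qed
    finally show ?thesis .
  qed
  also have "?c (Suc s) 0 * ?f 0 + ((\<Sum>i\<le>s. ?c s i * ?f (Suc i)) + - (\<Sum>i<s. ?c s (Suc i) * ?f (Suc i)))
      = (\<Sum>i\<le>s. ?c s i * ?f (Suc i)) - (?c s 0 * ?f 0 + (\<Sum>i<s. ?c s (Suc i) * ?f (Suc i)))"
    by simp
  also have "?c s 0 * ?f 0 + (\<Sum>i<s. ?c s (Suc i) * ?f (Suc i)) = (\<Sum>i\<le>s. ?c s i * ?f i)"
    by (simp only: sum.atMost_shift)
  finally show ?thesis
    unfolding fin_diff_eq_sum by (simp add: scaleR_add_left add.assoc)
qed

lemma fin_diff_eq_funpow: "fin_diff s h f = (diff_op h ^^ s) f"
proof (induction s)
  case 0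
  show ?case by (auto simp: fin_diff_eq_sum)
next
  case (Suc s)
  then show ?case by (auto simp: fin_diff_Suc diff_op_def)
qed

lemma diff_op_commute: "diff_op h (diff_op k F) = diff_op k (diff_op h F)"
  by (auto simp: diff_op_def add_ac)

lemma diff_op_funpow_commute: "diff_op h ((diff_op k ^^ n) F) = (diff_op k ^^ n) (diff_op h F)"
  by (induction n) (auto simp: diff_op_commute[of h k])

text \<open>Telescoping: a difference with step \<open>n\<close> times \<open>h\<close> is a sum of
  \<open>n\<close> translates of the difference with step \<open>h\<close>.\<close>

lemma pnorm_le_diff_op_multiple:
  fixes F :: "'a::euclidean_space \<Rightarrow> real"
  assumes "pnorm_le lborel p (diff_op h F) c" and p: "1 \<le> p"
  shows "pnorm_le lborel p (diff_op (real n *\<^sub>R h) F) (real n * c)"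
proof -
  have "diff_op (real n *\<^sub>R h) F x = (\<Sum>k<n. diff_op h F (x + real k *\<^sub>R h))" for x
    unfolding diff_op_def
    using sum_lessThan_telescope[of "\<lambda>k. F (x + real k *\<^sub>R h)" n]
    by (simp add: scaleR_add_left add_ac)
  then have eq: "diff_op (real n *\<^sub>R h) F = (\<lambda>x. \<Sum>k<n. diff_op h F (x + real k *\<^sub>R h))" by auto
  have "pnorm_le lborel p (\<lambda>x. \<Sum>k<n. diff_op h F (x + real k *\<^sub>R h)) (\<Sum>k<n. c)"
    using assms by (intro pnorm_le_sum pnorm_le_translate)
  then show ?thesis unfolding eq by simp
qed

text \<open>The steps are lengthened one factor at a time. The statement keeps \<open>a\<close>
  lengthened and \<open>b\<close> original factors because the induction has to trade one kind for
  the other; the case \<open>b = 0\<close> is the one that is used.\<close>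

lemma pnorm_le_funpow_multiple:
  fixes F :: "'a::euclidean_space \<Rightarrow> real"
  assumes "pnorm_le lborel p ((diff_op h ^^ (a + b)) F) c" and p: "1 \<le> p"
  shows "pnorm_le lborel p ((diff_op (real n *\<^sub>R h) ^^ a) ((diff_op h ^^ b) F)) (real n ^ a * c)"
  using assms(1)
proof (induction a arbitrary: b)
  case (Suc a)
  have "pnorm_le lborel p ((diff_op (real n *\<^sub>R h) ^^ a) ((diff_op h ^^ Suc b) F)) (real n ^ a * c)"
    using Suc.prems by (intro Suc.IH) simp
  then have "pnorm_le lborel p (diff_op h ((diff_op (real n *\<^sub>R h) ^^ a) ((diff_op h ^^ b) F))) (real n ^ a * c)"
    by (simp add: diff_op_funpow_commute)
  from pnorm_le_diff_op_multiple[OF this p, of n] show ?case by (simp add: mult.assoc)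
qed simp

text \<open>An upper bound for the modulus of smoothness that avoids the supremum and, through
  \<open>pnorm_le\<close>, includes measurability and finiteness of every difference
  involved.\<close>

definition modulus_le :: "real \<Rightarrow> nat \<Rightarrow> (real ^ 'd \<Rightarrow> real) \<Rightarrow> real \<Rightarrow> real \<Rightarrow> bool" where
  "modulus_le p s f \<delta> m \<longleftrightarrow> (\<forall>h. norm h < \<delta> \<longrightarrow> pnorm_le lborel p (fin_diff s h f) m)"

text \<open>The Jackson-type counterpart of \<open>sample_stable\<close>: the output is bounded by
  the modulus of the input, uniformly in the scale. Inputs are integrable because the identities
  that express errors through differences are proved for such functions.\<close>

definition modulus_stable :: "real \<Rightarrow> nat \<Rightarrow> (real \<Rightarrow> (real ^ 'd \<Rightarrow> real) \<Rightarrow> real ^ 'd \<Rightarrow> real) \<Rightarrow> bool" where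
  "modulus_stable p s T \<longleftrightarrow> (\<exists>B\<ge>0. \<forall>h \<delta> m. integrable lborel h \<longrightarrow> 0 < \<delta> \<longrightarrow>
     modulus_le p s h \<delta> m \<longrightarrow> pnorm_le lborel p (T \<delta> h) (B * m))"

lemma modulus_stable_lincomb:
  fixes T :: "'i \<Rightarrow> real \<Rightarrow> (real ^ 'd \<Rightarrow> real) \<Rightarrow> real ^ 'd \<Rightarrow> real"
  assumes p: "1 \<le> p" and T: "\<And>i. i \<in> I \<Longrightarrow> modulus_stable p s (T i)"
    and eq: "\<And>\<delta> h. 0 < \<delta> \<Longrightarrow> integrable lborel h \<Longrightarrow> T' \<delta> h = (\<lambda>x. \<Sum>i\<in>I. a i * T i \<delta> h x)"
  shows "modulus_stable p s T'"
proof -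
  obtain B where B: "\<And>i. i \<in> I \<Longrightarrow> 0 \<le> B i"
    "\<And>i h \<delta> m. i \<in> I \<Longrightarrow> integrable lborel h \<Longrightarrow> 0 < \<delta> \<Longrightarrow> modulus_le p s h \<delta> m \<Longrightarrow>
      pnorm_le lborel p (T i \<delta> h) (B i * m)"
    using T unfolding modulus_stable_def by metis
  show ?thesis
    unfolding modulus_stable_def
  proof (intro exI[of _ "\<Sum>i\<in>I. \<bar>a i\<bar> * B i"] conjI allI impI)
    show "0 \<le> (\<Sum>i\<in>I. \<bar>a i\<bar> * B i)" using B(1) by (intro sum_nonneg) simp
    fix h :: "real ^ 'd \<Rightarrow> real" and \<delta> m
    assume *: "integrable lborel h" "0 < \<delta>" "modulus_le p s h \<delta> m"
    have "pnorm_le lborel p (\<lambda>x. \<Sum>i\<in>I. a i * T i \<delta> h x) (\<Sum>i\<in>I. \<bar>a i\<bar> * (B i * m))"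
      using B(2) * by (intro pnorm_le_sum pnorm_le_cmult p) auto
    then show "pnorm_le lborel p (T' \<delta> h) ((\<Sum>i\<in>I. \<bar>a i\<bar> * B i) * m)"
      using * by (simp add: eq sum_distrib_right mult.assoc)
  qed
qed

lemma modulus_le_nonneg:
  assumes "modulus_le p s h \<delta> m" "0 < \<delta>"
  shows "0 \<le> m"
  using assms pnorm_le_nonneg unfolding modulus_le_def by (metis norm_zero)

text \<open>The classical growth of the modulus: the long step is cut into \<open>n\<close> equal
  parts shorter than \<open>\<delta>\<close>, at the price of a factor \<open>n ^ s\<close>, and
  \<open>n\<close> is at most K (1 + |v|) because \<open>K\<close> is at least 1.\<close>

lemma pnorm_le_fin_diff_growth:
  fixes f :: "real ^ 'd \<Rightarrow> real"
  assumes f: "modulus_le p s f \<delta> m" and p: "1 \<le> p" and \<delta>: "0 < \<delta>" and K: "1 \<le> K"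
  shows "pnorm_le lborel p (fin_diff s ((K * \<delta>) *\<^sub>R v) f) (K ^ s * m * (1 + norm v) ^ s)"
proof -
  \<comment> \<open>Strictly greater than K |v|, as the modulus admits only steps strictly shorter
    than \<open>\<delta>\<close>; also nonzero for \<open>v = 0\<close>.\<close>
  define n where "n = Suc (nat \<lfloor>K * norm v\<rfloor>)"
  have Kv: "0 \<le> K * norm v" using K by simp
  have n: "K * norm v < real n" "real n \<le> K * norm v + 1"
    using Kv unfolding n_def by (auto simp: of_nat_nat) linarith+
  define h where "h = ((K * \<delta>) / real n) *\<^sub>R v"
  have "norm h = \<delta> * (K * norm v / real n)" using K \<delta> by (simp add: h_def)
  also have "\<dots> < \<delta> * 1" using n \<delta> Kv by (intro mult_strict_left_mono) (auto simp: divide_less_eq n_def)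
  finally have h: "norm h < \<delta>" by simp
  have m: "pnorm_le lborel p ((diff_op h ^^ (s + 0)) f) m"
    using f h by (simp add: modulus_le_def fin_diff_eq_funpow)
  have nh: "real n *\<^sub>R h = (K * \<delta>) *\<^sub>R v" by (simp add: h_def n_def)
  have "pnorm_le lborel p (fin_diff s ((K * \<delta>) *\<^sub>R v) f) (real n ^ s * m)"
    using pnorm_le_funpow_multiple[OF m p, of n] by (simp add: nh fin_diff_eq_funpow)
  moreover have "real n ^ s * m \<le> K ^ s * m * (1 + norm v) ^ s"
  proof -
    have "real n \<le> K * (1 + norm v)" using n K by (simp add: algebra_simps)
    then have "real n ^ s \<le> (K * (1 + norm v)) ^ s" by (intro power_mono) auto
    from mult_right_mono[OF this pnorm_le_nonneg[OF m]] show ?thesis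
      by (simp add: power_mult_distrib mult_ac)
  qed
  ultimately show ?thesis using pnorm_le_mono p by blast
qed

text \<open>Every additional difference costs at most a factor 2. It is needed because the averaging
  error is a difference of order \<open>2 * r\<close>, while the modulus has order
  \<open>s\<close>.\<close>

lemma modulus_le_higher:
  assumes f: "modulus_le p s f \<delta> m" and p: "1 \<le> p" and "s \<le> k"
  shows "modulus_le p k f \<delta> (2 ^ (k - s) * m)"
proof -
  have "pnorm_le lborel p ((diff_op h ^^ (n + s)) f) (2 ^ n * m)" if "norm h < \<delta>" for n h
  proof (induction n)
    case 0
    then show ?case using f that by (simp add: modulus_le_def fin_diff_eq_funpow)
  next
    case (Suc n)
    from pnorm_le_diff[OF pnorm_le_translate[OF Suc, of h] Suc p]
    show ?case by (simp add: diff_op_def[abs_def] mult_ac)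
  qed
  from this[of _ "k - s"] \<open>s \<le> k\<close> show ?thesis by (simp add: modulus_le_def fin_diff_eq_funpow)
qed

lemma pnorm_le_funpow_diff_op:
  fixes f :: "'a::euclidean_space \<Rightarrow> real"
  assumes f: "pnorm_le lborel p f c" and p: "1 \<le> p"
  shows "pnorm_le lborel p ((diff_op h ^^ n) f) (2 ^ n * c)"
proof (induction n)
  case (Suc n)
  from pnorm_le_diff[OF pnorm_le_translate[OF Suc, of h] Suc p]
  show ?case by (simp add: diff_op_def[abs_def] mult_ac)
qed (simp add: f)

lemma fin_diff_add: "fin_diff s h (\<lambda>x. f x + g x) x = fin_diff s h f x + fin_diff s h g x"
  by (simp add: fin_diff_eq_sum algebra_simps sum.distrib)

text \<open>Differences of order \<open>s\<close> enlarge the p-norm by at most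
  \<open>2 ^ s\<close>. This controls the modulus of a truncated function by that of the original
  one.\<close>

lemma modulus_le_perturb:
  assumes f: "modulus_le p s f \<delta> m" and g: "pnorm_le lborel p (\<lambda>x. g x - f x) e" and p: "1 \<le> p"
  shows "modulus_le p s g \<delta> (m + 2 ^ s * e)"
  unfolding modulus_le_def
proof (intro allI impI)
  fix h :: "real ^ 'a" assume "norm h < \<delta>"
  then have "pnorm_le lborel p (fin_diff s h f) m" using f by (simp add: modulus_le_def)
  moreover have "pnorm_le lborel p (fin_diff s h (\<lambda>x. g x - f x)) (2 ^ s * e)"
    unfolding fin_diff_eq_funpow by (rule pnorm_le_funpow_diff_op[OF g p])
  ultimately have "pnorm_le lborel p (\<lambda>x. fin_diff s h f x + fin_diff s h (\<lambda>x. g x - f x) x) (m + 2 ^ s * e)"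
    using p by (rule pnorm_le_add)
  then show "pnorm_le lborel p (fin_diff s h g) (m + 2 ^ s * e)"
    unfolding fin_diff_add[symmetric] by (simp add: fun_eq_iff[symmetric])
qed

section \<open>Integrability and commutation of convolutions\<close>

definition decaying :: "nat \<Rightarrow> (real ^ 'd \<Rightarrow> real) \<Rightarrow> bool" where
  "decaying k A \<longleftrightarrow> A \<in> borel_measurable borel \<and> (\<exists>C. \<forall>v. \<bar>A v\<bar> \<le> C * decay k v)"

lemma decaying_measurable: "decaying k A \<Longrightarrow> A \<in> borel_measurable borel"
  by (simp add: decaying_def)

lemma decaying_integrable:
  assumes "decaying k A" "2 \<le> k"
  shows "integrable lborel A"
proof -
  obtain C where C: "\<And>v. \<bar>A v\<bar> \<le> C * decay k v" using assms by (auto simp: decaying_def)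
  show ?thesis
  proof (rule Bochner_Integration.integrable_bound)
    show "integrable lborel (\<lambda>v. C * decay k v)"
      using assms by (intro integrable_mult_right integrable_decay)
    show "AE v in lborel. norm (A v) \<le> norm (C * decay k v)"
      using C by (intro AE_I2) (auto intro: order_trans[OF _ abs_ge_self])
  qed (use assms in \<open>simp add: decaying_def\<close>)
qed

lemma decaying_bounded:
  assumes "decaying k A"
  shows "\<exists>C\<ge>0. \<forall>v. \<bar>A v\<bar> \<le> C"
proof -
  obtain C where C: "\<And>v. \<bar>A v\<bar> \<le> C * decay k v" using assms by (auto simp: decaying_def)
  have "\<bar>A v\<bar> \<le> \<bar>C\<bar>" for v
  proof -
    have "\<bar>A v\<bar> \<le> \<bar>C\<bar> * decay k v"
      by (rule order_trans[OF C[of v]]) (intro mult_right_mono abs_ge_self decay_nonneg)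
    also have "\<dots> \<le> \<bar>C\<bar> * 1" by (intro mult_left_mono decay_le_1) simp
    finally show ?thesis by simp
  qed
  then show ?thesis by (intro exI[of _ "\<bar>C\<bar>"]) auto
qed

lemma integrable_affine:
  fixes f :: "'a::euclidean_space \<Rightarrow> 'b::{banach,second_countable_topology}"
  assumes f: "integrable lborel f" and "c \<noteq> 0"
  shows "integrable lborel (\<lambda>x. f (t + c *\<^sub>R x))"
proof -
  have [measurable]: "f \<in> borel_measurable borel" using f by auto
  have "ennreal (\<bar>c\<bar> ^ DIM('a)) * (\<integral>\<^sup>+ x. norm (f (t + c *\<^sub>R x)) \<partial>lborel) < \<infinity>"
    using f nn_integral_affine[of "\<lambda>x. norm (f x)" c t] \<open>c \<noteq> 0\<close> by (simp add: integrable_iff_bounded)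
  then show ?thesis
    using \<open>c \<noteq> 0\<close> by (auto simp: integrable_iff_bounded ennreal_mult_less_top)
qed

lemma integral_affine:
  fixes f :: "'a::euclidean_space \<Rightarrow> 'b::{banach,second_countable_topology}"
  assumes f: "f \<in> borel_measurable borel" and "c \<noteq> 0"
  shows "(LINT x|lborel. f x) = \<bar>c\<bar> ^ DIM('a) *\<^sub>R (LINT x|lborel. f (t + c *\<^sub>R x))"
  using f by (subst lborel_affine[OF \<open>c \<noteq> 0\<close>, of t])
     (simp add: integral_density integral_distr)

lemma integrable_iff_pnorm_le_1:
  fixes f :: "'a::euclidean_space \<Rightarrow> real"
  shows "integrable lborel f \<longleftrightarrow> (\<exists>c. pnorm_le lborel 1 f c)"
proof -
  have *: "\<bar>f x\<bar> powr 1 = \<bar>f x\<bar>" for x by simp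
  show ?thesis
  proof
    assume "integrable lborel f"
    then show "\<exists>c. pnorm_le lborel 1 f c"
      by (intro exI[of _ "(LINT x|lborel. \<bar>f x\<bar> powr 1) powr (1 / 1)"])
         (simp add: pnorm_le_iff_integral del: powr_one)
  next
    assume "\<exists>c. pnorm_le lborel 1 f c"
    then obtain c where c: "pnorm_le lborel 1 f c" by blast
    show "integrable lborel f"
      using pnorm_le_integrable[OF c] pnorm_le_measurable[OF c] by (simp add: integrable_abs_iff)
  qed
qed

text \<open>The kernel is integrable and bounded, and |f| is at most 1 + |f|^p, so one half of the
  majorant is the kernel itself and the other a dilate of |f|^p. The dilation must be nonzero:
  otherwise the second half is constant.\<close>

lemma conv_integrable_Lp:
  fixes f :: "real ^ 'd \<Rightarrow> real"
  assumes A: "decaying k A" "2 \<le> k" and f: "pnorm_le lborel p f c" and p: "1 \<le> p" and t: "t \<noteq> 0"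
  shows "integrable lborel (\<lambda>v. A v * f (x + t *\<^sub>R v))"
proof -
  obtain C where C: "0 \<le> C" "\<And>v. \<bar>A v\<bar> \<le> C" using decaying_bounded[OF A(1)] by auto
  have [measurable]: "A \<in> borel_measurable borel" "f \<in> borel_measurable borel"
    using A pnorm_le_measurable[OF f] by (auto simp: decaying_def)
  show ?thesis
  proof (rule Bochner_Integration.integrable_bound)
    show "integrable lborel (\<lambda>v. \<bar>A v\<bar> + C * \<bar>f (x + t *\<^sub>R v)\<bar> powr p)"
      using decaying_integrable[OF A] integrable_affine[OF pnorm_le_integrable[OF f] t, of x] by simp
    have "\<bar>A v * f (x + t *\<^sub>R v)\<bar> \<le> \<bar>A v\<bar> + C * \<bar>f (x + t *\<^sub>R v)\<bar> powr p" for v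
    proof -
      have "\<bar>A v\<bar> * \<bar>f (x + t *\<^sub>R v)\<bar> \<le> \<bar>A v\<bar> * (1 + \<bar>f (x + t *\<^sub>R v)\<bar> powr p)"
        by (intro mult_left_mono abs_le_one_plus_powr p) simp
      also have "\<dots> \<le> \<bar>A v\<bar> + C * \<bar>f (x + t *\<^sub>R v)\<bar> powr p"
        using C by (simp add: distrib_left mult_right_mono)
      finally show ?thesis by (simp add: abs_mult)
    qed
    then show "AE v in lborel. norm (A v * f (x + t *\<^sub>R v)) \<le> norm (\<bar>A v\<bar> + C * \<bar>f (x + t *\<^sub>R v)\<bar> powr p)"
      unfolding real_norm_def by (intro AE_I2) (rule order_trans[OF _ abs_ge_self])
  qed measurable
qed

lemma conv_integrable:
  fixes f :: "real ^ 'd \<Rightarrow> real"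
  assumes A: "decaying k A" "2 \<le> k" and f: "integrable lborel f"
  shows "integrable lborel (\<lambda>v. A v * f (x + t *\<^sub>R v))"
proof (cases "t = 0")
  case True
  then show ?thesis using decaying_integrable[OF A] by simp
next
  case False
  obtain c where "pnorm_le lborel 1 f c" using f unfolding integrable_iff_pnorm_le_1 ..
  from conv_integrable_Lp[OF A this _ False] show ?thesis by simp
qed

lemma conv_measurable:
  fixes f :: "real ^ 'd \<Rightarrow> real"
  assumes [measurable]: "A \<in> borel_measurable borel" "f \<in> borel_measurable borel"
  shows "conv t A f \<in> borel_measurable borel"
  unfolding conv_def by measurable

lemma conv_lincomb:
  fixes f :: "real ^ 'd \<Rightarrow> real"
  assumes A: "decaying k A" "2 \<le> k" and f: "integrable lborel f"
  shows "(LINT v|lborel. A v * (\<Sum>i\<in>I. c i * f (x + t i *\<^sub>R v))) = (\<Sum>i\<in>I. c i * conv (t i) A f x)"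
proof -
  have "(\<lambda>v. A v * (\<Sum>i\<in>I. c i * f (x + t i *\<^sub>R v))) = (\<lambda>v. \<Sum>i\<in>I. c i * (A v * f (x + t i *\<^sub>R v)))"
    by (auto simp: sum_distrib_left mult_ac)
  then have "(LINT v|lborel. A v * (\<Sum>i\<in>I. c i * f (x + t i *\<^sub>R v)))
      = (\<Sum>i\<in>I. (LINT v|lborel. c i * (A v * f (x + t i *\<^sub>R v))))"
    by (simp add: Bochner_Integration.integral_sum conv_integrable[OF A f])
  then show ?thesis by (simp add: conv_def)
qed

lemma conv_diff:
  fixes f :: "real ^ 'd \<Rightarrow> real"
  assumes A: "decaying k A" "2 \<le> k" and f: "integrable lborel f" "integrable lborel g"
  shows "conv t A (\<lambda>x. f x - g x) x = conv t A f x - conv t A g x"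
  unfolding conv_def right_diff_distrib
  by (intro Bochner_Integration.integral_diff conv_integrable[OF A] f)

lemma conv_sum:
  fixes f :: "'i \<Rightarrow> real ^ 'd \<Rightarrow> real"
  assumes A: "decaying k A" "2 \<le> k" and f: "\<And>i. i \<in> I \<Longrightarrow> integrable lborel (f i)"
  shows "conv t A (\<lambda>x. \<Sum>i\<in>I. c i * f i x) x = (\<Sum>i\<in>I. c i * conv t A (f i) x)"
proof -
  have "(\<lambda>v. A v * (\<Sum>i\<in>I. c i * f i (x + t *\<^sub>R v))) = (\<lambda>v. \<Sum>i\<in>I. c i * (A v * f i (x + t *\<^sub>R v)))"
    by (auto simp: sum_distrib_left mult_ac)
  then show ?thesis unfolding conv_def
    by (simp add: Bochner_Integration.integral_sum conv_integrable[OF A f])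
qed

lemma pnorm_le_conv:
  fixes f :: "real ^ 'd \<Rightarrow> real"
  assumes A: "A \<in> borel_measurable borel" "\<And>v. \<bar>A v\<bar> \<le> C * decay 2 v"
    and f: "pnorm_le lborel p f c" and p: "1 \<le> p"
  shows "pnorm_le lborel p (conv t A f) (C * (LINT v|lborel. decay 2 (v :: real ^ 'd)) * c)"
proof -
  have [measurable]: "f \<in> borel_measurable borel" using pnorm_le_measurable[OF f] by simp
  show ?thesis
    unfolding conv_def
    by (rule pnorm_le_integral[where s = 0, unfolded add_0 power_0 mult_1_right])
       (use A f p pnorm_le_translate[OF f] pnorm_le_nonneg[OF f] in auto)
qed

lemma decay_mono: "k \<le> l \<Longrightarrow> decay l v \<le> decay k v"
  unfolding decay_def by (intro prod_mono) (auto intro!: divide_left_mono power_increasing)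

lemma decaying_mono:
  assumes "decaying l A" "k \<le> l"
  shows "decaying k A"
proof -
  obtain C where C: "\<And>v. \<bar>A v\<bar> \<le> C * decay l v" using assms by (auto simp: decaying_def)
  have "\<bar>A v\<bar> \<le> \<bar>C\<bar> * decay k v" for v
  proof -
    have "\<bar>A v\<bar> \<le> \<bar>C\<bar> * decay l v"
      by (rule order_trans[OF C[of v]]) (intro mult_right_mono abs_ge_self decay_nonneg)
    also have "\<dots> \<le> \<bar>C\<bar> * decay k v" by (intro mult_left_mono decay_mono assms) simp
    finally show ?thesis .
  qed
  then show ?thesis using assms by (auto simp: decaying_def)
qed

lemma conv_pnorm_bound:
  fixes A :: "real ^ 'd \<Rightarrow> real"
  assumes A: "decaying k A" "2 \<le> k" and p: "1 \<le> p"
  shows "\<exists>B\<ge>0. \<forall>t f c. pnorm_le lborel p f c \<longrightarrow> pnorm_le lborel p (conv t A f) (B * c)"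
proof -
  obtain C where C: "\<And>v. \<bar>A v\<bar> \<le> C * decay 2 v"
    using decaying_mono[OF A] by (auto simp: decaying_def)
  have "0 \<le> C * decay 2 (0 :: real ^ 'd)" using C[of 0] by linarith
  then have "0 \<le> C" using decay_pos[of 2 "0 :: real ^ 'd"] by (simp add: zero_le_mult_iff)
  then show ?thesis
    using pnorm_le_conv[OF decaying_measurable[OF A(1)] C _ p]
    by (intro exI[of _ "C * (LINT v|lborel. decay 2 (v :: real ^ 'd))"]) (auto simp: decay_nonneg)
qed

lemma conv_integrable_lborel:
  fixes f :: "real ^ 'd \<Rightarrow> real"
  assumes A: "decaying k A" "2 \<le> k" and f: "integrable lborel f"
  shows "integrable lborel (conv t A f)"
  using conv_pnorm_bound[OF A, of 1] f unfolding integrable_iff_pnorm_le_1 by auto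

text \<open>Fubini's theorem for the double integral over both kernels. It yields that averaging
  over balls commutes with the approximation operator.\<close>

lemma conv_commute:
  fixes f :: "real ^ 'd \<Rightarrow> real"
  assumes A: "decaying k A" "2 \<le> k" and B: "decaying l B" "2 \<le> l" and f: "integrable lborel f"
    and \<tau>: "\<tau> \<noteq> 0"
  shows "conv t A (conv \<tau> B f) x = conv \<tau> B (conv t A f) x"
proof -
  have [measurable]: "A \<in> borel_measurable borel" "B \<in> borel_measurable borel" "f \<in> borel_measurable borel"
    using A B f by (auto simp: decaying_def)
  let ?F = "\<lambda>u v. A u * (B v * f (x + t *\<^sub>R u + \<tau> *\<^sub>R v))"
  obtain C where C: "0 \<le> C" "\<And>v. \<bar>B v\<bar> \<le> C" using decaying_bounded[OF B(1)] by auto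
  \<comment> \<open>A bound for the inner integral that does not depend on its base point: the
    second kernel is bounded, and dilating by \<open>\<tau>\<close> divides the integral of |f| by
    the Jacobian.\<close>
  define N where "N = C * ((LINT x|lborel. \<bar>f x\<bar>) / \<bar>\<tau>\<bar> ^ CARD('d))"
  have N0: "0 \<le> N" using C by (simp add: N_def)
  have fint: "integrable lborel (\<lambda>v. \<bar>f (y + \<tau> *\<^sub>R v)\<bar>)" for y
    using integrable_affine[OF f \<tau>, of y] by simp
  have N: "(LINT v|lborel. norm (B v * f (y + \<tau> *\<^sub>R v))) \<le> N" for y
  proof -
    have "(LINT v|lborel. norm (B v * f (y + \<tau> *\<^sub>R v))) \<le> (LINT v|lborel. C * \<bar>f (y + \<tau> *\<^sub>R v)\<bar>)"
      using integrable_norm[OF conv_integrable[OF B f, of y \<tau>]] fint C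
      by (intro integral_mono) (auto simp: abs_mult intro: mult_right_mono)
    also have "\<dots> = N"
      using integral_affine[of "\<lambda>x. \<bar>f x\<bar>" \<tau> y] \<tau> unfolding N_def by simp
    finally show ?thesis .
  qed
  have int: "integrable (lborel \<Otimes>\<^sub>M lborel) (\<lambda>(u, v). ?F u v)"
  proof (rule lborel_pair.Fubini_integrable)
    show "(\<lambda>(u, v). ?F u v) \<in> borel_measurable (lborel \<Otimes>\<^sub>M lborel)" by measurable
    show "AE u in lborel. integrable lborel (\<lambda>v. case (u, v) of (u, v) \<Rightarrow> ?F u v)"
      using conv_integrable[OF B f] by (intro AE_I2) simp
    show "integrable lborel (\<lambda>u. LINT v|lborel. norm (case (u, v) of (u, v) \<Rightarrow> ?F u v))"
    proof (rule Bochner_Integration.integrable_bound)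
      show "integrable lborel (\<lambda>u. \<bar>A u\<bar> * N)" using decaying_integrable[OF A] by simp
      have "norm (LINT v|lborel. norm (?F u v)) \<le> norm (\<bar>A u\<bar> * N)" for u
      proof -
        have "(LINT v|lborel. norm (?F u v)) = \<bar>A u\<bar> * (LINT v|lborel. norm (B v * f (x + t *\<^sub>R u + \<tau> *\<^sub>R v)))"
          by (simp add: abs_mult)
        also have "\<dots> \<le> \<bar>A u\<bar> * N" by (intro mult_left_mono N) simp
        finally show ?thesis using N0 by (simp add: abs_mult)
      qed
      then show "AE u in lborel. norm (LINT v|lborel. norm (case (u, v) of (u, v) \<Rightarrow> ?F u v)) \<le> norm (\<bar>A u\<bar> * N)"
        by simp
    qed measurable
  qed
  have "conv t A (conv \<tau> B f) x = (LINT u|lborel. (LINT v|lborel. ?F u v))"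
    by (simp add: conv_def)
  also have "\<dots> = (LINT v|lborel. (LINT u|lborel. ?F u v))"
    by (rule lborel_pair.Fubini_integral[OF int, symmetric])
  also have "\<dots> = (LINT v|lborel. (LINT u|lborel. B v * (A u * f (x + \<tau> *\<^sub>R v + t *\<^sub>R u))))"
    by (intro Bochner_Integration.integral_cong refl) (simp add: mult_ac add_ac)
  also have "\<dots> = conv \<tau> B (conv t A f) x"
    by (simp add: conv_def)
  finally show ?thesis .
qed

section \<open>Ball averages as convolutions\<close>

lemma unit_ball_vol_neq_0 [simp]: "unit_ball_vol (real n) \<noteq> 0"
  using unit_ball_vol_pos[of "real n"] by (metis less_irrefl of_nat_0_le_iff)

definition ball_kernel :: "real ^ 'd \<Rightarrow> real" where
  "ball_kernel v = indicator (ball 0 1) v / unit_ball_vol (real CARD('d))"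

lemma ball_kernel_measurable [measurable]: "ball_kernel \<in> borel_measurable borel"
  unfolding ball_kernel_def by (intro borel_measurable_divide borel_measurable_indicator) auto

text \<open>Bounded support makes the kernel decay to every order; on the unit ball
  \<open>decay\<close> is compared with its value 1 at the origin by slow variation.\<close>

lemma ball_kernel_le: "\<bar>ball_kernel v\<bar> \<le> 2 ^ (k * CARD('d)) / unit_ball_vol (real CARD('d)) * decay k (v ::
    real ^ 'd)"
proof (cases "norm v < 1")
  case True
  have "decay k (0 :: real ^ 'd) \<le> 2 ^ (k * CARD('d)) * decay k (0 + v)"
    using True by (intro decay_shift) simp
  then have "1 \<le> 2 ^ (k * CARD('d)) * decay k v" by (simp add: decay_def)
  then have "1 / unit_ball_vol (real CARD('d)) \<le> 2 ^ (k * CARD('d)) * decay k v / unit_ball_vol (real CARD('d))"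
    by (intro divide_right_mono) auto
  then show ?thesis using True by (simp add: ball_kernel_def)
next
  case False
  then show ?thesis by (simp add: ball_kernel_def decay_nonneg)
qed

lemma ball_kernel_decaying: "decaying k (ball_kernel :: real ^ 'd \<Rightarrow> real)"
  unfolding decaying_def using ball_kernel_le by (auto simp del: times_divide_eq_left)

lemma ball_kernel_uminus: "ball_kernel (- v) = ball_kernel v"
  by (simp add: ball_kernel_def indicator_def)

lemma integral_ball_kernel: "(LINT v|lborel. ball_kernel (v :: real ^ 'd)) = 1"
proof -
  have "(LINT v|lborel. ball_kernel (v :: real ^ 'd))
      = measure lborel (ball (0 :: real ^ 'd) 1) / unit_ball_vol (real CARD('d))"
    unfolding ball_kernel_def by simp
  also have "measure lborel (ball (0 :: real ^ 'd) 1) = unit_ball_vol (real CARD('d))"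
    using content_ball[of 1 "0 :: real ^ 'd"] by simp
  finally show ?thesis using unit_ball_vol_pos[of "real CARD('d)"] by simp
qed

lemma conv_0_ball_kernel: "conv 0 ball_kernel f x = f x"
  by (simp add: conv_def integral_ball_kernel)

lemma conv_uminus_ball_kernel:
  assumes "f \<in> borel_measurable borel"
  shows "conv (- t) ball_kernel f x = conv t ball_kernel f x"
proof -
  have [measurable]: "f \<in> borel_measurable borel" by fact
  show ?thesis
    unfolding conv_def
    by (subst integral_affine[where c = "-1" and t = 0]) (auto simp: ball_kernel_uminus)
qed

lemma ball_avg_eq_conv:
  fixes f :: "real ^ 'd \<Rightarrow> real"
  assumes [measurable]: "f \<in> borel_measurable borel" and \<delta>: "0 < \<delta>"
  shows "ball_avg \<delta> f x = conv \<delta> ball_kernel f x"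
proof -
  have [measurable]: "ball x \<delta> \<in> sets borel" by simp
  have "(LINT y:ball x \<delta>|lebesgue. f y) = (LINT y|lborel. indicator (ball x \<delta>) y * f y)"
    unfolding set_lebesgue_integral_def by (subst integral_completion) auto
  also have "\<dots> = \<delta> ^ CARD('d) * (LINT v|lborel. indicator (ball x \<delta>) (x + \<delta> *\<^sub>R v) * f (x + \<delta> *\<^sub>R v))"
    using \<delta> by (subst integral_affine[where c = \<delta> and t = x]) auto
  also have "(\<lambda>v. indicator (ball x \<delta>) (x + \<delta> *\<^sub>R v) * f (x + \<delta> *\<^sub>R v))
      = (\<lambda>v :: real ^ 'd. unit_ball_vol (real CARD('d)) * (ball_kernel v * f (x + \<delta> *\<^sub>R v)))"
    using \<delta> by (auto simp: ball_kernel_def indicator_def dist_norm fun_eq_iff)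
  finally have "(LINT y:ball x \<delta>|lebesgue. f y) = \<delta> ^ CARD('d) * unit_ball_vol (real CARD('d)) * conv \<delta>
      ball_kernel f x"
    by (simp add: conv_def)
  moreover have "measure lebesgue (ball (0 :: real ^ 'd) \<delta>) = unit_ball_vol (real CARD('d)) * \<delta> ^ CARD('d)"
    using content_ball[of \<delta> "0 :: real ^ 'd"] \<delta> by simp
  ultimately show ?thesis
    using \<delta> by (simp add: ball_avg_def)
qed

definition avg_coeff :: "nat \<Rightarrow> nat \<Rightarrow> real" where
  "avg_coeff r j = - (2 / real (2 * r choose r)) * ((- 1) ^ j * real (2 * r choose (r - j)))"

lemma averaged_eq_conv:
  fixes f :: "real ^ 'd \<Rightarrow> real"
  assumes f: "f \<in> borel_measurable borel" and \<delta>: "0 < \<delta>"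
  shows "averaged \<delta> r f = (\<lambda>x. \<Sum>j = 1..r. avg_coeff r j * conv (\<delta> * real j / real r) ball_kernel f x)"
proof
  fix x
  have "averaged \<delta> r f x = (\<Sum>j = 1..r. avg_coeff r j * ball_avg (\<delta> * real j / real r) f x)"
    unfolding averaged_def avg_coeff_def by (simp add: sum_distrib_left mult_ac)
  also have "\<dots> = (\<Sum>j = 1..r. avg_coeff r j * conv (\<delta> * real j / real r) ball_kernel f x)"
    using \<delta> by (intro sum.cong refl) (simp add: ball_avg_eq_conv[OF f])
  finally show "averaged \<delta> r f x = (\<Sum>j = 1..r. avg_coeff r j * conv (\<delta> * real j / real r) ball_kernel f x)" .
qed

text \<open>Integrability is required only for nonzero dilations and only against the ball kernel.
  This covers integrable functions and also functions with finite p-norm that are not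
  integrable.\<close>

lemma averaged_diff:
  fixes h k :: "real ^ 'd \<Rightarrow> real"
  assumes m: "h \<in> borel_measurable borel" "k \<in> borel_measurable borel"
    and h: "\<And>t. t \<noteq> 0 \<Longrightarrow> integrable lborel (\<lambda>v. ball_kernel v * h (x + t *\<^sub>R v))"
    and k: "\<And>t. t \<noteq> 0 \<Longrightarrow> integrable lborel (\<lambda>v. ball_kernel v * k (x + t *\<^sub>R v))"
    and \<delta>: "0 < \<delta>"
  shows "averaged \<delta> r (\<lambda>x. h x - k x) x = averaged \<delta> r h x - averaged \<delta> r k x"
proof -
  have hk: "(\<lambda>x. h x - k x) \<in> borel_measurable borel" using m by simp
  have "conv t ball_kernel (\<lambda>x. h x - k x) x = conv t ball_kernel h x - conv t ball_kernel k x" if "t \<noteq> 0" for t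
    unfolding conv_def right_diff_distrib by (intro Bochner_Integration.integral_diff h k that)
  then show ?thesis
    unfolding averaged_eq_conv[OF m(1) \<delta>] averaged_eq_conv[OF m(2) \<delta>] averaged_eq_conv[OF hk \<delta>]
        sum_subtractf[symmetric]
    using \<delta> by (intro sum.cong refl) (simp add: right_diff_distrib)
qed

lemma sum_atMost_symmetric:
  fixes g :: "nat \<Rightarrow> real"
  shows "(\<Sum>i\<le>2 * r. g i) = g r + (\<Sum>j = 1..r. g (r - j) + g (r + j))"
proof -
  have "{..2 * r} = insert r ({..<r} \<union> {r<..2 * r})" by auto
  moreover have "sum g ({..<r} \<union> {r<..2 * r}) = sum g {..<r} + sum g {r<..2 * r}"
    by (rule sum.union_disjoint) auto
  ultimately have "(\<Sum>i\<le>2 * r. g i) = (\<Sum>i<r. g i) + (g r + (\<Sum>i\<in>{r<..2 * r}. g i))"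
    by simp
  moreover have "(\<Sum>i<r. g i) = (\<Sum>j = 1..r. g (r - j))"
    by (rule sum.reindex_bij_witness[of _ "\<lambda>j. r - j" "\<lambda>i. r - i"]) auto
  moreover have "(\<Sum>i\<in>{r<..2 * r}. g i) = (\<Sum>j = 1..r. g (r + j))"
    by (rule sum.reindex_bij_witness[of _ "\<lambda>j. r + j" "\<lambda>i. i - r"]) auto
  ultimately show ?thesis by (simp add: sum.distrib)
qed

text \<open>The coefficients of the averaged operator are those of a symmetric difference of order
  \<open>2 * r\<close>, because averaging over a ball identifies opposite directions.\<close>

lemma averaged_minus_eq:
  fixes f :: "real ^ 'd \<Rightarrow> real"
  assumes f: "integrable lborel f" and \<delta>: "0 < \<delta>" and r: "1 \<le> r"
  shows "averaged \<delta> r f x - f x = - ((- 1) ^ r / real (2 * r choose r)) *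
     (LINT v|lborel. ball_kernel v * fin_diff (2 * r) ((\<delta> / real r) *\<^sub>R v) f (x - \<delta> *\<^sub>R v))"
proof -
  have fm: "f \<in> borel_measurable borel" using f by auto
  define \<tau> where "\<tau> = \<delta> / real r"
  have \<delta>\<tau>: "\<delta> = real r * \<tau>" using r by (simp add: \<tau>_def)
  define c where "c i = (- 1) ^ (2 * r - i) * real (2 * r choose i)" for i
  define cv where "cv j = conv (\<delta> * real j / real r) ball_kernel f x" for j
  \<comment> \<open>The base point \<open>x - \<delta> *\<^sub>R v\<close> is \<open>r\<close> steps
    back, so the nodes are centred at \<open>x\<close>: the middle one is \<open>x\<close> itself,
    and those at \<open>r - j\<close> and \<open>r + j\<close> are opposite and give equal
    averages.\<close>
  have even: "fin_diff (2 * r) ((\<delta> / real r) *\<^sub>R v) f (x - \<delta> *\<^sub>R v)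
      = (\<Sum>i\<le>2 * r. c i * f (x + ((real i - real r) * \<tau>) *\<^sub>R v))" for v
    unfolding fin_diff_eq_sum c_def \<tau>_def[symmetric]
    by (intro sum.cong refl arg_cong[where f = "\<lambda>y. _ * f y"])
       (simp add: \<delta>\<tau> algebra_simps)
  have "(LINT v|lborel. ball_kernel v * fin_diff (2 * r) ((\<delta> / real r) *\<^sub>R v) f (x - \<delta> *\<^sub>R v))
      = (\<Sum>i\<le>2 * r. c i * conv ((real i - real r) * \<tau>) ball_kernel f x)"
    unfolding even by (rule conv_lincomb[OF ball_kernel_decaying[of 2] _ f]) simp
  also have "\<dots> = c r * f x + (\<Sum>j = 1..r. c (r - j) * cv j + c (r + j) * cv j)"
  proof -
    have "conv ((real (r - j) - real r) * \<tau>) ball_kernel f x = cv j"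
         "conv ((real (r + j) - real r) * \<tau>) ball_kernel f x = cv j" if "j \<in> {1..r}" for j
    proof -
      have *: "(real (r - j) - real r) * \<tau> = - (\<delta> * real j / real r)"
        using that r by (simp add: \<tau>_def of_nat_diff)
      show "conv ((real (r - j) - real r) * \<tau>) ball_kernel f x = cv j"
        unfolding * cv_def by (rule conv_uminus_ball_kernel[OF fm])
      show "conv ((real (r + j) - real r) * \<tau>) ball_kernel f x = cv j"
        unfolding cv_def by (simp add: \<tau>_def mult.commute)
    qed
    then show ?thesis
      unfolding sum_atMost_symmetric by (simp add: conv_0_ball_kernel)
  qed
  also have "\<dots> = (- 1) ^ r * real (2 * r choose r) * (f x - (\<Sum>j = 1..r. avg_coeff r j * cv j))"
  proof -
    have b: "0 < 2 * r choose r" by simp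
    \<comment> \<open>Opposite nodes carry the same coefficient, since the order
      \<open>2 * r\<close> is even; the two equal contributions account for the factor 2 in
      \<open>avg_coeff\<close>.\<close>
    have "c (r - j) * cv j + c (r + j) * cv j = - ((- 1) ^ r * real (2 * r choose r) * (avg_coeff r j * cv j))"
      if "j \<in> {1..r}" for j
    proof -
      have 1: "(- 1 :: real) ^ (2 * r - (r - j)) = (- 1) ^ r * (- 1) ^ j"
        using that by (simp add: power_add[symmetric])
      have "even (r - j) = even (r + j)" using that by auto
      then have 2: "(- 1 :: real) ^ (2 * r - (r + j)) = (- 1) ^ r * (- 1) ^ j"
        using that by (simp add: power_add[symmetric] minus_one_power_iff)
      have 3: "2 * r choose (r + j) = 2 * r choose (r - j)"
        using that binomial_symmetric[of "r - j" "2 * r"] by simp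
      show ?thesis using b unfolding c_def avg_coeff_def 1 2 3 by simp
    qed
    moreover have "c r = (- 1) ^ r * real (2 * r choose r)" by (simp add: c_def mult_2)
    ultimately show ?thesis
      by (simp add: sum_negf sum_distrib_left right_diff_distrib)
  qed
  also have "(\<Sum>j = 1..r. avg_coeff r j * cv j) = averaged \<delta> r f x"
    unfolding averaged_eq_conv[OF fm \<delta>] cv_def by simp
  finally show ?thesis
    by (simp add: power_mult_distrib[symmetric])
qed

text \<open>The ball kernel is supported in the unit ball, so only steps shorter than
  \<open>\<delta>\<close> occur and no growth estimate is needed; the order is then lowered from
  \<open>2 * r\<close> to \<open>s\<close>.\<close>

lemma modulus_stable_averaged:
  assumes p: "1 \<le> p" and r: "1 \<le> r" "s \<le> 2 * r" and \<gamma>: "0 < \<gamma>" "\<gamma> \<le> 1"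
  shows "modulus_stable p s (\<lambda>\<delta> f x. averaged (\<gamma> * \<delta>) r f x - f (x :: real ^ 'd))"
proof -
  let ?K = "2 ^ (2 * CARD('d)) / unit_ball_vol (real CARD('d))"
  let ?I = "LINT v|lborel. decay 2 (v :: real ^ 'd)"
  have "pnorm_le lborel p (\<lambda>x. averaged (\<gamma> * \<delta>) r f x - f x) (?K * ?I * 2 ^ (2 * r) * m)"
    if f: "integrable lborel f" and \<delta>: "0 < \<delta>" and mod: "modulus_le p s f \<delta> m" for f :: "real ^ 'd \<Rightarrow> real" and \<delta> m
  proof -
    define \<delta>' where "\<delta>' = \<gamma> * \<delta>"
    have \<delta>': "0 < \<delta>'" "\<delta>' \<le> \<delta>" using \<gamma> \<delta> by (auto simp: \<delta>'_def)
    have [measurable]: "f \<in> borel_measurable borel" using f by auto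
    let ?m = "2 ^ (2 * r) * m"
    \<comment> \<open>Cut off where the kernel vanishes: for long \<open>v\<close> the modulus at
      \<open>\<delta>\<close> gives no bound, but the integral inequality asks for one at every
      \<open>v\<close>.\<close>
    define H where "H x v = (if norm v < 1 then fin_diff (2 * r) ((\<delta>' / real r) *\<^sub>R v) f (x - \<delta>' *\<^sub>R v) else 0)" for x v
    have m0: "0 \<le> m" by (rule modulus_le_nonneg[OF mod \<delta>])
    have 1: "ball_kernel v * fin_diff (2 * r) ((\<delta>' / real r) *\<^sub>R v) f (x - \<delta>' *\<^sub>R v) = ball_kernel v * H x v" for x v
      by (simp add: H_def ball_kernel_def)
    have H: "pnorm_le lborel p (\<lambda>x. H x v) ?m" for v
    proof (cases "norm v < 1")
      case True
      have "0 \<le> \<delta>' * norm v" using \<delta>' by simp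
      then have "\<delta>' * norm v / real r \<le> \<delta>' * norm v" using r by (simp add: divide_le_eq mult_le_cancel_left1)
      also have "\<dots> < \<delta>" using True \<delta>' by (metis less_le_trans mult.right_neutral mult_strict_left_mono)
      finally have "norm ((\<delta>' / real r) *\<^sub>R v) < \<delta>" using \<delta>' by simp
      then have "pnorm_le lborel p (fin_diff (2 * r) ((\<delta>' / real r) *\<^sub>R v) f) (2 ^ (2 * r - s) * m)"
        using modulus_le_higher[OF mod p r(2)] by (simp add: modulus_le_def)
      moreover have "2 ^ (2 * r - s) * m \<le> ?m" using m0 by (intro mult_right_mono power_increasing) auto
      ultimately have "pnorm_le lborel p (fin_diff (2 * r) ((\<delta>' / real r) *\<^sub>R v) f) ?m"
        using p pnorm_le_mono by blast
      from pnorm_le_translate[OF this, of "- \<delta>' *\<^sub>R v"] True show ?thesis by (simp add: H_def)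
    next
      case False
      then show ?thesis using pnorm_le_mono[OF pnorm_le_zero _ p, of ?m] m0 by (simp add: H_def)
    qed
    have Hm: "case_prod H \<in> borel_measurable (borel \<Otimes>\<^sub>M borel)"
      unfolding H_def fin_diff_def by measurable
    have "pnorm_le lborel p (\<lambda>x. LINT v|lborel. ball_kernel v * H x v) (?K * ?I * ?m)"
      by (rule pnorm_le_integral[where s = 0, unfolded add_0 power_0 mult_1_right])
         (use ball_kernel_le H Hm m0 p in \<open>auto simp del: times_divide_eq_left\<close>)
    from pnorm_le_cmult[OF this, of "- ((- 1) ^ r / real (2 * r choose r))"]
    have "pnorm_le lborel p (\<lambda>x. averaged \<delta>' r f x - f x) (\<bar>- ((- 1) ^ r / real (2 * r choose r))\<bar> * (?K * ?I * ?m))"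
      unfolding averaged_minus_eq[OF f \<delta>'(1) r(1)] 1 .
    then have a: "pnorm_le lborel p (\<lambda>x. averaged \<delta>' r f x - f x) (1 / real (2 * r choose r) * (?K * ?I * ?m))"
      by (simp add: abs_mult power_abs)
    have "0 < 2 * r choose r" by simp
    then have "1 \<le> real (2 * r choose r)" by linarith
    then have "1 / real (2 * r choose r) \<le> 1" by (metis div_by_1 divide_left_mono mult_1_right
        order_less_le_trans zero_le_one zero_less_one)
    then have "1 / real (2 * r choose r) * (?K * ?I * ?m) \<le> 1 * (?K * ?I * ?m)"
      using m0 by (intro mult_right_mono) (auto simp: decay_nonneg)
    then have "1 / real (2 * r choose r) * (?K * ?I * ?m) \<le> ?K * ?I * 2 ^ (2 * r) * m" by simp
    with a p show ?thesis unfolding \<delta>'_def[symmetric] using pnorm_le_mono by blast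
  qed
  then show ?thesis
    unfolding modulus_stable_def by (intro exI[of _ "?K * ?I * 2 ^ (2 * r)"]) (auto simp: decay_nonneg)
qed

subsection \<open>A band-limited kernel with rapid decay\<close>

text \<open>An unnormalised inverse Fourier transform of a polynomial cut off to [-1, 1].
  Polynomials form a convenient class of symbols: differentiating in \<open>x\<close> multiplies the
  symbol by i t, and integrating by parts differentiates it, so neither operation leaves the
  family.\<close>

definition band_kernel :: "complex poly \<Rightarrow> real \<Rightarrow> complex" where
  "band_kernel q x = integral (cbox (-1) 1) (\<lambda>t. poly q (of_real t) * exp (\<i> * of_real (x * t)))"

lemma continuous_band_integrand:
  "continuous_on A (\<lambda>t. poly q (of_real t) * exp (\<i> * of_real (x * t)))"
  by (intro continuous_intros)

lemma poly_bounded_on_interval: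
  obtains B where "0 \<le> B" "\<And>t::real. t \<in> {-1..1} \<Longrightarrow> norm (poly q (of_real t :: complex)) \<le> B"
proof -
  have "compact ((\<lambda>t::real. poly q (of_real t)) ` {-1..1})"
    by (intro compact_continuous_image continuous_intros) simp
  then have "bounded ((\<lambda>t::real. poly q (of_real t)) ` {-1..1})"
    by (rule compact_imp_bounded)
  then obtain B where "\<forall>t\<in>{-1..1::real}. norm (poly q (of_real t)) \<le> B"
    unfolding bounded_iff by auto
  then show ?thesis by (intro that[of "max B 0"]) (auto simp: le_max_iff_disj)
qed

lemma band_kernel_bounded: "\<exists>C. \<forall>x. norm (band_kernel q x) \<le> C"
proof -
  obtain B where B0: "0 \<le> B" and B: "\<And>t::real. t \<in> {-1..1} \<Longrightarrow> norm (poly q (of_real t)) \<le> B"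
    using poly_bounded_on_interval[of q] by blast
  have "norm (band_kernel q x) \<le> B * measure lborel (cbox (-1) (1::real))" for x
    unfolding band_kernel_def
    by (rule Henstock_Kurzweil_Integration.integrable_bound[OF B0])
       (use B in \<open>auto simp: norm_mult intro!: integrable_continuous_interval continuous_intros\<close>)
  then show ?thesis by blast
qed

lemma band_kernel_has_vector_derivative:
  "(band_kernel q has_vector_derivative band_kernel ([:0, \<i>:] * q) x) (at x)"
proof -
  have "((\<lambda>x. integral (cbox (-1) 1) (\<lambda>t. poly q (of_real t) * exp (\<i> * of_real (x * t))))
     has_vector_derivative integral (cbox (-1) 1) (\<lambda>t. poly ([:0, \<i>:] * q) (of_real t) * exp (\<i> * of_real (x * t))))
     (at x within UNIV)"
  proof (rule leibniz_rule_vector_derivative)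
    fix x t :: real
    have "((\<lambda>x. exp (\<i> * of_real (x * t))) has_vector_derivative (\<i> * of_real t) * exp (\<i> * of_real (x * t))) (at x)"
    proof -
      have "((\<lambda>z. exp (\<i> * (z * of_real t))) has_field_derivative (\<i> * of_real t) * exp (\<i> * (of_real x *
          of_real t))) (at (of_real x))"
        by (auto intro!: derivative_eq_intros simp: mult_ac)
      from has_vector_derivative_real_field[OF this] show ?thesis by (simp add: mult.assoc)
    qed
    from has_vector_derivative_mult_right[OF this, of "poly q (of_real t)"]
    show "((\<lambda>x. poly q (of_real t) * exp (\<i> * of_real (x * t))) has_vector_derivative
        poly ([:0, \<i>:] * q) (of_real t) * exp (\<i> * of_real (x * t))) (at x within UNIV)"
      by (simp add: mult_ac)
  next
    show "(\<lambda>t. poly q (of_real t) * exp (\<i> * of_real (x * t))) integrable_on cbox (-1) 1" for x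
      by (intro integrable_continuous continuous_band_integrand)
    show "continuous_on (UNIV \<times> cbox (-1) 1) (\<lambda>(x, t). poly ([:0, \<i>:] * q) (of_real t) * exp (\<i> * of_real (x * t)))"
      unfolding split_beta by (intro continuous_intros)
  qed auto
  then show ?thesis by (simp add: band_kernel_def[abs_def])
qed

text \<open>The boundary terms vanish because the symbol does at both ends; each use trades a power
  of \<open>x\<close> for a derivative of the symbol.\<close>

lemma band_kernel_by_parts:
  assumes "poly q 1 = 0" "poly q (-1) = 0"
  shows "of_real x * band_kernel q x = \<i> * band_kernel (pderiv q) x"
proof -
  let ?e = "\<lambda>t. exp (\<i> * of_real (x * t))"
  have d: "((\<lambda>t. poly q (of_real t) * ?e t) has_vector_derivative
     (poly (pderiv q) (of_real t) * ?e t + \<i> * of_real x * (poly q (of_real t) * ?e t))) (at t within {-1..1})" for t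
  proof -
    have "((\<lambda>z. poly q z * exp (\<i> * (of_real x * z))) has_field_derivative
       (poly (pderiv q) (of_real t) * exp (\<i> * (of_real x * of_real t))
           + \<i> * of_real x * (poly q (of_real t) * exp (\<i> * (of_real x * of_real t))))) (at (of_real t))"
      by (rule derivative_eq_intros poly_DERIV refl | simp add: mult_ac)+
    from has_vector_derivative_real_field[OF this] show ?thesis
      by (simp add: mult.assoc has_vector_derivative_at_within)
  qed
  have "((\<lambda>t. poly (pderiv q) (of_real t) * ?e t + \<i> * of_real x * (poly q (of_real t) * ?e t)) has_integral
     (poly q (of_real 1) * ?e 1 - poly q (of_real (-1)) * ?e (-1))) {-1..1}"
    by (rule fundamental_theorem_of_calculus) (use d in auto)
  then have 0: "((\<lambda>t. poly (pderiv q) (of_real t) * ?e t + \<i> * of_real x * (poly q (of_real t) * ?e t))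
      has_integral 0) (cbox (-1) 1)"
    using assms by simp
  have "((\<lambda>t. poly (pderiv q) (of_real t) * ?e t + \<i> * of_real x * (poly q (of_real t) * ?e t)) has_integral
     (band_kernel (pderiv q) x + \<i> * of_real x * band_kernel q x)) (cbox (-1) 1)"
    unfolding band_kernel_def
    by (intro has_integral_add has_integral_mult_right integrable_integral integrable_continuous
        continuous_band_integrand)
  from has_integral_unique[OF this 0] have "\<i> * (band_kernel (pderiv q) x + \<i> * of_real x * band_kernel q x)
      = 0" by simp
  then show ?thesis by (simp add: algebra_simps)
qed

text \<open>Divisibility by \<open>edge ^ M\<close> encodes a zero of order \<open>M\<close> at both
  ends of the band. Multiplying the symbol preserves it, and differentiating lowers \<open>M\<close>
  by one.\<close>

abbreviation "edge \<equiv> [:-1, 0, 1 :: complex:]"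

lemma band_kernel_decay_aux:
  "edge ^ M dvd q \<Longrightarrow> \<exists>C. \<forall>x. \<bar>x\<bar> ^ M * norm (band_kernel q x) \<le> C"
proof (induction M arbitrary: q)
  case 0
  then show ?case using band_kernel_bounded[of q] by simp
next
  case (Suc M)
  then obtain w where w: "q = edge ^ Suc M * w" by (elim dvdE)
  have "pderiv q = edge ^ M * (smult (of_nat (Suc M)) (pderiv edge) * w + edge * pderiv w)"
    unfolding w pderiv_mult pderiv_power_Suc by (simp add: algebra_simps)
  then have "edge ^ M dvd pderiv q" by simp
  then obtain C where C: "\<And>x. \<bar>x\<bar> ^ M * norm (band_kernel (pderiv q) x) \<le> C" using Suc.IH by blast
  have "\<bar>x\<bar> ^ Suc M * norm (band_kernel q x) \<le> C" for x
  proof -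
    have "of_real x * band_kernel q x = \<i> * band_kernel (pderiv q) x"
      by (rule band_kernel_by_parts) (auto simp: w)
    then have "norm (of_real x * band_kernel q x) = norm (\<i> * band_kernel (pderiv q) x)" by simp
    then have "\<bar>x\<bar> * norm (band_kernel q x) = norm (band_kernel (pderiv q) x)" by (simp add: norm_mult)
    moreover have "\<bar>x\<bar> ^ Suc M * norm (band_kernel q x) = \<bar>x\<bar> ^ M * (\<bar>x\<bar> * norm (band_kernel q x))"
      by (simp only: power_Suc mult_ac)
    ultimately have "\<bar>x\<bar> ^ Suc M * norm (band_kernel q x) = \<bar>x\<bar> ^ M * norm (band_kernel (pderiv q) x)"
      by (simp only:)
    then show ?thesis using C[of x] by (simp only:)
  qed
  then show ?case by blast
qed

lemma band_kernel_decay: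
  assumes "edge ^ M dvd q"
  shows "\<exists>C. \<forall>x. norm (band_kernel q x) \<le> C * (1 / (1 + \<bar>x\<bar>) ^ M)"
proof -
  obtain C0 where C0: "\<And>x. norm (band_kernel q x) \<le> C0" using band_kernel_bounded by blast
  obtain C1 where C1: "\<And>x. \<bar>x\<bar> ^ M * norm (band_kernel q x) \<le> C1" using band_kernel_decay_aux[OF assms] by blast
  have "(1 + \<bar>x\<bar>) ^ M * norm (band_kernel q x) \<le> 2 ^ M * (C0 + C1)" for x
  proof -
    have "(1 + \<bar>x\<bar>) ^ M \<le> 2 ^ M * (1 + \<bar>x\<bar> ^ M)"
    proof (cases "\<bar>x\<bar> \<le> 1")
      case True
      then have "(1 + \<bar>x\<bar>) ^ M \<le> 2 ^ M * 1" by (simp add: power_mono)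
      also have "\<dots> \<le> 2 ^ M * (1 + \<bar>x\<bar> ^ M)" by (intro mult_left_mono) auto
      finally show ?thesis .
    next
      case False
      then have "(1 + \<bar>x\<bar>) ^ M \<le> (2 * \<bar>x\<bar>) ^ M" by (intro power_mono) auto
      also have "\<dots> \<le> 2 ^ M * (1 + \<bar>x\<bar> ^ M)" by (simp add: power_mult_distrib)
      finally show ?thesis .
    qed
    then have "(1 + \<bar>x\<bar>) ^ M * norm (band_kernel q x) \<le> 2 ^ M * (1 + \<bar>x\<bar> ^ M) * norm (band_kernel q x)"
      by (intro mult_right_mono) auto
    also have "\<dots> = 2 ^ M * (norm (band_kernel q x) + \<bar>x\<bar> ^ M * norm (band_kernel q x))"
      by (simp add: algebra_simps)
    also have "\<dots> \<le> 2 ^ M * (C0 + C1)"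
      using C0[of x] C1[of x] by (intro mult_left_mono add_mono) auto
    finally show ?thesis .
  qed
  moreover have "0 < (1 + \<bar>x\<bar>) ^ M" for x :: real by (intro zero_less_power) (simp add: add_pos_nonneg)
  ultimately have "norm (band_kernel q x) \<le> 2 ^ M * (C0 + C1) * (1 / (1 + \<bar>x\<bar>) ^ M)" for x
    by (simp add: pos_le_divide_eq mult.commute)
  then show ?thesis by blast
qed

section \<open>Fourier inversion for the kernel\<close>

lemma continuous_band_kernel: "continuous_on UNIV (band_kernel q)"
  using has_vector_derivative_continuous[OF band_kernel_has_vector_derivative]
  by (auto simp: continuous_on_eq_continuous_at)

lemma band_kernel_measurable [measurable]: "band_kernel q \<in> borel_measurable borel"
  by (intro borel_measurable_continuous_onI continuous_band_kernel)

lemma band_kernel_integrable: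
  assumes "edge ^ 2 dvd q"
  shows "integrable lborel (band_kernel q)"
proof -
  obtain C where C: "\<And>x. norm (band_kernel q x) \<le> C * (1 / (1 + \<bar>x\<bar>) ^ 2)"
    using band_kernel_decay[OF assms] by blast
  show ?thesis
  proof (rule Bochner_Integration.integrable_bound)
    show "integrable lborel (\<lambda>x::real. C * (1 / (1 + \<bar>x\<bar>) ^ 2))"
      by (intro integrable_mult_right integrable_inverse_square) simp
    show "AE x in lborel. norm (band_kernel q x) \<le> norm (C * (1 / (1 + \<bar>x\<bar>) ^ 2))"
      unfolding real_norm_def by (rule AE_I2) (rule order_trans[OF C abs_ge_self])
  qed measurable
qed

lemma band_kernel_eq_lebesgue:
  "band_kernel q x = (LINT t|lborel. indicator {-1..1} t *\<^sub>R (poly q (of_real t) * exp (\<i> * of_real (x * t))))"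
  "integrable lborel (\<lambda>t. indicator {-1..1} t *\<^sub>R (poly q (of_real t) * exp (\<i> * of_real (x * t))))"
proof -
  have *: "set_integrable lborel {-1..1} (\<lambda>t. poly q (of_real t) * exp (\<i> * of_real (x * t)))"
    by (intro borel_integrable_atLeastAtMost' continuous_band_integrand)
  then show "integrable lborel (\<lambda>t. indicator {-1..1} t *\<^sub>R (poly q (of_real t) * exp (\<i> * of_real (x * t))))"
    by (simp add: set_integrable_def)
  show "band_kernel q x = (LINT t|lborel. indicator {-1..1} t *\<^sub>R (poly q (of_real t) * exp (\<i> * of_real (x * t))))"
    using set_borel_integral_eq_integral(2)[OF *] by (simp add: band_kernel_def set_lebesgue_integral_def)
qed

text \<open>The characteristic function of the standard normal law, freed from its normalising
  factor and rescaled by \<open>\<epsilon>\<close>.\<close>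

lemma gaussian_fourier:
  assumes "0 < \<epsilon>"
  shows "integrable lborel (\<lambda>x. exp (\<i> * of_real (u * x)) * of_real (exp (- (\<epsilon> * x)\<^sup>2 / 2)))"
    and "(LINT x|lborel. exp (\<i> * of_real (u * x)) * of_real (exp (- (\<epsilon> * x)\<^sup>2 / 2)))
      = of_real (sqrt (2 * pi) / \<epsilon> * exp (- (u / \<epsilon>)\<^sup>2 / 2))"
proof -
  let ?g = "\<lambda>v z. exp (\<i> * of_real (v * z)) * of_real (exp (- z\<^sup>2 / 2))"
  have int: "integrable lborel (?g v)" for v
  proof (rule Bochner_Integration.integrable_bound)
    show "integrable lborel (\<lambda>z. sqrt (2 * pi) * std_normal_density z)"
      by (intro integrable_mult_right) simp
    show "AE z in lborel. norm (?g v z) \<le> norm (sqrt (2 * pi) * std_normal_density z)"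
      by (intro AE_I2) (simp add: norm_mult std_normal_density_def)
  qed measurable
  have val: "(LINT z|lborel. ?g v z) = of_real (sqrt (2 * pi) * exp (- v\<^sup>2 / 2))" for v
  proof -
    have "(LINT z|lborel. std_normal_density z *\<^sub>R exp (\<i> * of_real (v * z))) = char std_normal_distribution v"
      unfolding char_def
      by (subst integral_density) (auto simp: normal_density_nonneg)
    also have "\<dots> = of_real (exp (- v\<^sup>2 / 2))" by (simp add: char_std_normal_distribution)
    finally have "of_real (sqrt (2 * pi)) * (LINT z|lborel. std_normal_density z *\<^sub>R exp (\<i> * of_real (v * z)))
       = of_real (sqrt (2 * pi) * exp (- v\<^sup>2 / 2))" by simp
    moreover have "of_real (sqrt (2 * pi)) * (LINT z|lborel. std_normal_density z *\<^sub>R exp (\<i> * of_real (v * z)))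
       = (LINT z|lborel. ?g v z)"
      unfolding integral_mult_right_zero[symmetric]
      by (intro Bochner_Integration.integral_cong refl) (simp add: std_normal_density_def scaleR_conv_of_real mult_ac)
    ultimately show ?thesis by simp
  qed
  have eq: "exp (\<i> * of_real (u * x)) * of_real (exp (- (\<epsilon> * x)\<^sup>2 / 2)) = ?g (u / \<epsilon>) (0 + \<epsilon> * x)" for x
    using assms by simp
  show "integrable lborel (\<lambda>x. exp (\<i> * of_real (u * x)) * of_real (exp (- (\<epsilon> * x)\<^sup>2 / 2)))"
    unfolding eq using assms by (intro lborel_integrable_real_affine int) auto
  have "(LINT z|lborel. ?g (u / \<epsilon>) z) = \<epsilon> *\<^sub>R (LINT x|lborel. ?g (u / \<epsilon>) (0 + \<epsilon> * x))"
    using assms lborel_integral_real_affine[of \<epsilon> "?g (u / \<epsilon>)" 0] by simp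
  then show "(LINT x|lborel. exp (\<i> * of_real (u * x)) * of_real (exp (- (\<epsilon> * x)\<^sup>2 / 2)))
      = of_real (sqrt (2 * pi) / \<epsilon> * exp (- (u / \<epsilon>)\<^sup>2 / 2))"
    unfolding eq val using assms by (simp add: scaleR_conv_of_real field_simps)
qed

text \<open>The Gaussian factor makes Fubini's theorem applicable; letting \<open>\<epsilon>\<close> tend to 0 gives Fourier
  inversion for the kernel.\<close>

lemma band_kernel_regularised:
  assumes \<epsilon>: "0 < \<epsilon>"
  shows "(LINT x|lborel. band_kernel q x * exp (- (\<i> * of_real (\<xi> * x))) * of_real (exp (- (\<epsilon> * x)\<^sup>2 / 2)))
    = of_real (sqrt (2 * pi)) * (LINT z|lborel. indicator {-1..1} (\<xi> + \<epsilon> * z) *\<^sub>R (poly q (of_real (\<xi>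
        + \<epsilon> * z)) * of_real (exp (- z\<^sup>2 / 2))))"
proof -
  define k where "k t = (indicator {-1..1} t :: real) *\<^sub>R poly q (of_real t)" for t :: real
  have [measurable]: "k \<in> borel_measurable borel"
    unfolding k_def by (intro borel_measurable_scaleR borel_measurable_indicator
        borel_measurable_continuous_onI continuous_intros) auto
  define G where "G x = (of_real (exp (- (\<epsilon> * x)\<^sup>2 / 2)) :: complex)" for x :: real
  have [measurable]: "G \<in> borel_measurable borel" unfolding G_def by measurable
  have kint: "integrable lborel k"
    using band_kernel_eq_lebesgue(2)[of q 0] by (simp add: k_def[abs_def])
  have Gint: "integrable lborel (\<lambda>x. norm (G x))"
    using gaussian_fourier(1)[OF \<epsilon>, of 0] by (intro integrable_norm) (simp add: G_def)
  let ?F = "\<lambda>x t. k t * (exp (\<i> * of_real ((t - \<xi>) * x)) * G x)"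
  have int: "integrable (lborel \<Otimes>\<^sub>M lborel) (\<lambda>(x, t). ?F x t)"
  proof (rule lborel_pair.Fubini_integrable)
    show "(\<lambda>(x, t). ?F x t) \<in> borel_measurable (lborel \<Otimes>\<^sub>M lborel)" by measurable
    have "integrable lborel (\<lambda>x. norm (G x) * (LINT t|lborel. norm (k t)))"
      using Gint by simp
    then show "integrable lborel (\<lambda>x. LINT t|lborel. norm (case (x, t) of (x, t) \<Rightarrow> ?F x t))"
      by (simp add: norm_mult mult.commute)
    show "AE x in lborel. integrable lborel (\<lambda>t. case (x, t) of (x, t) \<Rightarrow> ?F x t)"
    proof (intro AE_I2, simp only: prod.case)
      fix x
      show "integrable lborel (\<lambda>t. ?F x t)"
        by (rule Bochner_Integration.integrable_bound[where f = "\<lambda>t. norm (k t) * norm (G x)"])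
           (use kint in \<open>auto simp: norm_mult\<close>)
    qed
  qed
  have 1: "band_kernel q x * exp (- (\<i> * of_real (\<xi> * x))) * G x = (LINT t|lborel. ?F x t)" for x
  proof -
    have "(LINT t|lborel. ?F x t) = (LINT t|lborel. (indicator {-1..1} t *\<^sub>R (poly q (of_real t) * exp (\<i> *
        of_real (x * t)))) * (exp (- (\<i> * of_real (\<xi> * x))) * G x))"
    proof (intro Bochner_Integration.integral_cong refl)
      fix t
      have "exp (\<i> * of_real ((t - \<xi>) * x)) = exp (\<i> * of_real (x * t)) * exp (- (\<i> * of_real (\<xi> * x)))"
        by (simp add: exp_add[symmetric] algebra_simps)
      then show "?F x t = (indicator {-1..1} t *\<^sub>R (poly q (of_real t) * exp (\<i> * of_real (x * t)))) * (exp
          (- (\<i> * of_real (\<xi> * x))) * G x)"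
        by (simp add: k_def)
    qed
    also have "\<dots> = band_kernel q x * (exp (- (\<i> * of_real (\<xi> * x))) * G x)"
      unfolding band_kernel_eq_lebesgue(1) by (rule integral_mult_left_zero)
    finally show ?thesis by (simp only: mult.assoc)
  qed
  have 2: "(LINT x|lborel. ?F x t) = k t * of_real (sqrt (2 * pi) / \<epsilon> * exp (- ((t - \<xi>) / \<epsilon>)\<^sup>2 / 2))" for t
    using gaussian_fourier(2)[OF \<epsilon>, of "t - \<xi>"] by (simp add: G_def)
  have "(LINT x|lborel. band_kernel q x * exp (- (\<i> * of_real (\<xi> * x))) * G x)
      = (LINT x|lborel. (LINT t|lborel. ?F x t))"
    unfolding 1 ..
  also have "\<dots> = (LINT t|lborel. (LINT x|lborel. ?F x t))"
    by (rule lborel_pair.Fubini_integral[OF int, symmetric])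
  also have "\<dots> = (LINT t|lborel. k t * of_real (sqrt (2 * pi) / \<epsilon> * exp (- ((t - \<xi>) / \<epsilon>)\<^sup>2 / 2)))"
    unfolding 2 ..
  \<comment> \<open>Substituting t = \<xi> + \<epsilon> z fixes the Gaussian and moves
    \<open>\<epsilon>\<close> into the symbol, where the limit is a matter of continuity.\<close>
  also have "\<dots> = \<epsilon> *\<^sub>R (LINT z|lborel. k (\<xi> + \<epsilon> * z) * of_real (sqrt (2 * pi) / \<epsilon> * exp (- z\<^sup>2 / 2)))"
    using \<epsilon> by (subst lborel_integral_real_affine[of \<epsilon> _ \<xi>]) auto
  also have "\<dots> = (LINT z|lborel. of_real (sqrt (2 * pi)) * (indicator {-1..1} (\<xi>
      + \<epsilon> * z) *\<^sub>R (poly q (of_real (\<xi> + \<epsilon> * z)) * of_real (exp (- z\<^sup>2 / 2)))))"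
    unfolding integral_scaleR_right[symmetric]
    using \<epsilon> by (intro Bochner_Integration.integral_cong refl) (simp add: k_def scaleR_conv_of_real)
  also have "\<dots> = of_real (sqrt (2 * pi)) * (LINT z|lborel. indicator {-1..1} (\<xi>
      + \<epsilon> * z) *\<^sub>R (poly q (of_real (\<xi> + \<epsilon> * z)) * of_real (exp (- z\<^sup>2 / 2))))"
    by (rule integral_mult_right_zero)
  finally show ?thesis by (simp only: G_def)
qed

text \<open>Both sides of the regularised identity converge by dominated convergence. A double zero
  at the ends makes the kernel integrable, which dominates the left side, and makes the cut-off
  symbol continuous, so the right side converges at every frequency, including the ends of the band.
  The two Gaussian factors \<open>sqrt (2 * pi)\<close> multiply to \<open>2 * pi\<close>.\<close>

lemma integral_band_kernel_exp:
  assumes q: "edge ^ 2 dvd q"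
  shows "(LINT x|lborel. band_kernel q x * exp (- (\<i> * of_real (\<xi> * x))))
    = 2 * pi * (indicator {-1..1} \<xi> *\<^sub>R poly q (of_real \<xi>))"
proof -
  let ?f = "\<lambda>x. band_kernel q x * exp (- (\<i> * of_real (\<xi> * x)))"
  let ?g = "\<lambda>z. complex_of_real (exp (- z\<^sup>2 / 2))"
  define k where "k t = (indicator {-1..1} t :: real) *\<^sub>R poly q (of_real t)" for t :: real
  have [measurable]: "k \<in> borel_measurable borel"
    unfolding k_def by (intro borel_measurable_scaleR borel_measurable_indicator
        borel_measurable_continuous_onI continuous_intros) auto
  obtain w where w: "q = edge ^ 2 * w" using q by (elim dvdE)
  have q0: "poly q 1 = 0" "poly q (-1) = 0" by (auto simp: w)
  have kcont: "isCont k t" for t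
  proof -
    \<comment> \<open>As the symbol vanishes at both ends, cutting it off equals clamping its
      argument to [-1, 1], which is visibly continuous.\<close>
    have k': "k = (\<lambda>t. poly q (of_real (max (-1) (min 1 t))))"
    proof
      fix t :: real
      show "k t = poly q (of_real (max (-1) (min 1 t)))"
        using q0 by (cases "t < -1"; cases "t > 1") (auto simp: k_def max_def min_def)
    qed
    show ?thesis unfolding k' by (intro continuous_intros)
  qed
  have kbd: "\<exists>B. \<forall>t. norm (k t) \<le> B"
  proof -
    obtain B where "0 \<le> B" "\<And>t::real. t \<in> {-1..1} \<Longrightarrow> norm (poly q (of_real t)) \<le> B"
      using poly_bounded_on_interval[of q] by blast
    then have "norm (k t) \<le> B" for t
      by (cases "t \<in> {-1..1}") (auto simp: k_def)
    then show ?thesis by blast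
  qed
  then obtain B where B: "\<And>t. norm (k t) \<le> B" by blast
  define \<epsilon> where "\<epsilon> n = inverse (real (Suc n))" for n
  have \<epsilon>: "0 < \<epsilon> n" for n by (simp add: \<epsilon>_def)
  let ?G = "\<lambda>n x. complex_of_real (exp (- (\<epsilon> n * x)\<^sup>2 / 2))"
  have \<epsilon>0: "\<epsilon> \<longlonglongrightarrow> 0" unfolding \<epsilon>_def by (rule LIMSEQ_inverse_real_of_nat)
  have gint: "integrable lborel (\<lambda>z::real. exp (- z\<^sup>2 / 2))"
  proof -
    have "integrable lborel (\<lambda>z. sqrt (2 * pi) * std_normal_density z)"
      by (intro integrable_mult_right) simp
    then show ?thesis by (simp add: std_normal_density_def)
  qed
  have gval: "(LINT z|lborel. exp (- z\<^sup>2 / 2)) = sqrt (2 * pi)"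
    using gaussian_fourier(2)[of 1 0] by simp
  have L: "(\<lambda>n. LINT x|lborel. ?f x * ?G n x)
     \<longlonglongrightarrow> (LINT x|lborel. ?f x)"
  proof (rule integral_dominated_convergence[where w = "\<lambda>x. norm (band_kernel q x)"])
    show "integrable lborel (\<lambda>x. norm (band_kernel q x))"
      by (intro integrable_norm band_kernel_integrable q)
    show "AE x in lborel. (\<lambda>n. ?f x * ?G n x)
        \<longlonglongrightarrow> ?f x"
    proof (intro AE_I2)
      fix x
      have "(\<lambda>n. ?f x * ?G n x)
        \<longlonglongrightarrow> ?f x * of_real (exp (- (0 * x)\<^sup>2 / 2))"
        by (intro tendsto_intros \<epsilon>0) simp
      then show "(\<lambda>n. ?f x * ?G n x)
        \<longlonglongrightarrow> ?f x" by simp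
    qed
    show "AE x in lborel. norm (?f x * ?G n x) \<le> norm (band_kernel q x)" for n
      by (intro AE_I2) (simp add: norm_mult mult_left_le)
  qed measurable
  have R: "(\<lambda>n. LINT z|lborel. k (\<xi> + \<epsilon> n * z) * ?g z)
     \<longlonglongrightarrow> (LINT z|lborel. k \<xi> * ?g z)"
  proof (rule integral_dominated_convergence[where w = "\<lambda>z. B * exp (- z\<^sup>2 / 2)"])
    show "integrable lborel (\<lambda>z. B * exp (- z\<^sup>2 / 2))" using gint by simp
    show "AE z in lborel. (\<lambda>n. k (\<xi> + \<epsilon> n * z) * ?g z) \<longlonglongrightarrow> k \<xi> * ?g z"
    proof (intro AE_I2 tendsto_mult tendsto_const)
      fix z
      have "(\<lambda>n. \<xi> + \<epsilon> n * z) \<longlonglongrightarrow> \<xi> + 0 * z" by (intro tendsto_intros \<epsilon>0)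
      then show "(\<lambda>n. k (\<xi> + \<epsilon> n * z)) \<longlonglongrightarrow> k \<xi>" using kcont isCont_tendsto_compose by fastforce
    qed
    show "AE z in lborel. norm (k (\<xi> + \<epsilon> n * z) * ?g z) \<le> B * exp (- z\<^sup>2 / 2)" for n
      using B by (intro AE_I2) (simp add: norm_mult mult_right_mono)
  qed measurable
  have eq: "(LINT x|lborel. ?f x * ?G n x)
      = of_real (sqrt (2 * pi)) * (LINT z|lborel. k (\<xi> + \<epsilon> n * z) * ?g z)" for n
    unfolding band_kernel_regularised[OF \<epsilon>] by (simp add: k_def)
  have "(\<lambda>n. LINT x|lborel. ?f x * ?G n x)
     \<longlonglongrightarrow> of_real (sqrt (2 * pi)) * (LINT z|lborel. k \<xi> * ?g z)"
    unfolding eq by (intro tendsto_mult tendsto_const R)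
  from LIMSEQ_unique[OF L this]
  have "(LINT x|lborel. ?f x)
      = of_real (sqrt (2 * pi)) * (k \<xi> * of_real (sqrt (2 * pi)))"
    by (simp add: gval[simplified])
  also have "\<dots> = of_real (sqrt (2 * pi) * sqrt (2 * pi)) * k \<xi>" by (simp only: of_real_mult mult_ac)
  also have "sqrt (2 * pi) * sqrt (2 * pi) = 2 * pi" by simp
  finally show ?thesis by (simp add: k_def)
qed

lemma band_limited_kernel_exists:
  assumes M: "2 \<le> M"
  obtains \<phi> :: "nat \<Rightarrow> real \<Rightarrow> real" where
    "\<And>n x. (\<phi> n has_real_derivative \<phi> (Suc n) x) (at x)"
    "\<And>n. \<exists>C. \<forall>x. \<bar>\<phi> n x\<bar> \<le> C * (1 / (1 + \<bar>x\<bar>) ^ M)"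
    "\<And>n \<xi>. 1 < \<bar>\<xi>\<bar> \<Longrightarrow> (LINT x|lborel. complex_of_real (\<phi> n x) * exp (\<i> * of_real (\<xi> * x))) = 0"
    "(LINT x|lborel. \<phi> 0 x) = 1"
    "\<And>n. 1 \<le> n \<Longrightarrow> (LINT x|lborel. \<phi> n x) = 0"
proof
  \<comment> \<open>Inversion at frequency 0 returns \<open>2 * pi\<close> times the symbol at 0,
    and \<open>edge ^ M\<close> is \<open>(- 1) ^ M\<close> there; hence the normalisation. The
    power of \<open>[:0, \<i>:]\<close> produces the \<open>n\<close>-th derivative: it keeps the
    order of the zeros at the ends, so all derivatives decay alike, and it vanishes at 0 for
    positive \<open>n\<close>.\<close>
  define q where "q n = [:0, \<i>:] ^ n * (smult (of_real ((- 1) ^ M / (2 * pi))) (edge ^ M))" for n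
  define \<phi> where "\<phi> n x = Re (band_kernel (q n) x)" for n x
  have dvdM: "edge ^ M dvd q n" for n unfolding q_def by (intro dvd_mult dvd_smult) simp
  have dvd2: "edge ^ 2 dvd q n" for n using dvdM[of n] le_imp_power_dvd[OF M, of edge] by (rule dvd_trans[rotated])
  have int: "integrable lborel (band_kernel (q n))" for n by (rule band_kernel_integrable[OF dvd2])
  show "(\<phi> n has_real_derivative \<phi> (Suc n) x) (at x)" for n x
  proof -
    have "[:0, \<i>:] * q n = q (Suc n)" by (simp add: q_def mult.assoc)
    then have "(band_kernel (q n) has_vector_derivative band_kernel (q (Suc n)) x) (at x)"
      using band_kernel_has_vector_derivative[of "q n" x] by simp
    from bounded_linear.has_vector_derivative[OF bounded_linear_Re this]
    show ?thesis by (simp add: \<phi>_def[abs_def] has_real_derivative_iff_has_vector_derivative)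
  qed
  show "\<exists>C. \<forall>x. \<bar>\<phi> n x\<bar> \<le> C * (1 / (1 + \<bar>x\<bar>) ^ M)" for n
    using band_kernel_decay[OF dvdM[of n]] abs_Re_le_cmod unfolding \<phi>_def by (meson order_trans)
  have eint: "integrable lborel (\<lambda>x. band_kernel (q n) x * exp (- (\<i> * of_real (\<xi> * x))))" for n \<xi>
    by (rule Bochner_Integration.integrable_bound[OF integrable_norm[OF int[of n]]]) (auto simp: norm_mult)
  show "(LINT x|lborel. complex_of_real (\<phi> n x) * exp (\<i> * of_real (\<xi> * x))) = 0" if "1 < \<bar>\<xi>\<bar>" for n \<xi>
  proof -
    let ?e = "\<lambda>\<xi> x. band_kernel (q n) x * exp (- (\<i> * of_real (\<xi> * x)))"
    have 0: "(LINT x|lborel. ?e \<xi> x) = 0" "(LINT x|lborel. ?e (- \<xi>) x) = 0"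
      unfolding integral_band_kernel_exp[OF dvd2] using that by (auto simp: indicator_def)
    \<comment> \<open>Taking real parts keeps the band: the transform of the real part averages the
      original one at a frequency with the conjugate at the opposite frequency, and the band is
      symmetric.\<close>
    have "complex_of_real (\<phi> n x) * exp (\<i> * of_real (\<xi> * x)) = (?e (- \<xi>) x + cnj (?e \<xi> x)) / 2" for x
    proof -
      have "complex_of_real (\<phi> n x) = (band_kernel (q n) x + cnj (band_kernel (q n) x)) / 2"
        by (simp add: \<phi>_def complex_add_cnj)
      moreover have "cnj (exp (- (\<i> * of_real (\<xi> * x)))) = exp (\<i> * of_real (\<xi> * x))"
        by (simp add: exp_cnj)
      ultimately show ?thesis by (simp add: algebra_simps add_divide_distrib)
    qed
    then have "(LINT x|lborel. complex_of_real (\<phi> n x) * exp (\<i> * of_real (\<xi> * x)))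
       = (LINT x|lborel. (?e (- \<xi>) x + cnj (?e \<xi> x)) / 2)" by (simp only:)
    also have "\<dots> = (LINT x|lborel. ?e (- \<xi>) x + cnj (?e \<xi> x)) / 2"
      by (rule integral_divide_zero)
    also have "(LINT x|lborel. ?e (- \<xi>) x + cnj (?e \<xi> x)) = (LINT x|lborel. ?e (- \<xi>) x)
        + (LINT x|lborel. cnj (?e \<xi> x))"
      using eint by (intro Bochner_Integration.integral_add) (simp_all only: integrable_cnj)
    also have "(LINT x|lborel. cnj (?e \<xi> x)) = cnj (LINT x|lborel. ?e \<xi> x)"
      by (rule Bochner_Integration.integral_cnj)
    finally show ?thesis unfolding 0 by simp
  qed
  have Re_int: "(LINT x|lborel. \<phi> n x) = Re (2 * pi * poly (q n) 0)" for n
  proof -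
    have "(LINT x|lborel. \<phi> n x) = Re (LINT x|lborel. band_kernel (q n) x)"
      unfolding \<phi>_def using int by simp
    also have "(LINT x|lborel. band_kernel (q n) x) = 2 * pi * poly (q n) 0"
      using integral_band_kernel_exp[OF dvd2, of n 0] by simp
    finally show ?thesis .
  qed
  show "(LINT x|lborel. \<phi> 0 x) = 1"
    unfolding Re_int q_def by (simp add: poly_power power_mult_distrib[symmetric])
  show "(LINT x|lborel. \<phi> n x) = 0" if "1 \<le> n" for n
    unfolding Re_int q_def using that by (simp add: poly_power power_0_left)
qed

subsection \<open>Convolution with products of band-limited kernels\<close>

text \<open>Differentiation under the integral: along any sequence the difference quotients are
  dominated by \<open>w\<close>, by the mean value inequality.\<close>

lemma has_real_derivative_integral:
  fixes F F' :: "real \<Rightarrow> 'a \<Rightarrow> real"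
  assumes d: "\<And>t y. ((\<lambda>t. F t y) has_real_derivative F' t y) (at t)"
    and F: "\<And>t. integrable M (F t)" and w: "integrable M w"
    and F'w: "\<And>t y. \<bar>F' t y\<bar> \<le> w y" and F'm: "F' t0 \<in> borel_measurable M"
  shows "((\<lambda>t. LINT y|M. F t y) has_real_derivative (LINT y|M. F' t0 y)) (at t0)"
  unfolding has_field_derivative_iff tendsto_at_iff_sequentially
proof (intro allI impI)
  fix X :: "nat \<Rightarrow> real"
  assume X: "\<forall>n. X n \<in> UNIV - {t0}" "X \<longlonglongrightarrow> t0"
  have "(\<lambda>n. LINT y|M. (F (X n) y - F t0 y) / (X n - t0)) \<longlonglongrightarrow> (LINT y|M. F' t0 y)"
  proof (rule integral_dominated_convergence[OF F'm _ w])
    show "(\<lambda>y. (F (X n) y - F t0 y) / (X n - t0)) \<in> borel_measurable M" for n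
      using borel_measurable_integrable[OF F] by measurable
    show "AE y in M. (\<lambda>n. (F (X n) y - F t0 y) / (X n - t0)) \<longlonglongrightarrow> F' t0 y"
    proof (intro AE_I2)
      fix y
      have "((\<lambda>t. (F t y - F t0 y) / (t - t0)) \<longlongrightarrow> F' t0 y) (at t0)"
        using d[of y t0] by (simp add: has_field_derivative_iff)
      then show "(\<lambda>n. (F (X n) y - F t0 y) / (X n - t0)) \<longlonglongrightarrow> F' t0 y"
        using X unfolding tendsto_at_iff_sequentially by (auto simp: o_def)
    qed
    show "AE y in M. norm ((F (X n) y - F t0 y) / (X n - t0)) \<le> w y" for n
    proof (intro AE_I2)
      fix y
      have "\<bar>F (X n) y - F t0 y\<bar> \<le> w y * \<bar>X n - t0\<bar>"
        using field_differentiable_bound[of UNIV "\<lambda>t. F t y" "\<lambda>t. F' t y" "w y" "X n" t0]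
          d F'w by (simp add: abs_minus_commute)
      then show "norm ((F (X n) y - F t0 y) / (X n - t0)) \<le> w y"
        using X(1) by (auto simp: divide_le_eq)
    qed
  qed
  moreover have "(LINT y|M. (F (X n) y - F t0 y) / (X n - t0))
      = ((LINT y|M. F (X n) y) - (LINT y|M. F t0 y)) / (X n - t0)" for n
    using F by simp
  ultimately show "((\<lambda>t. ((LINT y|M. F t y) - (LINT y|M. F t0 y)) / (t - t0)) \<circ> X) \<longlonglongrightarrow> (LINT y|M. F' t0 y)"
    by (simp only: o_def)
qed

text \<open>Moves the base point from \<open>f\<close>, which is merely integrable, into the smooth
  kernel, so that continuity and derivatives in \<open>x\<close> can be read off the kernel.\<close>

lemma conv_eq_kernel:
  fixes f :: "real ^ 'd \<Rightarrow> real"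
  assumes A: "A \<in> borel_measurable borel" and f: "f \<in> borel_measurable borel" and \<tau>: "0 < \<tau>"
  shows "conv \<tau> A f x = (1 / \<tau> ^ CARD('d)) * (LINT y|lborel. A ((1 / \<tau>) *\<^sub>R (y - x)) * f y)"
proof -
  note [measurable] = A f
  have "(LINT y|lborel. A ((1 / \<tau>) *\<^sub>R (y - x)) * f y) = \<tau> ^ CARD('d) * conv \<tau> A f x"
    using \<tau> by (subst integral_affine[of _ \<tau> x]) (auto simp: conv_def)
  then show ?thesis using \<tau> by simp
qed

lemma kernel_integrable:
  fixes f :: "real ^ 'd \<Rightarrow> real"
  assumes A: "A \<in> borel_measurable borel" "\<And>v. \<bar>A v\<bar> \<le> C" and f: "integrable lborel f"
  shows "integrable lborel (\<lambda>y. A (c *\<^sub>R (y - x)) * f y)"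
proof (rule Bochner_Integration.integrable_bound)
  have [measurable]: "f \<in> borel_measurable borel" "A \<in> borel_measurable borel" using f A by auto
  show "(\<lambda>y. A (c *\<^sub>R (y - x)) * f y) \<in> borel_measurable lborel" by measurable
  show "integrable lborel (\<lambda>y. C * \<bar>f y\<bar>)" using f by simp
  have "0 \<le> C" using A(2)[of 0] by linarith
  then show "AE y in lborel. norm (A (c *\<^sub>R (y - x)) * f y) \<le> norm (C * \<bar>f y\<bar>)"
    using A(2) by (intro AE_I2) (auto simp: abs_mult intro: mult_right_mono)
qed

lemma continuous_conv:
  fixes f :: "real ^ 'd \<Rightarrow> real"
  assumes A: "continuous_on UNIV A" "\<And>v. \<bar>A v\<bar> \<le> C" and f: "integrable lborel f" and \<tau>: "0 < \<tau>"
  shows "continuous_on UNIV (conv \<tau> A f)"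
proof (rule continuous_on_sequentiallyI)
  fix u and x :: "real ^ 'd"
  assume u: "u \<longlonglongrightarrow> x"
  have [measurable]: "f \<in> borel_measurable borel" "A \<in> borel_measurable borel"
    using f A by (auto intro: borel_measurable_continuous_onI)
  have C: "0 \<le> C" using A(2)[of 0] by linarith
  have "(\<lambda>n. LINT y|lborel. A ((1 / \<tau>) *\<^sub>R (y - u n)) * f y) \<longlonglongrightarrow> (LINT y|lborel. A ((1 / \<tau>) *\<^sub>R (y - x)) * f y)"
  proof (rule integral_dominated_convergence[where w = "\<lambda>y. C * \<bar>f y\<bar>"])
    show "integrable lborel (\<lambda>y. C * \<bar>f y\<bar>)" using f by simp
    show "AE y in lborel. (\<lambda>n. A ((1 / \<tau>) *\<^sub>R (y - u n)) * f y) \<longlonglongrightarrow> A ((1 / \<tau>) *\<^sub>R (y - x)) * f y"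
    proof (intro AE_I2 tendsto_mult tendsto_const)
      fix y
      show "(\<lambda>n. A ((1 / \<tau>) *\<^sub>R (y - u n))) \<longlonglongrightarrow> A ((1 / \<tau>) *\<^sub>R (y - x))"
        by (rule continuous_on_tendsto_compose[OF A(1)]) (auto intro!: tendsto_intros u)
    qed
    show "AE y in lborel. norm (A ((1 / \<tau>) *\<^sub>R (y - u n)) * f y) \<le> C * \<bar>f y\<bar>" for n
      using A(2) by (intro AE_I2) (auto simp: abs_mult intro: mult_right_mono)
  qed measurable
  then show "(\<lambda>n. conv \<tau> A f (u n)) \<longlonglongrightarrow> conv \<tau> A f x"
    unfolding conv_eq_kernel[OF \<open>A \<in> borel_measurable borel\<close> \<open>f \<in> borel_measurable borel\<close> \<tau>]
    by (rule tendsto_mult_left)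
qed

section \<open>The convolution theorem and derivatives of product kernels\<close>

lemma fourier_lborel:
  assumes [measurable]: "f \<in> borel_measurable borel"
  shows "fourier f x = (LINT y|lborel. complex_of_real (f y) * exp (- 2 * of_real pi * \<i> * of_real (x \<bullet> y)))"
  unfolding fourier_def by (rule integral_completion) measurable

text \<open>The exponent has a plus sign because \<open>conv\<close> evaluates \<open>f\<close> at
  \<open>x + \<tau> *\<^sub>R v\<close>; the factor \<open>2 * pi * \<tau>\<close> comes from the
  dilation and the normalisation of \<open>fourier\<close>.\<close>

lemma fourier_conv:
  fixes f :: "real ^ 'd \<Rightarrow> real"
  assumes A: "decaying k A" "2 \<le> k" and f: "integrable lborel f"
  shows "fourier (conv \<tau> A f) x
    = (LINT v|lborel. complex_of_real (A v) * exp (\<i> * of_real (((2 * pi * \<tau>) *\<^sub>R x) \<bullet> v))) * fourier f x"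
proof -
  have [measurable]: "A \<in> borel_measurable borel" "f \<in> borel_measurable borel"
    using A f by (auto simp: decaying_def)
  define e where "e y = exp (- 2 * of_real pi * \<i> * of_real (x \<bullet> y))" for y
  have [measurable]: "e \<in> borel_measurable borel"
    unfolding e_def by measurable
  have e1: "norm (e y) = 1" for y
  proof -
    have "e y = exp (\<i> * of_real (- 2 * pi * (x \<bullet> y)))" by (simp add: e_def mult_ac)
    then show ?thesis by simp
  qed
  have eadd: "e (y + z) = e y * e z" for y z
    by (simp add: e_def exp_add[symmetric] inner_add_right algebra_simps)
  let ?F = "\<lambda>v y. complex_of_real (A v * f (y + \<tau> *\<^sub>R v)) * e y"
  have Fn: "norm (?F v y) = \<bar>A v\<bar> * \<bar>f (y + \<tau> *\<^sub>R v)\<bar>" for v y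
    by (simp add: norm_mult e1 abs_mult)
  have fshift: "integrable lborel (\<lambda>y. f (y + \<tau> *\<^sub>R v))" for v
    using integrable_affine[OF f, of 1 "\<tau> *\<^sub>R v"] by (simp add: add.commute)
  have int: "integrable (lborel \<Otimes>\<^sub>M lborel) (\<lambda>(v, y). ?F v y)"
  proof (rule lborel_pair.Fubini_integrable)
    show "(\<lambda>(v, y). ?F v y) \<in> borel_measurable (lborel \<Otimes>\<^sub>M lborel)" by measurable
    have "(LINT y|lborel. norm (?F v y)) = \<bar>A v\<bar> * (LINT y|lborel. \<bar>f y\<bar>)" for v
    proof -
      have "(LINT y|lborel. \<bar>f y\<bar>) = (LINT y|lborel. \<bar>f (y + \<tau> *\<^sub>R v)\<bar>)"
        by (subst integral_affine[of _ 1 "\<tau> *\<^sub>R v"]) (auto simp: add.commute)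
      then show ?thesis unfolding Fn by simp
    qed
    then show "integrable lborel (\<lambda>v. LINT y|lborel. norm (case (v, y) of (v, y) \<Rightarrow> ?F v y))"
      using decaying_integrable[OF A] by simp
    show "AE v in lborel. integrable lborel (\<lambda>y. case (v, y) of (v, y) \<Rightarrow> ?F v y)"
    proof (intro AE_I2, simp only: prod.case)
      fix v
      show "integrable lborel (\<lambda>y. ?F v y)"
      proof (rule Bochner_Integration.integrable_bound)
        show "integrable lborel (\<lambda>y. \<bar>A v\<bar> * \<bar>f (y + \<tau> *\<^sub>R v)\<bar>)" using fshift by simp
        show "AE y in lborel. norm (?F v y) \<le> norm (\<bar>A v\<bar> * \<bar>f (y + \<tau> *\<^sub>R v)\<bar>)"
          unfolding Fn by simp
      qed measurable
    qed
  qed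
  have "fourier (conv \<tau> A f) x = (LINT y|lborel. complex_of_real (conv \<tau> A f y) * e y)"
    unfolding e_def by (rule fourier_lborel) (rule conv_measurable; simp)
  also have "\<dots> = (LINT y|lborel. (LINT v|lborel. ?F v y))"
    unfolding conv_def integral_complex_of_real[symmetric] integral_mult_left_zero[symmetric] ..
  also have "\<dots> = (LINT v|lborel. (LINT y|lborel. ?F v y))"
    by (rule lborel_pair.Fubini_integral[OF int])
  also have "\<dots> = (LINT v|lborel. (complex_of_real (A v) * e (- \<tau> *\<^sub>R v)) * fourier f x)"
  proof (intro Bochner_Integration.integral_cong refl)
    fix v
    have "fourier f x = (LINT y|lborel. complex_of_real (f y) * e y)"
      unfolding e_def by (rule fourier_lborel) simp
    also have "\<dots> = (LINT y|lborel. complex_of_real (f (y + \<tau> *\<^sub>R v)) * e (y + \<tau> *\<^sub>R v))"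
      by (subst integral_affine[of _ 1 "\<tau> *\<^sub>R v"]) (auto simp: add.commute)
    finally have *: "fourier f x = (LINT y|lborel. complex_of_real (f (y + \<tau> *\<^sub>R v)) * e (y + \<tau> *\<^sub>R v))" .
    have "?F v y = (complex_of_real (A v) * e (- \<tau> *\<^sub>R v)) * (complex_of_real (f (y + \<tau> *\<^sub>R v)) * e (y + \<tau> *\<^sub>R v))" for y
      using eadd[of "- \<tau> *\<^sub>R v" "y + \<tau> *\<^sub>R v"] by (simp add: mult_ac)
    then show "(LINT y|lborel. ?F v y) = (complex_of_real (A v) * e (- \<tau> *\<^sub>R v)) * fourier f x"
      unfolding * by (simp only: integral_mult_right_zero)
  qed
  also have "\<dots> = (LINT v|lborel. complex_of_real (A v) * e (- \<tau> *\<^sub>R v)) * fourier f x"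
    by (rule integral_mult_left_zero)
  also have "(\<lambda>v. complex_of_real (A v) * e (- \<tau> *\<^sub>R v))
      = (\<lambda>v. complex_of_real (A v) * exp (\<i> * of_real (((2 * pi * \<tau>) *\<^sub>R x) \<bullet> v)))"
    by (auto simp: e_def mult_ac)
  finally show ?thesis .
qed

locale band_kernels =
  fixes \<phi> :: "nat \<Rightarrow> real \<Rightarrow> real" and M :: nat
  assumes M: "2 \<le> M"
    and deriv: "(\<phi> n has_real_derivative \<phi> (Suc n) x) (at x)"
    and decay_bound: "\<exists>C. \<forall>x. \<bar>\<phi> n x\<bar> \<le> C * (1 / (1 + \<bar>x\<bar>) ^ M)"
    and fourier_support: "1 < \<bar>\<xi>\<bar> \<Longrightarrow> (LINT x|lborel. complex_of_real (\<phi> n x) * exp (\<i> * of_real (\<xi> * x))) = 0"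
    and integral_0: "(LINT x|lborel. \<phi> 0 x) = 1"
    and integral_Suc: "1 \<le> n \<Longrightarrow> (LINT x|lborel. \<phi> n x) = 0"
begin

text \<open>The mixed derivative of order \<open>\<beta>\<close> of the product kernel, given
  directly by its factors, so that only one-variable calculus is needed.\<close>

definition \<Lambda> :: "('d::finite \<Rightarrow> nat) \<Rightarrow> real ^ 'd \<Rightarrow> real" where
  "\<Lambda> \<beta> v = (\<Prod>i\<in>UNIV. \<phi> (\<beta> i) (v $ i))"

lemma continuous_\<phi>: "continuous_on A (\<phi> n)"
  using deriv by (intro continuous_at_imp_continuous_on ballI DERIV_isCont)

lemma \<phi>_measurable [measurable]: "\<phi> n \<in> borel_measurable borel"
  by (intro borel_measurable_continuous_onI continuous_\<phi>)

lemma continuous_\<Lambda>: "continuous_on UNIV (\<Lambda> \<beta>)"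
  unfolding \<Lambda>_def
  by (intro continuous_on_prod continuous_on_compose2[OF continuous_\<phi>[of UNIV]] continuous_intros) auto

lemma decaying_\<Lambda>: "decaying M (\<Lambda> \<beta>)"
  unfolding decaying_def
proof
  show "\<Lambda> \<beta> \<in> borel_measurable borel"
    by (intro borel_measurable_continuous_onI continuous_\<Lambda>)
  obtain C where C: "\<And>n x. \<bar>\<phi> n x\<bar> \<le> C n * (1 / (1 + \<bar>x\<bar>) ^ M)"
    using decay_bound by metis
  have "\<bar>\<Lambda> \<beta> v\<bar> \<le> (\<Prod>i\<in>UNIV. C (\<beta> i)) * decay M v" for v
    unfolding \<Lambda>_def abs_prod decay_def prod.distrib[symmetric]
    by (intro prod_mono conjI C) simp
  then show "\<exists>C. \<forall>v. \<bar>\<Lambda> \<beta> v\<bar> \<le> C * decay M v" by blast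
qed

lemma \<phi>_integrable: "integrable lborel (\<phi> n)"
proof -
  obtain C where C: "\<And>x. \<bar>\<phi> n x\<bar> \<le> C * (1 / (1 + \<bar>x\<bar>) ^ M)"
    using decay_bound by blast
  show ?thesis
  proof (rule Bochner_Integration.integrable_bound)
    show "integrable lborel (\<lambda>x::real. C * (1 / (1 + \<bar>x\<bar>) ^ M))"
      by (intro integrable_mult_right integrable_inverse_square M)
    show "AE x in lborel. norm (\<phi> n x) \<le> norm (C * (1 / (1 + \<bar>x\<bar>) ^ M))"
      unfolding real_norm_def by (rule AE_I2) (rule order_trans[OF C abs_ge_self])
  qed measurable
qed

lemma integral_\<Lambda>: "(LINT v|lborel. \<Lambda> \<beta> v) = (\<Prod>i\<in>UNIV. (LINT x|lborel. \<phi> (\<beta> i) x))"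
  unfolding \<Lambda>_def by (rule lborel_vec_prod(2)[of "\<lambda>i. \<phi> (\<beta> i)"]) (rule \<phi>_integrable)

lemma integral_\<Lambda>_0: "(LINT v|lborel. \<Lambda> (\<lambda>_. 0) v) = 1"
  by (simp add: integral_\<Lambda> integral_0)

lemma integral_\<Lambda>_pos:
  assumes "1 \<le> (\<Sum>i\<in>UNIV. \<beta> i)"
  shows "(LINT v|lborel. \<Lambda> \<beta> v) = 0"
proof -
  obtain i where "1 \<le> \<beta> i"
    using assms by (metis One_nat_def Suc_leI not_gr_zero not_one_le_zero sum.neutral)
  then show ?thesis
    unfolding integral_\<Lambda> using integral_Suc[of "\<beta> i"] by (intro prod_zero bexI[of _ i]) auto
qed

lemma fourier_\<Lambda>:
  fixes \<xi> :: "real ^ 'd"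
  assumes "1 < \<bar>\<xi> $ j\<bar>"
  shows "(LINT v|lborel. complex_of_real (\<Lambda> \<beta> v) * exp (\<i> * of_real (\<xi> \<bullet> v))) = 0"
proof -
  let ?f = "\<lambda>i x. complex_of_real (\<phi> (\<beta> i) x) * exp (\<i> * of_real (\<xi> $ i * x))"
  have eq: "complex_of_real (\<Lambda> \<beta> v) * exp (\<i> * of_real (\<xi> \<bullet> v)) = (\<Prod>i\<in>UNIV. ?f i (v $ i))" for v
    by (simp add: \<Lambda>_def inner_vec_def sum_distrib_left exp_sum prod.distrib)
  have "integrable lborel (?f i)" for i
    by (rule Bochner_Integration.integrable_bound[OF integrable_norm[OF \<phi>_integrable[of "\<beta> i"]]]) (auto
        simp: norm_mult)
  then have "(LINT v|lborel. (\<Prod>i\<in>UNIV. ?f i ((v :: real ^ 'd) $ i))) = (\<Prod>i\<in>UNIV. (LINT x|lborel. ?f i x))"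
    by (rule lborel_vec_prod(2)[of ?f])
  also have "\<dots> = 0"
    using fourier_support[OF assms, of "\<beta> j"] by (intro prod_zero) auto
  finally show ?thesis unfolding eq .
qed

lemma \<Lambda>_derivative:
  "((\<lambda>t. \<Lambda> \<beta> (c *\<^sub>R (y - (x + t *\<^sub>R axis i 1)))) has_real_derivative
     - c * \<Lambda> (\<beta>(i := Suc (\<beta> i))) (c *\<^sub>R (y - (x + t *\<^sub>R axis i 1)))) (at t)"
proof -
  have split: "\<Lambda> \<alpha> v = \<phi> (\<alpha> i) (v $ i) * (\<Prod>j\<in>UNIV - {i}. \<phi> (\<alpha> j) (v $ j))" for \<alpha> v
    unfolding \<Lambda>_def by (subst prod.remove[of _ i]) auto
  let ?v = "\<lambda>t. c *\<^sub>R (y - (x + t *\<^sub>R axis i 1))"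
  have other: "?v t $ j = c * (y $ j - x $ j)" if "j \<in> UNIV - {i}" for j t
    using that by (simp add: axis_def)
  define P where "P = (\<Prod>j\<in>UNIV - {i}. \<phi> (\<beta> j) (c * (y $ j - x $ j)))"
  have 1: "\<Lambda> \<beta> (?v t) = \<phi> (\<beta> i) (c * (y $ i - (x $ i + t))) * P" for t
    unfolding split P_def by (intro arg_cong2[where f = "(*)"] prod.cong) (auto simp: other, simp add: axis_def)
  have 2: "\<Lambda> (\<beta>(i := Suc (\<beta> i))) (?v t) = \<phi> (Suc (\<beta> i)) (c * (y $ i - (x $ i + t))) * P" for t
    unfolding split P_def by (intro arg_cong2[where f = "(*)"] prod.cong) (auto simp: other, simp add: axis_def)
  have "((\<lambda>t. \<phi> (\<beta> i) (c * (y $ i - (x $ i + t)))) has_real_derivative \<phi> (Suc (\<beta> i)) (c * (y $ i - (x $ i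
      + t))) * (- c)) (at t)"
    by (rule DERIV_chain2[OF deriv]) (auto intro!: derivative_eq_intros)
  from DERIV_cmult_right[OF this, of P] show ?thesis
    unfolding 1 2 by (simp add: mult_ac)
qed

lemma conv_\<Lambda>_derivative:
  fixes f :: "real ^ 'd \<Rightarrow> real"
  assumes f: "integrable lborel f" and \<tau>: "0 < \<tau>"
  shows "((\<lambda>t. conv \<tau> (\<Lambda> \<beta>) f (x + t *\<^sub>R axis i 1)) has_real_derivative
     - (1 / \<tau>) * conv \<tau> (\<Lambda> (\<beta>(i := Suc (\<beta> i)))) f x) (at 0)"
proof -
  let ?\<beta> = "\<beta>(i := Suc (\<beta> i))"
  note [measurable] = decaying_measurable[OF decaying_\<Lambda>[of \<beta>]] decaying_measurable[OF decaying_\<Lambda>[of ?\<beta>]]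
  have [measurable]: "f \<in> borel_measurable borel" using f by auto
  obtain C where C: "\<And>v. \<bar>\<Lambda> \<beta> v\<bar> \<le> C" using decaying_bounded[OF decaying_\<Lambda>[of \<beta>]] by blast
  obtain D where D: "0 \<le> D" "\<And>v. \<bar>\<Lambda> ?\<beta> v\<bar> \<le> D" using decaying_bounded[OF decaying_\<Lambda>[of ?\<beta>]] by blast
  let ?v = "\<lambda>y t. (1 / \<tau>) *\<^sub>R (y - (x + t *\<^sub>R axis i 1))"
  note eq = conv_eq_kernel[OF decaying_measurable[OF decaying_\<Lambda>] \<open>f \<in> borel_measurable borel\<close> \<tau>]
  have "((\<lambda>t. LINT y|lborel. \<Lambda> \<beta> (?v y t) * f y) has_real_derivative
     (LINT y|lborel. (- (1 / \<tau>) * \<Lambda> ?\<beta> (?v y 0)) * f y)) (at 0)"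
  proof (rule has_real_derivative_integral[where w = "\<lambda>y. D / \<tau> * \<bar>f y\<bar>"])
    show "((\<lambda>t. \<Lambda> \<beta> (?v y t) * f y) has_real_derivative (- (1 / \<tau>) * \<Lambda> ?\<beta> (?v y t)) * f y) (at t)" for t y
      by (intro DERIV_cmult_right \<Lambda>_derivative)
    show "integrable lborel (\<lambda>y. \<Lambda> \<beta> (?v y t) * f y)" for t
      by (rule kernel_integrable[OF _ C f]) measurable
    show "integrable lborel (\<lambda>y. D / \<tau> * \<bar>f y\<bar>)" using f by simp
    show "\<bar>(- (1 / \<tau>) * \<Lambda> ?\<beta> (?v y t)) * f y\<bar> \<le> D / \<tau> * \<bar>f y\<bar>" for t y
      unfolding abs_mult using \<tau> D by (intro mult_right_mono) (auto intro!: divide_right_mono)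
  qed measurable
  from DERIV_cmult[OF this, of "1 / \<tau> ^ CARD('d)"]
  have "((\<lambda>t. conv \<tau> (\<Lambda> \<beta>) f (x + t *\<^sub>R axis i 1)) has_real_derivative
     1 / \<tau> ^ CARD('d) * (LINT y|lborel. (- (1 / \<tau>) * \<Lambda> ?\<beta> (?v y 0)) * f y)) (at 0)"
    unfolding eq .
  also have "1 / \<tau> ^ CARD('d) * (LINT y|lborel. (- (1 / \<tau>) * \<Lambda> ?\<beta> (?v y 0)) * f y)
      = - (1 / \<tau>) * conv \<tau> (\<Lambda> ?\<beta>) f x"
    unfolding eq mult.assoc by simp
  finally show ?thesis .
qed

text \<open>The power of \<open>- (1 / \<tau> m)\<close> is the factor that the chain rule produces, so this family is
  closed under partial differentiation.\<close>

definition comb :: "'m set \<Rightarrow> ('m \<Rightarrow> real) \<Rightarrow> ('m \<Rightarrow> real) \<Rightarrow> (real ^ 'd \<Rightarrow> real) \<Rightarrow> ('d::finite \<Rightarrow> nat) \<Rightarrow> real ^ 'd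
    \<Rightarrow> real" where
  "comb I c \<tau> f \<beta> x = (\<Sum>m\<in>I. c m * (- (1 / \<tau> m)) ^ (\<Sum>i\<in>UNIV. \<beta> i) * conv (\<tau> m) (\<Lambda> \<beta>) f x)"

lemma partial_deriv_comb:
  fixes f :: "real ^ 'd \<Rightarrow> real"
  assumes f: "integrable lborel f" and \<tau>: "\<And>m. m \<in> I \<Longrightarrow> 0 < \<tau> m"
  shows "partial_deriv i (comb I c \<tau> f \<beta>) = comb I c \<tau> f (\<beta>(i := Suc (\<beta> i)))"
proof
  fix x
  have S: "(\<Sum>j\<in>UNIV. (\<beta>(i := Suc (\<beta> i))) j) = Suc (\<Sum>j\<in>UNIV. \<beta> j)"
    by (subst (1 2) sum.remove[of _ i]) auto
  have "((\<lambda>t. comb I c \<tau> f \<beta> (x + t *\<^sub>R axis i 1)) has_real_derivative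
     (\<Sum>m\<in>I. (c m * (- (1 / \<tau> m)) ^ (\<Sum>i\<in>UNIV. \<beta> i)) * (- (1 / \<tau> m) * conv (\<tau> m) (\<Lambda> (\<beta>(i := Suc (\<beta> i)))) f x))) (at 0)"
    unfolding comb_def by (intro DERIV_sum DERIV_cmult conv_\<Lambda>_derivative f \<tau>)
  then have "partial_deriv i (comb I c \<tau> f \<beta>) x =
     (\<Sum>m\<in>I. (c m * (- (1 / \<tau> m)) ^ (\<Sum>i\<in>UNIV. \<beta> i)) * (- (1 / \<tau> m) * conv (\<tau> m) (\<Lambda> (\<beta>(i := Suc (\<beta> i)))) f x))"
    unfolding partial_deriv_def by (rule DERIV_imp_deriv)
  also have "\<dots> = comb I c \<tau> f (\<beta>(i := Suc (\<beta> i))) x"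
    unfolding comb_def S by (intro sum.cong refl) (simp add: mult_ac)
  finally show "partial_deriv i (comb I c \<tau> f \<beta>) x = comb I c \<tau> f (\<beta>(i := Suc (\<beta> i))) x" .
qed

lemma multi_deriv_comb:
  fixes f :: "real ^ 'd \<Rightarrow> real"
  assumes f: "integrable lborel f" and \<tau>: "\<And>m. m \<in> I \<Longrightarrow> 0 < \<tau> m"
  shows "multi_deriv \<alpha> (comb I c \<tau> f (\<lambda>_. 0)) = comb I c \<tau> f \<alpha>"
proof -
  have pow: "(partial_deriv i ^^ n) (comb I c \<tau> f \<beta>) = comb I c \<tau> f (\<beta>(i := \<beta> i + n))" for i n \<beta>
  proof (induction n)
    case (Suc n)
    then show ?case
      by (simp only: funpow.simps o_apply partial_deriv_comb[OF f \<tau>] fun_upd_same fun_upd_upd add_Suc_right)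
  qed simp
  \<comment> \<open>After the coordinates in \<open>xs\<close> have been processed, the multi-index
    is \<open>\<alpha>\<close> restricted to them. Distinctness ensures that no order is added
    twice.\<close>
  have fold: "foldr (\<lambda>i. partial_deriv i ^^ \<alpha> i) xs (comb I c \<tau> f (\<lambda>_. 0))
      = comb I c \<tau> f (\<lambda>i. if i \<in> set xs then \<alpha> i else 0)" if "distinct xs" for xs
    using that
  proof (induction xs)
    case (Cons i xs)
    have "(\<lambda>j. if j \<in> set xs then \<alpha> j else 0)(i := (if i \<in> set xs then \<alpha> i else 0) + \<alpha> i)
        = (\<lambda>j. if j \<in> set (i # xs) then \<alpha> j else 0)"
      using Cons.prems by auto
    then show ?case using Cons by (simp add: pow)
  qed simp
  let ?xs = "map (from_nat_into (UNIV :: 'd set)) [0..<CARD('d)]"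
  have bij: "bij_betw (from_nat_into (UNIV :: 'd set)) {..<CARD('d)} UNIV"
    by (rule bij_betw_from_nat_into_finite) simp
  have "distinct ?xs" using bij by (simp add: distinct_map bij_betw_def lessThan_atLeast0)
  moreover have "set ?xs = UNIV" using bij by (simp add: bij_betw_def lessThan_atLeast0)
  ultimately show ?thesis unfolding multi_deriv_def by (subst fold) auto
qed

end

subsection \<open>The approximant\<close>

text \<open>The difference of order \<open>s\<close> at 0 of the monomial of degree
  \<open>n\<close>. Absorbing one factor \<open>j\<close> into the binomial and expanding the
  shifted power reduces to all lower degrees, hence the statement for every
  \<open>n \<le> s\<close>, although the normalisation of \<open>c\<close> needs only
  \<open>n = s\<close>.\<close>

lemma alternating_binomial_power_sum:
  "n \<le> s \<Longrightarrow> (\<Sum>j\<le>s. (- 1) ^ (s - j) * real (s choose j) * real j ^ n) = (if n = s then fact s else 0)"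
proof (induction s arbitrary: n)
  case (Suc s)
  show ?case
  proof (cases n)
    case 0
    have "(\<Sum>j\<le>Suc s. (- 1) ^ (Suc s - j) * real (Suc s choose j)) = (\<Sum>j\<le>Suc s. (- 1) ^ j * real (Suc s choose j))"
      by (rule sum.reindex_bij_witness[of _ "\<lambda>j. Suc s - j" "\<lambda>j. Suc s - j"])
         (auto simp del: binomial_Suc_Suc simp: binomial_symmetric[symmetric])
    also have "\<dots> = 0" by (rule choose_alternating_sum) simp
    finally show ?thesis using 0 by simp
  next
    case (Suc k)
    have "(\<Sum>j\<le>Suc s. (- 1) ^ (Suc s - j) * real (Suc s choose j) * real j ^ n)
        = (\<Sum>i\<le>s. (- 1) ^ (s - i) * real (Suc s choose Suc i) * real (Suc i) ^ n)"
      unfolding sum.atMost_Suc_shift using Suc by simp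
    also have "\<dots> = (\<Sum>i\<le>s. real (Suc s) * ((- 1) ^ (s - i) * real (s choose i) * (real i + 1) ^ k))"
    proof (intro sum.cong refl)
      fix i
      have "Suc i * (Suc s choose Suc i) = Suc s * (s choose i)" by (rule Suc_times_binomial)
      then have "real (Suc i) * real (Suc s choose Suc i) = real (Suc s) * real (s choose i)"
        by (simp only: of_nat_mult[symmetric])
      then have "(- 1) ^ (s - i) * real (Suc i) ^ k * (real (Suc i) * real (Suc s choose Suc i))
          = (- 1) ^ (s - i) * real (Suc i) ^ k * (real (Suc s) * real (s choose i))" by (simp only:)
      then show "(- 1) ^ (s - i) * real (Suc s choose Suc i) * real (Suc i) ^ n
          = real (Suc s) * ((- 1) ^ (s - i) * real (s choose i) * (real i + 1) ^ k)"
        unfolding Suc power_Suc by (simp del: binomial_Suc_Suc add: mult_ac add_ac)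
    qed
    also have "\<dots> = real (Suc s) * (\<Sum>i\<le>s. \<Sum>m\<le>k. real (k choose m) * ((- 1) ^ (s - i) * real (s choose i) *
        real i ^ m))"
      unfolding sum_distrib_left[symmetric] binomial_ring
      by (simp add: sum_distrib_left mult_ac)
    also have "(\<Sum>i\<le>s. \<Sum>m\<le>k. real (k choose m) * ((- 1) ^ (s - i) * real (s choose i) * real i ^ m))
        = (\<Sum>m\<le>k. real (k choose m) * (\<Sum>i\<le>s. (- 1) ^ (s - i) * real (s choose i) * real i ^ m))"
      by (subst sum.swap) (simp add: sum_distrib_left)
    also have "\<dots> = (\<Sum>m\<le>k. real (k choose m) * (if m = s then fact s else 0))"
    proof (intro sum.cong refl arg_cong2[where f = "(*)"] Suc.IH)
      fix m assume "m \<in> {..k}"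
      then show "m \<le> s" using Suc.prems \<open>n = Suc k\<close> by simp
    qed
    also have "\<dots> = (if k = s then fact s else 0)"
    proof -
      have "(\<Sum>m\<le>k. real (k choose m) * (if m = s then fact s else 0)) = (\<Sum>m\<le>k. if m
          = s then real (k choose m) * fact s else 0)"
        by (intro sum.cong) auto
      then show ?thesis using Suc.prems \<open>n = Suc k\<close> by (auto simp: sum.delta')
    qed
    finally show ?thesis using Suc by (simp add: algebra_simps)
  qed
qed simp

lemma sample_stable_averaged:
  assumes p: "1 \<le> p" and \<gamma>: "0 < \<gamma>" and r: "1 \<le> r"
  shows "sample_stable p \<gamma> (\<lambda>\<sigma>. averaged (\<gamma> / \<sigma>) r :: (real ^ 'd \<Rightarrow> real) \<Rightarrow> _)"
proof (rule sample_stable_lincomb[OF p])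
  fix j assume "j \<in> {1..r}"
  then show "sample_stable p \<gamma> (\<lambda>\<sigma>. conv (\<gamma> * real j / real r / \<sigma>) (ball_kernel :: real ^ 'd \<Rightarrow> real))"
    using \<gamma> by (intro sample_stable_conv[OF ball_kernel_measurable ball_kernel_le[of _ 2] order_refl p _ \<gamma>]) auto
next
  fix \<sigma> :: real and f :: "real ^ 'd \<Rightarrow> real"
  assume "0 < \<sigma>" "f \<in> borel_measurable borel"
  then show "averaged (\<gamma> / \<sigma>) r f = (\<lambda>x. \<Sum>j = 1..r. avg_coeff r j * conv (\<gamma> * real j / real r / \<sigma>) ball_kernel f x)"
    using \<gamma> by (simp add: averaged_eq_conv mult_ac)
qed

locale band_kernels_order = band_kernels \<phi> "s + 2" for \<phi> s +
  assumes s: "1 \<le> s"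
begin

text \<open>Summing \<open>b i\<close> times the value at \<open>x + i u\<close> over positive
  \<open>i\<close> gives the value at \<open>x\<close> up to a sign times the difference of order
  \<open>s\<close> with step \<open>u\<close>.\<close>

definition b :: "nat \<Rightarrow> real" where
  "b i = (- 1) ^ (i + 1) * real (s choose i)"

text \<open>Difference coefficients times \<open>j ^ s\<close>; division by \<open>fact s\<close>,
  the difference of order \<open>s\<close> of the monomial of degree \<open>s\<close>, makes them
  sum to 1.\<close>

definition c :: "nat \<Rightarrow> real" where
  "c j = (- 1) ^ (s - j) * real (s choose j) * real j ^ s / fact s"

definition idx :: "(nat \<times> nat) set" where
  "idx = {1..s} \<times> {1..s}"

definition coef :: "nat \<times> nat \<Rightarrow> real" where
  "coef m = b (fst m) * c (snd m)"

definition dil :: "real \<Rightarrow> nat \<times> nat \<Rightarrow> real" where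
  "dil t m = real (fst m) * real (snd m) * t"

text \<open>The sum over \<open>i\<close> makes the symbol flat at the origin to order \<open>s\<close>, whence the approximation order.
  The weights \<open>j ^ s\<close> in \<open>c\<close> cancel the factors produced by differentiating the dilated kernels
  \<open>s\<close> times, so that every derivative of order \<open>s\<close> is an average of differences of order \<open>s\<close>.\<close>

definition approx :: "real \<Rightarrow> (real ^ 'd \<Rightarrow> real) \<Rightarrow> real ^ 'd \<Rightarrow> real" where
  "approx t h = comb idx coef (dil t) h (\<lambda>_. 0)"

lemma dil_pos: "0 < t \<Longrightarrow> m \<in> idx \<Longrightarrow> 0 < dil t m"
  by (auto simp: dil_def idx_def)

section \<open>Error, derivatives and spectrum of the approximant\<close>

lemma two_le_order: "2 \<le> s + 2" by simp

lemma approx_eq: "approx t h x = (\<Sum>m\<in>idx. coef m * conv (dil t m) (\<Lambda> (\<lambda>_. 0)) h x)"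
  by (simp add: approx_def comb_def)

lemma sum_atMost_split_0:
  fixes g :: "nat \<Rightarrow> real"
  shows "(\<Sum>i\<le>n. g i) = g 0 + (\<Sum>i = 1..n. g i)"
proof -
  have "{..n} = insert 0 {1..n}" by auto
  then show ?thesis by simp
qed

lemma sum_c: "(\<Sum>j = 1..s. c j) = 1"
proof -
  have "(\<Sum>j\<le>s. c j) = 1"
    unfolding c_def sum_divide_distrib[symmetric] by (simp add: alternating_binomial_power_sum)
  moreover have "c 0 = 0" using s by (simp add: c_def)
  ultimately show ?thesis by (simp add: sum_atMost_split_0)
qed

text \<open>The undilated term is split off because it is treated in two ways: for
  \<open>\<alpha> = 0\<close> it is a signed copy of \<open>h x\<close>, whereas for order
  \<open>s\<close> it drops out since the kernel has integral 0.\<close>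

lemma integral_fin_diff:
  fixes h :: "real ^ 'd \<Rightarrow> real"
  assumes h: "integrable lborel h"
  shows "(LINT v|lborel. \<Lambda> \<alpha> v * fin_diff s (t *\<^sub>R v) h x) = (- 1) ^ s * h x * (LINT v|lborel. \<Lambda> \<alpha> v)
    + (\<Sum>i = 1..s. (- 1) ^ (s - i) * real (s choose i) * conv (real i * t) (\<Lambda> \<alpha>) h x)"
proof -
  have "(LINT v|lborel. \<Lambda> \<alpha> v * fin_diff s (t *\<^sub>R v) h x)
     = (\<Sum>i\<le>s. (- 1) ^ (s - i) * real (s choose i) * conv (real i * t) (\<Lambda> \<alpha>) h x)"
    unfolding fin_diff_eq_sum scaleR_scaleR by (rule conv_lincomb[OF decaying_\<Lambda> two_le_order h])
  also have "\<dots> = (- 1) ^ s * conv 0 (\<Lambda> \<alpha>) h x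
     + (\<Sum>i = 1..s. (- 1) ^ (s - i) * real (s choose i) * conv (real i * t) (\<Lambda> \<alpha>) h x)"
    by (simp add: sum_atMost_split_0)
  also have "conv 0 (\<Lambda> \<alpha>) h x = h x * (LINT v|lborel. \<Lambda> \<alpha> v)"
    by (simp add: conv_def mult.commute)
  finally show ?thesis by simp
qed

text \<open>For fixed \<open>j\<close> the sum over \<open>i\<close> gives \<open>h x\<close> plus a
  kernel average of a difference; the copies of \<open>h x\<close> add up to one because the weights
  \<open>c j\<close> do.\<close>

lemma approx_minus_eq:
  fixes h :: "real ^ 'd \<Rightarrow> real"
  assumes h: "integrable lborel h"
  shows "approx t h x - h x
    = (\<Sum>j = 1..s. (- ((- 1) ^ s) * c j) * (LINT v|lborel. \<Lambda> (\<lambda>_. 0) v * fin_diff s ((real j * t) *\<^sub>R v) h x))"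
proof -
  have inner: "- ((- 1) ^ s) * (LINT v|lborel. \<Lambda> (\<lambda>_. 0) v * fin_diff s (u *\<^sub>R v) h x)
     = (\<Sum>i = 1..s. b i * conv (real i * u) (\<Lambda> (\<lambda>_. 0)) h x) - h x" for u
  proof -
    have "- ((- 1) ^ s) * ((- 1) ^ (s - i) * real (s choose i) * y) = b i * y" if "i \<in> {1..s}" for i y
    proof -
      have "(- 1 :: real) ^ s * (- 1) ^ (s - i) = (- 1) ^ i"
        using that by (simp add: power_add[symmetric] minus_one_power_iff)
      then show ?thesis by (simp add: b_def mult.assoc[symmetric])
    qed
    then have "- ((- 1) ^ s) * (\<Sum>i = 1..s. (- 1) ^ (s - i) * real (s choose i) * conv (real i * u) (\<Lambda> (\<lambda>_. 0)) h x)
       = (\<Sum>i = 1..s. b i * conv (real i * u) (\<Lambda> (\<lambda>_. 0)) h x)"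
      unfolding sum_distrib_left by (intro sum.cong refl) auto
    then show ?thesis
      unfolding integral_fin_diff[OF h] integral_\<Lambda>_0 by (simp add: algebra_simps power_mult_distrib[symmetric])
  qed
  have "approx t h x = (\<Sum>j = 1..s. c j * (\<Sum>i = 1..s. b i * conv (real i * (real j * t)) (\<Lambda> (\<lambda>_. 0)) h x))"
    unfolding approx_eq idx_def coef_def dil_def sum.cartesian_product' fst_conv snd_conv
    by (subst sum.swap) (simp add: sum_distrib_left mult_ac)
  also have "\<dots> = (\<Sum>j = 1..s. c j * (- ((- 1) ^ s) * (LINT v|lborel. \<Lambda> (\<lambda>_. 0) v * fin_diff s ((real j * t)
      *\<^sub>R v) h x) + h x))"
    unfolding inner by simp
  also have "\<dots> = (\<Sum>j = 1..s. (- ((- 1) ^ s) * c j) * (LINT v|lborel. \<Lambda> (\<lambda>_. 0) v * fin_diff s ((real j * t)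
      *\<^sub>R v) h x)) + (\<Sum>j = 1..s. c j) * h x"
    by (simp only: distrib_left sum.distrib sum_distrib_right) (simp add: mult_ac)
  finally show ?thesis unfolding sum_c by simp
qed

text \<open>Here \<open>i\<close> is fixed instead. The chain rule contributes j^(-s), cancelling
  \<open>j ^ s\<close> in \<open>c j\<close>, and what remains in \<open>j\<close> are the
  coefficients of a difference of order \<open>s\<close>. Its missing term at \<open>j = 0\<close>
  is 0 by the vanishing integral.\<close>

lemma multi_deriv_approx:
  fixes h :: "real ^ 'd \<Rightarrow> real"
  assumes h: "integrable lborel h" and t: "0 < t" and \<alpha>: "(\<Sum>i\<in>UNIV. \<alpha> i) = s"
  shows "multi_deriv \<alpha> (approx t h) x
    = (\<Sum>i = 1..s. (b i * (- (1 / (real i * t))) ^ s / fact s) * (LINT v|lborel. \<Lambda> \<alpha> v * fin_diff s ((real i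
        * t) *\<^sub>R v) h x))"
proof -
  have inner: "(LINT v|lborel. \<Lambda> \<alpha> v * fin_diff s (u *\<^sub>R v) h x)
     = (\<Sum>j = 1..s. (- 1) ^ (s - j) * real (s choose j) * conv (real j * u) (\<Lambda> \<alpha>) h x)" for u
    using \<alpha> s unfolding integral_fin_diff[OF h] by (simp add: integral_\<Lambda>_pos)
  have "multi_deriv \<alpha> (approx t h) x = comb idx coef (dil t) h \<alpha> x"
    unfolding approx_def by (subst multi_deriv_comb[OF h dil_pos[OF t]]) auto
  also have "\<dots> = (\<Sum>i = 1..s. \<Sum>j = 1..s. (b i * c j) * (- (1 / (real i * real j * t))) ^ s * conv (real i *
      real j * t) (\<Lambda> \<alpha>) h x)"
    unfolding comb_def idx_def coef_def dil_def \<alpha> sum.cartesian_product' by simp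
  also have "\<dots> = (\<Sum>i = 1..s. (b i * (- (1 / (real i * t))) ^ s / fact s) * (\<Sum>j
      = 1..s. (- 1) ^ (s - j) * real (s choose j) * conv (real j * (real i * t)) (\<Lambda> \<alpha>) h x))"
    unfolding sum_distrib_left
  proof (intro sum.cong refl)
    fix i j assume "i \<in> {1..s}" "j \<in> {1..s}"
    then have "c j * (- (1 / (real i * real j * t))) ^ s
        = (- (1 / (real i * t))) ^ s / fact s * ((- 1) ^ (s - j) * real (s choose j))"
      by (simp add: c_def power_minus[of "1 / _"] power_divide power_mult_distrib mult_ac)
    then have "b i * (c j * (- (1 / (real i * real j * t))) ^ s) * conv (real i * real j * t) (\<Lambda> \<alpha>) h x
       = b i * ((- (1 / (real i * t))) ^ s / fact s * ((- 1) ^ (s - j) * real (s choose j))) * conv (real i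
           * real j * t) (\<Lambda> \<alpha>) h x"
      by (simp only:)
    moreover have "real i * real j * t = real j * (real i * t)" by simp
    ultimately show "(b i * c j) * (- (1 / (real i * real j * t))) ^ s * conv (real i * real j * t) (\<Lambda> \<alpha>) h x
      = (b i * (- (1 / (real i * t))) ^ s / fact s) * ((- 1) ^ (s - j) * real (s choose j) * conv (real j *
          (real i * t)) (\<Lambda> \<alpha>) h x)"
      by (simp only: mult.assoc times_divide_eq_left times_divide_eq_right)
  qed
  finally show ?thesis unfolding inner .
qed

text \<open>The common estimate behind error and derivatives: differences with steps proportional to
  \<open>v\<close> grow like (1 + |v|)^s, which the kernel can afford.\<close>

lemma modulus_stable_integral_fin_diff:
  assumes p: "1 \<le> p" and K: "1 \<le> K"
  shows "modulus_stable p s (\<lambda>\<delta> h x. LINT v|lborel. \<Lambda> \<alpha> v * fin_diff s ((K * \<delta>) *\<^sub>R v) h (x :: real ^ 'd))"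
proof -
  obtain C where C: "\<And>v. \<bar>\<Lambda> \<alpha> v\<bar> \<le> C * decay (s + 2) (v :: real ^ 'd)"
    using decaying_\<Lambda>[of \<alpha>] by (auto simp: decaying_def)
  have "0 \<le> C * decay (s + 2) (0 :: real ^ 'd)" using C[of 0] by linarith
  then have C0: "0 \<le> C" using decay_pos[of "s + 2" "0 :: real ^ 'd"] by (simp add: zero_le_mult_iff)
  let ?B = "C * (LINT v|lborel. decay 2 (v :: real ^ 'd)) * K ^ s"
  show ?thesis
    unfolding modulus_stable_def
  proof (intro exI[of _ ?B] conjI allI impI)
    show "0 \<le> ?B" using C0 K by (simp add: decay_nonneg)
    fix h :: "real ^ 'd \<Rightarrow> real" and \<delta> m
    assume h: "integrable lborel h" and \<delta>: "0 < \<delta>" and mod: "modulus_le p s h \<delta> m"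
    have [measurable]: "h \<in> borel_measurable borel" using h by auto
    show "pnorm_le lborel p (\<lambda>x. LINT v|lborel. \<Lambda> \<alpha> v * fin_diff s ((K * \<delta>) *\<^sub>R v) h x) (?B * m)"
      unfolding mult.assoc[of _ "K ^ s" m]
    proof (rule pnorm_le_integral[OF decaying_measurable[OF decaying_\<Lambda>] _ C _ _ p])
      show "(\<lambda>(x, v). fin_diff s ((K * \<delta>) *\<^sub>R v) h x) \<in> borel_measurable (borel \<Otimes>\<^sub>M borel)"
        unfolding fin_diff_def by measurable
      show "pnorm_le lborel p (\<lambda>x. fin_diff s ((K * \<delta>) *\<^sub>R v) h x) (K ^ s * m * (1 + norm v) ^ s)" for v
        by (rule pnorm_le_fin_diff_growth[OF mod p \<delta> K])
      show "0 \<le> K ^ s * m" using modulus_le_nonneg[OF mod \<delta>] K by simp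
    qed
  qed
qed

lemma modulus_stable_approx:
  assumes p: "1 \<le> p" and \<kappa>: "1 \<le> \<kappa>"
  shows "modulus_stable p s (\<lambda>\<delta> h x. approx (\<kappa> * \<delta>) h x - h (x :: real ^ 'd))"
proof (rule modulus_stable_lincomb[OF p, where a = "\<lambda>j. - ((- 1) ^ s) * c j"])
  fix j assume "j \<in> {1..s}"
  then have "1 \<le> real j * \<kappa>" using \<kappa> by (intro mult_ge1_I) auto
  then show "modulus_stable p s (\<lambda>\<delta> h x. LINT v|lborel. \<Lambda> (\<lambda>_. 0) v * fin_diff s ((real j * \<kappa> * \<delta>) *\<^sub>R v) h
      (x :: real ^ 'd))"
    by (rule modulus_stable_integral_fin_diff[OF p])
qed (simp add: approx_minus_eq mult.assoc)

text \<open>The factor \<open>\<delta> ^ s\<close> cancels the chain rule factor, leaving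
  coefficients that do not depend on \<open>\<delta>\<close>. In this way derivatives are bounded by
  the modulus directly, without Bernstein's inequality.\<close>

lemma modulus_stable_multi_deriv_approx:
  assumes p: "1 \<le> p" and \<kappa>: "1 \<le> \<kappa>" and \<alpha>: "(\<Sum>i\<in>UNIV. \<alpha> i) = s"
  shows "modulus_stable p s (\<lambda>\<delta> h x. \<delta> ^ s * multi_deriv \<alpha> (approx (\<kappa> * \<delta>) h) (x :: real ^ 'd))"
proof (rule modulus_stable_lincomb[OF p])
  fix i assume "i \<in> {1..s}"
  then have "1 \<le> real i * \<kappa>" using \<kappa> by (intro mult_ge1_I) auto
  then show "modulus_stable p s (\<lambda>\<delta> h x. LINT v|lborel. \<Lambda> \<alpha> v * fin_diff s ((real i * \<kappa> * \<delta>) *\<^sub>R v) h (x ::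
      real ^ 'd))"
    by (rule modulus_stable_integral_fin_diff[OF p])
next
  fix \<delta> :: real and h :: "real ^ 'd \<Rightarrow> real"
  assume \<delta>: "0 < \<delta>" and h: "integrable lborel h"
  have "\<delta> ^ s * (- (1 / (real i * (\<kappa> * \<delta>)))) ^ s = (- (1 / (real i * \<kappa>))) ^ s" for i
    using \<delta> by (simp add: power_mult_distrib[symmetric])
  then have "\<delta> ^ s * (b i * (- (1 / (real i * (\<kappa> * \<delta>)))) ^ s / fact s)
      = b i * (- (1 / (real i * \<kappa>))) ^ s / fact s" for i
    by (simp only: times_divide_eq_right mult.left_commute[of "\<delta> ^ s"])
  then have "\<delta> ^ s * ((b i * (- (1 / (real i * (\<kappa> * \<delta>)))) ^ s / fact s) * I)
      = b i * (- (1 / (real i * \<kappa>))) ^ s / fact s * I" for i I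
    by (simp only: mult.assoc[symmetric, of "\<delta> ^ s"])
  moreover have "0 < \<kappa> * \<delta>" using \<kappa> \<delta> by simp
  ultimately show "(\<lambda>x. \<delta> ^ s * multi_deriv \<alpha> (approx (\<kappa> * \<delta>) h) x) = (\<lambda>x. \<Sum>i = 1..s.
      (b i * (- (1 / (real i * \<kappa>))) ^ s / fact s) * (LINT v|lborel. \<Lambda> \<alpha> v * fin_diff s ((real i * \<kappa> * \<delta>) *\<^sub>R v) h x))"
    by (simp only: multi_deriv_approx[OF h _ \<alpha>] sum_distrib_left mult.assoc[of _ \<kappa> \<delta>])
qed

lemma approx_integrable:
  fixes h :: "real ^ 'd \<Rightarrow> real"
  assumes "integrable lborel h"
  shows "integrable lborel (approx t h)"
  unfolding approx_eq[abs_def]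
  by (intro Bochner_Integration.integrable_sum integrable_mult_right conv_integrable_lborel[OF decaying_\<Lambda>
      two_le_order assms])

lemma approx_continuous:
  fixes h :: "real ^ 'd \<Rightarrow> real"
  assumes h: "integrable lborel h" and t: "0 < t"
  shows "continuous_on UNIV (approx t h)"
proof -
  obtain C where C: "\<And>v :: real ^ 'd. \<bar>\<Lambda> (\<lambda>_. 0) v\<bar> \<le> C"
    using decaying_bounded[OF decaying_\<Lambda>[of "\<lambda>_. 0"]] by blast
  show ?thesis
    unfolding approx_eq[abs_def]
    by (intro continuous_on_sum continuous_on_mult continuous_on_const continuous_conv[OF continuous_\<Lambda> C h] dil_pos t)
qed

text \<open>Every dilation in the combination is at least \<open>t\<close>, and a wider kernel has a
  narrower band, so all terms fit into the band for \<open>t\<close>. The factor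
  \<open>2 * pi\<close> from \<open>fourier\<close> is only slack and is estimated by 1.\<close>

lemma fourier_approx_eq_0:
  fixes h :: "real ^ 'd \<Rightarrow> real"
  assumes h: "integrable lborel h" and t: "0 < t" and x: "1 / t < \<bar>x $ k\<bar>"
  shows "fourier (approx t h) x = 0"
proof -
  let ?L = "\<Lambda> (\<lambda>_. 0) :: real ^ 'd \<Rightarrow> real"
  let ?e = "\<lambda>y. exp (- 2 * of_real pi * \<i> * of_real (x \<bullet> y))"
  have ci: "integrable lborel (conv (dil t m) ?L h)" for m
    by (rule conv_integrable_lborel[OF decaying_\<Lambda> two_le_order h])
  have cm [measurable]: "conv (dil t m) ?L h \<in> borel_measurable borel" for m
    using ci[of m] by auto
  have zero: "fourier (conv (dil t m) ?L h) x = 0" if m: "m \<in> idx" for m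
  proof -
    have "1 \<le> real (fst m) * real (snd m)" using m by (intro mult_ge1_I) (auto simp: idx_def)
    then have "1 * t \<le> dil t m" unfolding dil_def using t by (intro mult_right_mono) auto
    then have dt: "t \<le> dil t m" by simp
    have "1 < t * \<bar>x $ k\<bar>" using x t by (simp add: divide_less_eq mult.commute)
    also have "\<dots> \<le> dil t m * \<bar>x $ k\<bar>" by (intro mult_right_mono dt) simp
    also have "\<dots> = 1 * (dil t m * \<bar>x $ k\<bar>)" by simp
    also have "\<dots> \<le> 2 * pi * (dil t m * \<bar>x $ k\<bar>)"
      using pi_ge_two dt t by (intro mult_right_mono mult_nonneg_nonneg) linarith+
    finally have "1 < \<bar>((2 * pi * dil t m) *\<^sub>R x) $ k\<bar>" using dt t by (simp add: abs_mult)
    from fourier_\<Lambda>[OF this, of "\<lambda>_. 0"] show ?thesis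
      unfolding fourier_conv[OF decaying_\<Lambda> two_le_order h] by simp
  qed
  have ei: "integrable lborel (\<lambda>y. complex_of_real (conv (dil t m) ?L h y) * ?e y)" for m
  proof (rule Bochner_Integration.integrable_bound[OF integrable_norm[OF ci[of m]]])
    have "norm (?e y) = 1" for y
    proof -
      have "?e y = exp (\<i> * of_real (- 2 * pi * (x \<bullet> y)))" by (simp add: mult_ac)
      then show ?thesis by (simp only: norm_exp_i_times)
    qed
    then show "AE y in lborel. norm (complex_of_real (conv (dil t m) ?L h y) * ?e y)
        \<le> norm (norm (conv (dil t m) ?L h y))"
      by (intro AE_I2) (simp only: norm_mult, simp)
  qed measurable
  have "fourier (approx t h) x = (LINT y|lborel. complex_of_real (approx t h y) * ?e y)"
    by (rule fourier_lborel) (use approx_integrable[OF h] in auto)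
  also have "\<dots> = (LINT y|lborel. (\<Sum>m\<in>idx. complex_of_real (coef m) * (complex_of_real (conv (dil t m) ?L h
      y) * ?e y)))"
    unfolding approx_eq of_real_sum of_real_mult sum_distrib_right mult.assoc ..
  also have "\<dots> = (\<Sum>m\<in>idx. complex_of_real (coef m) * (LINT y|lborel. complex_of_real (conv (dil t m) ?L h y) * ?e y))"
    using ei by (simp only: Bochner_Integration.integral_sum integrable_mult_right integral_mult_right_zero)
  also have "\<dots> = 0"
    using zero by (intro sum.neutral ballI) (simp only: fourier_lborel[OF cm] mult_zero_right)
  finally show ?thesis .
qed

text \<open>The two hypotheses on \<open>h\<close> give the two integrability requirements on
  band-limited functions, for exponents 1 and \<open>p\<close>; continuity everywhere is inherited
  from the kernel.\<close>

lemma approx_bandlimited: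
  fixes h :: "real ^ 'd \<Rightarrow> real"
  assumes p: "1 \<le> p" and h: "integrable lborel h" and hp: "pnorm_le lborel p h C" and \<rho>: "0 < \<rho>"
  shows "approx (1 / \<rho>) h \<in> bandlimited p \<rho>"
proof -
  let ?g = "approx (1 / \<rho>) h"
  have gm: "?g \<in> borel_measurable borel" using approx_integrable[OF h] by auto
  obtain B where B: "\<And>t f c. pnorm_le lborel p f c \<Longrightarrow> pnorm_le lborel p (conv t (\<Lambda> (\<lambda>_. 0) :: real ^ 'd \<Rightarrow>
      real) f) (B * c)"
    using conv_pnorm_bound[OF decaying_\<Lambda> two_le_order p] by blast
  have "pnorm_le lborel p ?g ((\<Sum>m\<in>idx. \<bar>coef m\<bar>) * (B * C))"
    unfolding approx_eq[abs_def] by (intro pnorm_le_lincomb p B hp)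
  then have "?g \<in> Lp p"
    using pnorm_le_lebesgue_lborel[OF gm, of p] pnorm_le_lebesgue_iff[OF p, of ?g] by blast
  moreover have "?g \<in> Lp 1"
    using approx_integrable[OF h, of "1 / \<rho>"] pnorm_le_lebesgue_lborel[OF gm, of 1] pnorm_le_lebesgue_iff[of 1 ?g]
    unfolding integrable_iff_pnorm_le_1 by auto
  moreover have "continuous_on UNIV ?g" using \<rho> by (intro approx_continuous h) simp
  moreover have "closure {x. fourier ?g x \<noteq> 0} \<subseteq> cbox (vec (- \<rho>)) (vec \<rho>)"
  proof (rule closure_minimal[OF _ closed_cbox], rule subsetI)
    fix x assume x: "x \<in> {x. fourier ?g x \<noteq> 0}"
    have "\<bar>x $ k\<bar> \<le> \<rho>" for k
    proof (rule ccontr)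
      assume "\<not> \<bar>x $ k\<bar> \<le> \<rho>"
      then have "fourier ?g x = 0" using \<rho> by (intro fourier_approx_eq_0[OF h, where k = k]) auto
      then show False using x by simp
    qed
    then show "x \<in> cbox (vec (- \<rho>)) (vec \<rho>)" by (auto simp: mem_box_cart abs_le_iff minus_le_iff)
  qed
  ultimately show ?thesis by (simp add: bandlimited_def)
qed

lemma sample_stable_approx:
  assumes p: "1 \<le> p" and \<kappa>: "0 < \<kappa>" and \<gamma>: "0 < \<gamma>"
  shows "sample_stable p \<gamma> (\<lambda>\<sigma>. approx (\<kappa> / \<sigma>) :: (real ^ 'd \<Rightarrow> real) \<Rightarrow> _)"
proof (rule sample_stable_lincomb[OF p])
  let ?L = "\<Lambda> (\<lambda>_. 0) :: real ^ 'd \<Rightarrow> real"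
  obtain C where C: "\<And>v. \<bar>?L v\<bar> \<le> C * decay (s + 2) v"
    using decaying_\<Lambda>[of "\<lambda>_. 0"] by (auto simp: decaying_def)
  show "sample_stable p \<gamma> (\<lambda>\<sigma>. conv (dil \<kappa> m / \<sigma>) ?L)" if "m \<in> idx" for m
    by (rule sample_stable_conv[OF decaying_measurable[OF decaying_\<Lambda>] C two_le_order p dil_pos[OF \<kappa> that] \<gamma>])
  show "approx (\<kappa> / \<sigma>) f = (\<lambda>x. \<Sum>m\<in>idx. coef m * conv (dil \<kappa> m / \<sigma>) ?L f x)" for \<sigma> f
    by (simp add: approx_eq[abs_def] dil_def)
qed

lemma averaged_integrable:
  fixes h :: "real ^ 'd \<Rightarrow> real"
  assumes h: "integrable lborel h" and \<delta>: "0 < \<delta>"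
  shows "integrable lborel (averaged \<delta> r h)"
proof -
  have hm: "h \<in> borel_measurable borel" using h by auto
  show ?thesis
    unfolding averaged_eq_conv[OF hm \<delta>]
    by (intro Bochner_Integration.integrable_sum integrable_mult_right conv_integrable_lborel[OF
        ball_kernel_decaying[of 2] _ h]) auto
qed

lemma averaged_approx:
  fixes h :: "real ^ 'd \<Rightarrow> real"
  assumes h: "integrable lborel h" and t: "0 < t" and \<delta>: "0 < \<delta>"
  shows "averaged \<delta> r (approx t h) x = approx t (averaged \<delta> r h) x"
proof -
  let ?L = "\<Lambda> (\<lambda>_. 0) :: real ^ 'd \<Rightarrow> real"
  let ?t = "\<lambda>j. \<delta> * real j / real r"
  have hm: "h \<in> borel_measurable borel" using h by auto
  have am: "approx t h \<in> borel_measurable borel" using approx_integrable[OF h] by auto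
  note bd = ball_kernel_decaying[of 2, where 'd = 'd]
  have iL: "integrable lborel (conv \<tau> ?L h)" for \<tau>
    by (rule conv_integrable_lborel[OF decaying_\<Lambda> two_le_order h])
  have iB: "integrable lborel (conv \<tau> ball_kernel h)" for \<tau>
    by (rule conv_integrable_lborel[OF bd _ h]) simp
  have "averaged \<delta> r (approx t h) x = (\<Sum>j = 1..r. avg_coeff r j * (\<Sum>m\<in>idx. coef m * conv (?t j) ball_kernel
      (conv (dil t m) ?L h) x))"
    unfolding averaged_eq_conv[OF am \<delta>] unfolding approx_eq[abs_def]
    by (subst conv_sum[OF bd]) (auto intro: iL)
  also have "\<dots> = (\<Sum>j = 1..r. avg_coeff r j * (\<Sum>m\<in>idx. coef m * conv (dil t m) ?L (conv (?t j) ball_kernel h) x))"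
  proof (intro sum.cong refl arg_cong2[where f = "(*)"])
    fix j m assume "m \<in> idx"
    from dil_pos[OF t this]
    show "conv (?t j) ball_kernel (conv (dil t m) ?L h) x = conv (dil t m) ?L (conv (?t j) ball_kernel h) x"
      by (intro conv_commute[OF bd _ decaying_\<Lambda> two_le_order h]) auto
  qed
  also have "\<dots> = (\<Sum>m\<in>idx. coef m * (\<Sum>j = 1..r. avg_coeff r j * conv (dil t m) ?L (conv (?t j) ball_kernel h) x))"
    unfolding sum_distrib_left by (subst sum.swap) (simp add: mult_ac)
  also have "\<dots> = approx t (averaged \<delta> r h) x"
    unfolding approx_eq averaged_eq_conv[OF hm \<delta>]
    by (subst conv_sum[OF decaying_\<Lambda> two_le_order]) (auto intro: iB)
  finally show ?thesis .
qed

lemma approx_diff: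
  fixes h :: "real ^ 'd \<Rightarrow> real"
  assumes "integrable lborel h" "integrable lborel k"
  shows "approx t (\<lambda>x. h x - k x) x = approx t h x - approx t k x"
  unfolding approx_eq conv_diff[OF decaying_\<Lambda> two_le_order assms]
  by (simp add: right_diff_distrib sum_subtractf)

end

text \<open>Jackson's theorem for all norms involved. The approximant is a combination of convolutions, so it
  commutes with the averaged operator; this is what controls its samples.\<close>

lemma band_limited_approximation:
  fixes p \<gamma> lam :: real and r s :: nat
  assumes p: "1 \<le> p" and rs: "1 \<le> r" "1 \<le> s" "s \<le> 2 * r" and \<gamma>: "0 < \<gamma>" "\<gamma> \<le> 1" and lam: "0 < lam" "lam \<le> 1"
  shows "\<exists>B\<ge>0. \<forall>\<sigma> X (h :: real ^ 'd \<Rightarrow> real) m C. 0 < \<sigma> \<longrightarrow> separated (2 * \<gamma> / \<sigma>) X \<longrightarrow> integrable lborel h \<longrightarrow>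
     pnorm_le lborel p h C \<longrightarrow> modulus_le p s h (1 / \<sigma>) m \<longrightarrow>
     (\<exists>g\<in>bandlimited p (lam * \<sigma>). pnorm_le lborel p (\<lambda>x. g x - h x) (B * m) \<and>
        sobolev_seminorm p s g \<le> \<sigma> ^ s * (B * m) \<and>
        pnorm_le (sample_measure \<sigma> X) p (\<lambda>x. g x - averaged (\<gamma> / \<sigma>) r h x) (B * m))"
proof -
  have "2 \<le> s + 2" by simp
  then obtain \<phi> :: "nat \<Rightarrow> real \<Rightarrow> real" where \<phi>:
    "\<And>n x. (\<phi> n has_real_derivative \<phi> (Suc n) x) (at x)"
    "\<And>n. \<exists>C. \<forall>x. \<bar>\<phi> n x\<bar> \<le> C * (1 / (1 + \<bar>x\<bar>) ^ (s + 2))"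
    "\<And>n \<xi>. 1 < \<bar>\<xi>\<bar> \<Longrightarrow> (LINT x|lborel. complex_of_real (\<phi> n x) * exp (\<i> * of_real (\<xi> * x))) = 0"
    "(LINT x|lborel. \<phi> 0 x) = 1"
    "\<And>n. 1 \<le> n \<Longrightarrow> (LINT x|lborel. \<phi> n x) = 0"
    by (rule band_limited_kernel_exists) blast
  interpret band_kernels_order \<phi> s
    by unfold_locales (use \<phi> rs in auto)
  \<comment> \<open>With this factor the kernel width \<open>\<kappa> / \<sigma>\<close> is the
    reciprocal of the allowed bandwidth \<open>lam * \<sigma>\<close>.\<close>
  define \<kappa> where "\<kappa> = 1 / lam"
  have \<kappa>: "1 \<le> \<kappa>" "0 < \<kappa>" using lam by (auto simp: \<kappa>_def)
  obtain B1 where B1: "0 \<le> B1" "\<And>(h :: real ^ 'd \<Rightarrow> real) \<delta> m. integrable lborel h \<Longrightarrow> 0 < \<delta> \<Longrightarrow> modulus_le p s h \<delta> m \<Longrightarrow>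
      pnorm_le lborel p (\<lambda>x. approx (\<kappa> * \<delta>) h x - h x) (B1 * m)"
    using modulus_stable_approx[OF p \<kappa>(1)] unfolding modulus_stable_def by blast
  let ?A = "{\<alpha> :: 'd \<Rightarrow> nat. (\<Sum>i\<in>UNIV. \<alpha> i) = s}"
  have "\<forall>\<alpha>\<in>?A. modulus_stable p s (\<lambda>\<delta> h x. \<delta> ^ s * multi_deriv \<alpha> (approx (\<kappa> * \<delta>) h) x)"
    using modulus_stable_multi_deriv_approx[OF p \<kappa>(1)] by blast
  then obtain B2 where B2: "\<And>\<alpha>. \<alpha> \<in> ?A \<Longrightarrow> 0 \<le> B2 \<alpha>"
    "\<And>\<alpha> (h :: real ^ 'd \<Rightarrow> real) \<delta> m. \<alpha> \<in> ?A \<Longrightarrow> integrable lborel h \<Longrightarrow> 0 < \<delta> \<Longrightarrow> modulus_le p s h \<delta> m \<Longrightarrow>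
      pnorm_le lborel p (\<lambda>x. \<delta> ^ s * multi_deriv \<alpha> (approx (\<kappa> * \<delta>) h) x) (B2 \<alpha> * m)"
    unfolding modulus_stable_def by metis
  obtain B3 where B3: "0 \<le> B3" "\<And>\<sigma> X (f :: real ^ 'd \<Rightarrow> real) c. 0 < \<sigma> \<Longrightarrow> separated (2 * \<gamma> / \<sigma>) X
      \<Longrightarrow> pnorm_le lborel p f c \<Longrightarrow>
      pnorm_le (sample_measure \<sigma> X) p (averaged (\<gamma> / \<sigma>) r f) (B3 * c)"
    using sample_stable_averaged[OF p \<gamma>(1) rs(1)] unfolding sample_stable_def by blast
  obtain B4 where B4: "0 \<le> B4" "\<And>\<sigma> X (f :: real ^ 'd \<Rightarrow> real) c. 0 < \<sigma> \<Longrightarrow> separated (2 * \<gamma> / \<sigma>) X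
      \<Longrightarrow> pnorm_le lborel p f c \<Longrightarrow>
      pnorm_le (sample_measure \<sigma> X) p (approx (\<kappa> / \<sigma>) f) (B4 * c)"
    using sample_stable_approx[OF p \<kappa>(2) \<gamma>(1)] unfolding sample_stable_def by blast
  obtain B5 where B5: "0 \<le> B5" "\<And>(h :: real ^ 'd \<Rightarrow> real) \<delta> m. integrable lborel h \<Longrightarrow> 0 < \<delta> \<Longrightarrow> modulus_le p s h \<delta> m \<Longrightarrow>
      pnorm_le lborel p (\<lambda>x. averaged (\<gamma> * \<delta>) r h x - h x) (B5 * m)"
    using modulus_stable_averaged[OF p rs(1,3) \<gamma>] unfolding modulus_stable_def by blast
  define S where "S = (\<Sum>\<alpha>\<in>?A. B2 \<alpha>)"
  have S: "0 \<le> S" unfolding S_def using B2(1) by (intro sum_nonneg)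
  \<comment> \<open>The summands bound the error, the derivatives, and the two parts into which the
    sampled difference is split.\<close>
  define B where "B = B1 + S + (B4 * B5 + B3 * B1)"
  have B: "0 \<le> B" "B1 \<le> B" "S \<le> B" "B4 * B5 + B3 * B1 \<le> B"
    using B1 S B3 B4 B5 by (auto simp: B_def)
  show ?thesis
  proof (intro exI[of _ B] conjI allI impI B)
    fix \<sigma> and X :: "(real ^ 'd) set" and h :: "real ^ 'd \<Rightarrow> real" and m C
    assume \<sigma>: "0 < \<sigma>" and X: "separated (2 * \<gamma> / \<sigma>) X" and h: "integrable lborel h"
      and hp: "pnorm_le lborel p h C" and mod: "modulus_le p s h (1 / \<sigma>) m"
    have \<delta>: "0 < 1 / \<sigma>" using \<sigma> by simp
    have m: "0 \<le> m" by (rule modulus_le_nonneg[OF mod \<delta>])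
    define g where "g = approx (\<kappa> * (1 / \<sigma>)) h"
    have t: "\<kappa> * (1 / \<sigma>) = 1 / (lam * \<sigma>)" "\<kappa> * (1 / \<sigma>) = \<kappa> / \<sigma>" by (auto simp: \<kappa>_def)
    have gint: "integrable lborel g" unfolding g_def by (rule approx_integrable[OF h])
    have gh: "pnorm_le lborel p (\<lambda>x. g x - h x) (B1 * m)"
      unfolding g_def by (rule B1(2)[OF h \<delta> mod])
    show "\<exists>g\<in>bandlimited p (lam * \<sigma>). pnorm_le lborel p (\<lambda>x. g x - h x) (B * m) \<and>
        sobolev_seminorm p s g \<le> \<sigma> ^ s * (B * m) \<and>
        pnorm_le (sample_measure \<sigma> X) p (\<lambda>x. g x - averaged (\<gamma> / \<sigma>) r h x) (B * m)"
    proof (intro bexI[of _ g] conjI)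
      show "g \<in> bandlimited p (lam * \<sigma>)"
        unfolding g_def t(1) using \<sigma> lam by (intro approx_bandlimited[OF p h hp]) simp
      show "pnorm_le lborel p (\<lambda>x. g x - h x) (B * m)"
        using pnorm_le_mono[OF gh mult_right_mono[OF B(2) m] p] .
      have "Lp_norm p (multi_deriv \<alpha> g) \<le> B2 \<alpha> * (\<sigma> ^ s * m)" if "\<alpha> \<in> ?A" for \<alpha>
      proof -
        have "\<sigma> ^ s * ((1 / \<sigma>) ^ s * y) = y" for y using \<sigma> by (simp add: power_divide)
        then have "pnorm_le lborel p (multi_deriv \<alpha> g) (B2 \<alpha> * (\<sigma> ^ s * m))"
          using pnorm_le_cmult[OF B2(2)[OF that h \<delta> mod], of "\<sigma> ^ s"] \<sigma> by (simp only: g_def) (simp add: mult_ac)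
        then show ?thesis
          using pnorm_le_lebesgue_lborel pnorm_le_lebesgue_iff[OF p] pnorm_le_measurable by fastforce
      qed
      then have "sobolev_seminorm p s g \<le> (\<Sum>\<alpha>\<in>?A. B2 \<alpha> * (\<sigma> ^ s * m))"
        unfolding sobolev_seminorm_def by (rule sum_mono)
      also have "\<dots> = S * (\<sigma> ^ s * m)" by (simp add: S_def sum_distrib_right)
      also have "\<dots> \<le> B * (\<sigma> ^ s * m)" using B(3) m \<sigma> by (intro mult_right_mono) auto
      finally show "sobolev_seminorm p s g \<le> \<sigma> ^ s * (B * m)" by (simp add: mult_ac)
      have \<gamma>\<sigma>: "0 < \<gamma> / \<sigma>" "\<gamma> / \<sigma> \<le> 1 / \<sigma>" using \<gamma> \<sigma> by (auto simp: divide_right_mono)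
      note hA = averaged_integrable[OF h \<gamma>\<sigma>(1), of r]
      have "pnorm_le lborel p (\<lambda>x. averaged (\<gamma> / \<sigma>) r h x - h x) (B5 * m)"
        using B5(2)[OF h \<delta> mod] by simp
      from pnorm_le_uminus[OF this] have "pnorm_le lborel p (\<lambda>x. h x - averaged (\<gamma> / \<sigma>) r h x) (B5 * m)" by simp
      from B4(2)[OF \<sigma> X this]
      have 1: "pnorm_le (sample_measure \<sigma> X) p (\<lambda>x. g x - approx (\<kappa> / \<sigma>) (averaged (\<gamma> / \<sigma>) r h) x) (B4 * (B5 * m))"
        unfolding g_def t(2) approx_diff[OF h hA, abs_def] .
      \<comment> \<open>Commutation identifies the remaining part with the average of
        \<open>g - h\<close>, whose p-norm is already known.\<close>
      have ag: "averaged (\<gamma> / \<sigma>) r g x = approx (\<kappa> / \<sigma>) (averaged (\<gamma> / \<sigma>) r h) x" for x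
        unfolding g_def t(2) using \<kappa> \<sigma> by (intro averaged_approx h \<gamma>\<sigma>) simp
      have avg_diff: "averaged (\<gamma> / \<sigma>) r (\<lambda>x. g x - h x) x = averaged (\<gamma> / \<sigma>) r g x - averaged (\<gamma> / \<sigma>) r h x" for x
        by (intro averaged_diff \<gamma>\<sigma> conv_integrable[OF ball_kernel_decaying[of 2] order_refl] gint h)
           (use gint h in auto)
      have 2: "pnorm_le (sample_measure \<sigma> X) p
          (\<lambda>x. approx (\<kappa> / \<sigma>) (averaged (\<gamma> / \<sigma>) r h) x - averaged (\<gamma> / \<sigma>) r h x) (B3 * (B1 * m))"
        using B3(2)[OF \<sigma> X gh] unfolding avg_diff ag .
      have "B4 * (B5 * m) + B3 * (B1 * m) \<le> B * m"
        using mult_right_mono[OF B(4) m] by (simp add: algebra_simps)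
      from pnorm_le_mono[OF pnorm_le_add[OF 1 2 p] this p]
      show "pnorm_le (sample_measure \<sigma> X) p (\<lambda>x. g x - averaged (\<gamma> / \<sigma>) r h x) (B * m)" by simp
    qed
  qed
qed

subsection \<open>The error of the sampling operator\<close>

lemma integrable_powr_truncate:
  fixes f :: "'a::euclidean_space \<Rightarrow> real"
  assumes f: "pnorm_le lborel p f c" and p: "1 \<le> p"
  shows "integrable lborel (\<lambda>x. indicator (ball 0 R) x * f x)"
    and "pnorm_le lborel p (\<lambda>x. indicator (ball 0 R) x * f x) c"
proof -
  have fm [measurable]: "f \<in> borel_measurable borel" using pnorm_le_measurable[OF f] by simp
  have [measurable]: "ball 0 R \<in> sets (borel :: 'a measure)" by simp
  show "integrable lborel (\<lambda>x. indicator (ball 0 R) x * f x)"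
  proof (rule Bochner_Integration.integrable_bound)
    show "integrable lborel (\<lambda>x. indicator (ball 0 R) x + \<bar>f x\<bar> powr p)"
      using pnorm_le_integrable[OF f] by (intro Bochner_Integration.integrable_add
          integrable_real_indicator) (use emeasure_bounded_finite[of "ball 0 R :: 'a set"] in auto)
    have "\<bar>f x\<bar> \<le> 1 + \<bar>f x\<bar> powr p" for x by (intro abs_le_one_plus_powr p)
    then show "AE x in lborel. norm (indicator (ball 0 R) x * f x) \<le> norm (indicator (ball 0 R) x + \<bar>f x\<bar> powr p)"
      by (intro AE_I2) (auto simp: indicator_def)
  qed measurable
  have "(\<integral>\<^sup>+ x. ennreal (\<bar>indicator (ball 0 R) x * f x\<bar> powr p) \<partial>lborel) \<le> (\<integral>\<^sup>+ x. ennreal (\<bar>f x\<bar> powr p) \<partial>lborel)"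
    by (intro nn_integral_mono) (auto simp: indicator_def)
  also have "\<dots> \<le> ennreal (c powr p)" by (rule pnorm_le_nn[OF f])
  finally show "pnorm_le lborel p (\<lambda>x. indicator (ball 0 R) x * f x) c"
    using pnorm_le_nonneg[OF f] unfolding pnorm_le_def by simp
qed

lemma truncation_converges:
  fixes f :: "'a::euclidean_space \<Rightarrow> real"
  assumes f: "pnorm_le lborel p f c" and p: "1 \<le> p" and e: "0 < e"
  shows "\<exists>R. pnorm_le lborel p (\<lambda>x. f x - indicator (ball 0 R) x * f x) e"
proof -
  have [measurable]: "f \<in> borel_measurable borel" using pnorm_le_measurable[OF f] by simp
  have [measurable]: "ball 0 R \<in> sets (borel :: 'a measure)" for R by simp
  let ?d = "\<lambda>n x. f x - indicator (ball 0 (real n)) x * f x"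
  have "(\<lambda>n. LINT x|lborel. \<bar>?d n x\<bar> powr p) \<longlonglongrightarrow> (LINT x|(lborel :: 'a measure). (0 :: real))"
  proof (rule integral_dominated_convergence[where w = "\<lambda>x. \<bar>f x\<bar> powr p"])
    show "integrable lborel (\<lambda>x. \<bar>f x\<bar> powr p)" by (rule pnorm_le_integrable[OF f])
    show "AE x in lborel. (\<lambda>n. \<bar>?d n x\<bar> powr p) \<longlonglongrightarrow> 0"
    proof (intro AE_I2)
      fix x
      have "eventually (\<lambda>n. \<bar>?d n x\<bar> powr p = 0) sequentially"
      proof -
        obtain N where "norm x < real N" using reals_Archimedean2 by blast
        then have "\<bar>?d n x\<bar> powr p = 0" if "N \<le> n" for n
          using that by (auto simp: indicator_def)
        then show ?thesis unfolding eventually_sequentially by blast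
      qed
      then show "(\<lambda>n. \<bar>?d n x\<bar> powr p) \<longlonglongrightarrow> 0" by (rule tendsto_eventually)
    qed
    show "AE x in lborel. norm (\<bar>?d n x\<bar> powr p) \<le> \<bar>f x\<bar> powr p" for n
      by (intro AE_I2) (auto simp: indicator_def)
  qed measurable
  then have "eventually (\<lambda>n. (LINT x|lborel. \<bar>?d n x\<bar> powr p) < e powr p) sequentially"
    using e by (intro order_tendstoD(2)) auto
  then obtain n where n: "(LINT x|lborel. \<bar>?d n x\<bar> powr p) < e powr p"
    unfolding eventually_sequentially by blast
  have "integrable lborel (\<lambda>x. \<bar>?d n x\<bar> powr p)"
    using pnorm_le_integrable[OF pnorm_le_diff[OF f integrable_powr_truncate(2)[OF f p] p]] .
  then have "(\<integral>\<^sup>+ x. ennreal (\<bar>?d n x\<bar> powr p) \<partial>lborel) = ennreal (LINT x|lborel. \<bar>?d n x\<bar> powr p)"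
    by (intro nn_integral_eq_integral) auto
  also have "\<dots> \<le> ennreal (e powr p)" using n by (intro ennreal_leI) simp
  finally have "pnorm_le lborel p (?d n) e" unfolding pnorm_le_def using e by simp
  then show ?thesis by blast
qed

text \<open>All estimates through integrals are made for this representative. Its samples may differ
  from those of \<open>f\<close>, so only \<open>f\<close> itself may enter a sampled norm
  unaveraged.\<close>

lemma Lp_borel_representative:
  fixes f :: "real ^ 'd \<Rightarrow> real"
  assumes f: "f \<in> Lp p" and p: "1 \<le> p"
  obtains f0 where "f0 \<in> borel_measurable borel" "AE x in lborel. f x = f0 x" "pnorm_le lborel p f0 (Lp_norm p f)"
proof -
  have fm: "f \<in> borel_measurable lebesgue" using f by (simp add: Lp_def)
  then obtain f0 where f0: "f0 \<in> borel_measurable lborel" "AE x in lborel. f x = f0 x"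
    using completion_ex_borel_measurable_real by blast
  have f0b: "f0 \<in> borel_measurable borel" using f0(1) by simp
  have "pnorm_le lebesgue p f (Lp_norm p f)" using f by (simp add: pnorm_le_lebesgue_iff[OF p])
  then have "pnorm_le lebesgue p f0 (Lp_norm p f)"
    by (rule pnorm_le_cong_AE) (use f0 in \<open>auto intro: AE_completion measurable_completion\<close>)
  then show ?thesis using that[OF f0b f0(2)] pnorm_le_lebesgue_lborel[OF f0b] by blast
qed

lemma AE_lborel_translate:
  fixes P :: "'a::euclidean_space \<Rightarrow> bool"
  assumes "AE x in lborel. P x"
  shows "AE x in lborel. P (x + a)"
proof -
  from AE_E[OF assms] obtain N where N0: "{x \<in> space lborel. \<not> P x} \<subseteq> N" "emeasure lborel N = 0" "N \<in> sets lborel"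
    by blast
  then have N: "N \<in> null_sets lborel" "{x \<in> space lborel. \<not> P x} \<subseteq> N"
    by (auto intro: null_setsI)
  have "{x. x - (- a) \<in> N} \<in> null_sets lborel" by (rule null_sets_translation[OF N(1)])
  from AE_not_in[OF this] show ?thesis
    by eventually_elim (use N(2) in auto)
qed

text \<open>\<open>modulus\<close> is a real supremum, hence an upper bound only when the norms are
  bounded; the crude bound \<open>2 ^ s * N\<close> provides this. Translations preserve null sets,
  so the differences of \<open>f\<close> and \<open>f0\<close> agree almost everywhere.\<close>

lemma modulus_le_modulus:
  fixes f :: "real ^ 'd \<Rightarrow> real"
  assumes f: "f \<in> Lp p" and p: "1 \<le> p"
    and f0: "f0 \<in> borel_measurable borel" "AE x in lborel. f x = f0 x" "pnorm_le lborel p f0 N"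
  shows "modulus_le p s f0 \<delta> (modulus p s f \<delta>)"
  unfolding modulus_le_def
proof (intro allI impI)
  have fm: "f \<in> borel_measurable lebesgue" using f by (simp add: Lp_def)
  have "fin_diff s h f \<in> borel_measurable lebesgue" for h
  proof -
    have "(\<lambda>x. a + (\<Sum>j\<in>Basis. (1 * (x \<bullet> j)) *\<^sub>R j)) \<in> lebesgue \<rightarrow>\<^sub>M lebesgue" for a :: "real ^ 'd"
      by (rule lebesgue_affine_measurable) simp
    then have "(\<lambda>x. a + x) \<in> lebesgue \<rightarrow>\<^sub>M lebesgue" for a :: "real ^ 'd"
      by (simp add: euclidean_representation)
    then have "(\<lambda>x. x + a) \<in> lebesgue \<rightarrow>\<^sub>M lebesgue" for a :: "real ^ 'd"
      by (simp add: add.commute[of _ a])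
    then have "(\<lambda>x. f (x + a)) \<in> borel_measurable lebesgue" for a
      by (rule measurable_compose[OF _ fm])
    then show ?thesis unfolding fin_diff_def by (intro borel_measurable_sum borel_measurable_times) auto
  qed
  moreover have "AE x in lborel. fin_diff s h f0 x = fin_diff s h f x" for h
  proof -
    have "AE x in lborel. \<forall>\<nu>\<in>{0..s}. f (x + real (s - \<nu>) *\<^sub>R h) = f0 (x + real (s - \<nu>) *\<^sub>R h)"
      by (intro AE_finite_allI AE_lborel_translate f0(2)) simp
    then show ?thesis by eventually_elim (simp add: fin_diff_def)
  qed
  moreover have fb: "fin_diff s h f0 \<in> borel_measurable borel" for h
    using f0(1) unfolding fin_diff_def by measurable
  ultimately have iff: "pnorm_le lborel p (fin_diff s h f0) c \<longleftrightarrow> pnorm_le lebesgue p (fin_diff s h f) c" for h c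
    unfolding pnorm_le_lebesgue_lborel[OF fb, symmetric]
    by (auto elim!: pnorm_le_cong_AE intro: AE_completion measurable_completion simp: eq_commute[of
        "fin_diff s h f _"])
  have bd: "Lp_norm p (fin_diff s h f) \<le> 2 ^ s * N" for h
    using pnorm_le_funpow_diff_op[OF f0(3) p, where h = h and n = s] iff pnorm_le_lebesgue_iff[OF p]
    unfolding fin_diff_eq_funpow[symmetric] by blast
  fix h :: "real ^ 'd" assume h: "norm h < \<delta>"
  have "Lp_norm p (fin_diff s h f) \<le> modulus p s f \<delta>"
    unfolding modulus_def using h bd by (intro cSUP_upper bdd_aboveI2[where M = "2 ^ s * N"]) auto
  moreover have "fin_diff s h f \<in> Lp p"
    using pnorm_le_funpow_diff_op[OF f0(3) p, where h = h and n = s] iff pnorm_le_lebesgue_iff[OF p]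
    unfolding fin_diff_eq_funpow[symmetric] by blast
  ultimately show "pnorm_le lborel p (fin_diff s h f0) (modulus p s f \<delta>)"
    unfolding iff pnorm_le_lebesgue_iff[OF p] by simp
qed

text \<open>Ball integrals ignore null sets, so the averages agree at every point and in particular
  at the sampling points.\<close>

lemma averaged_cong_AE:
  fixes f :: "real ^ 'd \<Rightarrow> real"
  assumes f: "f \<in> borel_measurable lebesgue" and f0: "f0 \<in> borel_measurable borel" "AE x in lborel. f x = f0 x"
  shows "averaged \<delta> r f = averaged \<delta> r f0"
proof -
  have "ball_avg e f x = ball_avg e f0 x" for e x
  proof -
    have f0m: "f0 \<in> borel_measurable lebesgue" using f0(1) by (intro measurable_completion) simp
    have "AE y in lebesgue. indicator (ball x e) y *\<^sub>R f y = indicator (ball x e) y *\<^sub>R f0 y"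
      using AE_completion[OF f0(2)] by eventually_elim simp
    then have "(LINT y:ball x e|lebesgue. f y) = (LINT y:ball x e|lebesgue. f0 y)"
      unfolding set_lebesgue_integral_def using f f0m
      by (intro integral_cong_AE borel_measurable_scaleR borel_measurable_indicator) auto
    then show ?thesis by (simp add: ball_avg_def)
  qed
  then show ?thesis unfolding averaged_def by auto
qed

text \<open>\<open>infsum\<close> is additive only for convergent families, and the sampling series
  converge almost everywhere; hence linearity holds only up to a null set.\<close>

lemma sampling_op_diff:
  assumes def: "sampling_defined p X \<psi>" and f: "f \<in> Lp p \<inter> lp_sample p X" and g: "g \<in> Lp p \<inter> lp_sample p X"
  shows "AE x in lebesgue. sampling_op X \<psi> (\<lambda>\<xi>. g \<xi> - f \<xi>) x = sampling_op X \<psi> g x - sampling_op X \<psi> f x"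
proof -
  have "AE x in lebesgue. (\<lambda>\<xi>. f \<xi> * \<psi> \<xi> x) summable_on X" "AE x in lebesgue. (\<lambda>\<xi>. g \<xi> * \<psi> \<xi> x) summable_on X"
    using assms by (auto simp: sampling_defined_def)
  then show ?thesis
  proof eventually_elim
    case (elim x)
    have "(\<lambda>\<xi>. - (f \<xi> * \<psi> \<xi> x)) summable_on X"
      using elim(1) by (simp add: summable_on_uminus)
    from infsum_add[OF elim(2) this] show ?case
      by (simp add: sampling_op_def left_diff_distrib infsum_uminus)
  qed
qed

text \<open>The upper and lower bound solve the same identity for different terms. The bound
  \<open>e\<close> serves only to make the samples of \<open>F\<close>, and with them those of
  \<open>g\<close>, summable, so that the sampling series of \<open>g\<close> converges; its size
  does not enter the result.\<close>

lemma sampling_error_bounds: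
  fixes f g F :: "real ^ 'd \<Rightarrow> real"
  assumes p: "1 \<le> p" and \<sigma>: "0 < \<sigma>" and \<kappa>: "0 < \<kappa>\<^sub>1" "0 < \<kappa>\<^sub>2" "0 < \<kappa>\<^sub>3"
    and G: "sampling_defined p X \<psi>"
    and A1: "cond_A1 \<kappa>\<^sub>1 p \<sigma> X \<psi>" and A2: "cond_A2 \<kappa>\<^sub>2 p \<sigma> X \<psi>" and A3: "cond_A3 \<kappa>\<^sub>3 lam s p \<sigma> X \<psi>"
    and f: "f \<in> Lp p" "f \<in> lp_sample p X" and g: "g \<in> bandlimited p (lam * \<sigma>)"
    and gf: "pnorm_le lebesgue p (\<lambda>x. g x - f x) a"
    and sob: "sobolev_seminorm p s g \<le> \<sigma> ^ s * b"
    and gF: "pnorm_le (sample_measure \<sigma> X) p (\<lambda>x. g x - F x) d"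
    and F: "pnorm_le (sample_measure \<sigma> X) p F e"
  shows "Lp_norm p (\<lambda>x. f x - sampling_op X \<psi> f x)
      \<le> a + \<kappa>\<^sub>3 * b + \<kappa>\<^sub>1 * (lp_sample_norm p \<sigma> X (\<lambda>x. F x - f x) + d)"
    and "\<kappa>\<^sub>2 * lp_sample_norm p \<sigma> X (\<lambda>x. F x - f x)
      \<le> Lp_norm p (\<lambda>x. f x - sampling_op X \<psi> f x) + a + \<kappa>\<^sub>3 * b + \<kappa>\<^sub>2 * d"
proof -
  let ?S = "sample_measure \<sigma> X" and ?G = "sampling_op X \<psi>"
  let ?N = "lp_sample_norm p \<sigma> X (\<lambda>x. F x - f x)"
  let ?u = "\<lambda>x. g x - f x"
  note L = pnorm_le_lebesgue_iff[OF p] and S = pnorm_le_sample_iff[OF p \<sigma>]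
  have fS: "pnorm_le ?S p f (lp_sample_norm p \<sigma> X f)" using f by (simp add: S)
  have "pnorm_le ?S p (\<lambda>x. g x - F x + F x) (d + e)" by (rule pnorm_le_add[OF gF F p])
  then have gS: "pnorm_le ?S p g (d + e)" by simp
  have gL: "g \<in> Lp p" using g by (simp add: bandlimited_def)
  have fLS: "f \<in> Lp p \<inter> lp_sample p X" and gLS: "g \<in> Lp p \<inter> lp_sample p X"
    using f gL gS by (auto simp: S)
  have "pnorm_le ?S p ?u (d + e + lp_sample_norm p \<sigma> X f)" by (rule pnorm_le_diff[OF gS fS p])
  then have uLS: "?u \<in> Lp p \<inter> lp_sample p X" using gf by (auto simp: S L)
  have GL: "?G f \<in> Lp p" "?G g \<in> Lp p" "?G ?u \<in> Lp p"
    using G fLS gLS uLS unfolding sampling_defined_def by blast+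
  have LpI: "pnorm_le lebesgue p k (Lp_norm p k)" if "k \<in> Lp p" for k :: "real ^ 'd \<Rightarrow> real"
    using that by (simp add: L)
  have FfS: "pnorm_le ?S p (\<lambda>x. F x - f x) ?N"
    using pnorm_le_diff[OF F fS p] by (simp add: S)
  have uS: "pnorm_le ?S p ?u (lp_sample_norm p \<sigma> X ?u)" using uLS by (simp add: S)
  have u_le: "lp_sample_norm p \<sigma> X ?u \<le> ?N + d"
    using pnorm_le_add[OF gF FfS p] by (simp add: S)
  have N_le: "?N \<le> lp_sample_norm p \<sigma> X ?u + d"
    using pnorm_le_diff[OF uS gF p] by (simp add: S)
  have gGg: "pnorm_le lebesgue p (\<lambda>x. g x - ?G g x) (\<kappa>\<^sub>3 * b)"
  proof -
    have "Lp_norm p (\<lambda>x. g x - ?G g x) \<le> \<kappa>\<^sub>3 * \<sigma> powr (- real s) * sobolev_seminorm p s g"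
      using A3 g by (simp add: cond_A3_def)
    also have "\<dots> \<le> \<kappa>\<^sub>3 * \<sigma> powr (- real s) * (\<sigma> ^ s * b)"
      using \<kappa> by (intro mult_left_mono sob) simp
    also have "\<dots> = \<kappa>\<^sub>3 * b" using \<sigma> by (simp add: powr_minus powr_realpow)
    finally show ?thesis
      using pnorm_le_diff[OF LpI[OF gL] LpI[OF GL(2)] p] by (simp add: L)
  qed
  have fGf: "(\<lambda>x. f x - ?G f x) \<in> Lp p"
    using pnorm_le_diff[OF LpI[OF f(1)] LpI[OF GL(1)] p] by (simp add: L)
  have meas: "f \<in> borel_measurable lebesgue" "?G f \<in> borel_measurable lebesgue" "?G ?u \<in> borel_measurable lebesgue"
    using f(1) GL by (auto simp: Lp_def)
  note AE = sampling_op_diff[OF G fLS gLS]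
  \<comment> \<open>Linearity almost everywhere turns the left function into the sampling error of
    \<open>f\<close>; its last summand is then bounded through the samples of
    \<open>g - f\<close>.\<close>
  have "pnorm_le lebesgue p (\<lambda>x. ((g x - ?G g x) - (g x - f x)) + ?G ?u x) ((\<kappa>\<^sub>3 * b + a) + Lp_norm p (?G ?u))"
    by (intro pnorm_le_add pnorm_le_diff gGg gf LpI GL p)
  then have "pnorm_le lebesgue p (\<lambda>x. f x - ?G f x) ((\<kappa>\<^sub>3 * b + a) + Lp_norm p (?G ?u))"
  proof (rule pnorm_le_cong_AE)
    show "AE x in lebesgue. g x - ?G g x - (g x - f x) + ?G ?u x = f x - ?G f x"
      using AE by eventually_elim simp
  qed (use meas in measurable)
  then have 1: "Lp_norm p (\<lambda>x. f x - ?G f x) \<le> \<kappa>\<^sub>3 * b + a + Lp_norm p (?G ?u)" by (simp add: L)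
  have "Lp_norm p (?G ?u) \<le> \<kappa>\<^sub>1 * lp_sample_norm p \<sigma> X ?u"
    using A1 uLS by (simp add: cond_A1_def)
  also have "\<dots> \<le> \<kappa>\<^sub>1 * (?N + d)" using \<kappa> u_le by (intro mult_left_mono) auto
  finally show "Lp_norm p (\<lambda>x. f x - ?G f x) \<le> a + \<kappa>\<^sub>3 * b + \<kappa>\<^sub>1 * (?N + d)" using 1 by simp
  \<comment> \<open>The same identity solved for the operator applied to \<open>g - f\<close>, where
    the lower bound of the operator is available.\<close>
  have "pnorm_le lebesgue p (\<lambda>x. ((f x - ?G f x) + (g x - f x)) - (g x - ?G g x)) ((Lp_norm p (\<lambda>x. f x - ?G
      f x) + a) + \<kappa>\<^sub>3 * b)"
    by (intro pnorm_le_add pnorm_le_diff gGg gf LpI fGf p)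
  then have "pnorm_le lebesgue p (?G ?u) ((Lp_norm p (\<lambda>x. f x - ?G f x) + a) + \<kappa>\<^sub>3 * b)"
  proof (rule pnorm_le_cong_AE)
    show "AE x in lebesgue. f x - ?G f x + (g x - f x) - (g x - ?G g x) = ?G ?u x"
      using AE by eventually_elim simp
  qed (rule meas)
  then have 2: "Lp_norm p (?G ?u) \<le> Lp_norm p (\<lambda>x. f x - ?G f x) + a + \<kappa>\<^sub>3 * b" by (simp add: L)
  have "\<kappa>\<^sub>2 * ?N \<le> \<kappa>\<^sub>2 * (lp_sample_norm p \<sigma> X ?u + d)" using \<kappa> N_le by (intro mult_left_mono) auto
  also have "\<dots> = \<kappa>\<^sub>2 * lp_sample_norm p \<sigma> X ?u + \<kappa>\<^sub>2 * d" by (simp add: algebra_simps)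
  also have "\<kappa>\<^sub>2 * lp_sample_norm p \<sigma> X ?u \<le> Lp_norm p (?G ?u)"
    using A2 uLS by (simp add: cond_A2_def)
  finally show "\<kappa>\<^sub>2 * ?N \<le> Lp_norm p (\<lambda>x. f x - ?G f x) + a + \<kappa>\<^sub>3 * b + \<kappa>\<^sub>2 * d" using 2 by simp
qed

text \<open>Removes the truncation error. Dividing by \<open>z + 1\<close> instead of
  \<open>z\<close> covers \<open>z = 0\<close>.\<close>

lemma le_of_le_add_all_scaled:
  fixes x y z :: real
  assumes "\<And>e. 0 < e \<Longrightarrow> x \<le> y + e * z" "0 \<le> z"
  shows "x \<le> y"
proof (rule field_le_epsilon)
  fix e :: real assume "0 < e"
  then have "x \<le> y + e / (z + 1) * z" using assms(2) by (intro assms(1) divide_pos_pos) auto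
  also have "e / (z + 1) * z \<le> e" using assms \<open>0 < e\<close> by (simp add: field_simps)
  finally show "x \<le> y + e" by simp
qed

text \<open>The approximation theorem is applied to a truncation of the representative. The
  truncation radius depends on \<open>e\<close>, but the constants do not: they involve only
  stability bounds and not the integral of the truncated function.\<close>

lemma Lp_band_limited_approximation:
  fixes p \<gamma> lam :: real and f :: "real ^ 'd \<Rightarrow> real"
  assumes p: "1 \<le> p" and rs: "1 \<le> r" "1 \<le> s" "s \<le> 2 * r" and \<gamma>: "0 < \<gamma>" "\<gamma> \<le> 1" and lam: "0 < lam" "lam \<le> 1"
    and f: "f \<in> Lp p"
  obtains K N where "0 \<le> K" "\<And>\<sigma>. 0 < \<sigma> \<Longrightarrow> 0 \<le> modulus p s f (1 / \<sigma>)"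
    "\<And>\<sigma> Y. 0 < \<sigma> \<Longrightarrow> separated (2 * \<gamma> / \<sigma>) Y \<Longrightarrow> pnorm_le (sample_measure \<sigma> Y) p (averaged (\<gamma> / \<sigma>) r f) N"
    "\<And>\<sigma> Y e. 0 < \<sigma> \<Longrightarrow> separated (2 * \<gamma> / \<sigma>) Y \<Longrightarrow> 0 < e \<Longrightarrow> \<exists>g\<in>bandlimited p (lam * \<sigma>).
       pnorm_le lebesgue p (\<lambda>x. g x - f x) (K * (modulus p s f (1 / \<sigma>) + e)) \<and>
       sobolev_seminorm p s g \<le> \<sigma> ^ s * (K * (modulus p s f (1 / \<sigma>) + e)) \<and>
       pnorm_le (sample_measure \<sigma> Y) p (\<lambda>x. g x - averaged (\<gamma> / \<sigma>) r f x) (K * (modulus p s f (1 / \<sigma>) + e))"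
proof -
  obtain f0 where f0: "f0 \<in> borel_measurable borel" "AE x in lborel. f x = f0 x" "pnorm_le lborel p f0 (Lp_norm p f)"
    by (rule Lp_borel_representative[OF f p])
  have fm: "f \<in> borel_measurable lebesgue" using f by (simp add: Lp_def)
  obtain B where B: "0 \<le> B" "\<And>\<sigma> Y (h :: real ^ 'd \<Rightarrow> real) m C. 0 < \<sigma> \<Longrightarrow> separated (2 * \<gamma> / \<sigma>) Y \<Longrightarrow> integrable lborel h \<Longrightarrow>
     pnorm_le lborel p h C \<Longrightarrow> modulus_le p s h (1 / \<sigma>) m \<Longrightarrow>
     (\<exists>g\<in>bandlimited p (lam * \<sigma>). pnorm_le lborel p (\<lambda>x. g x - h x) (B * m) \<and>
        sobolev_seminorm p s g \<le> \<sigma> ^ s * (B * m) \<and>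
        pnorm_le (sample_measure \<sigma> Y) p (\<lambda>x. g x - averaged (\<gamma> / \<sigma>) r h x) (B * m))"
    using band_limited_approximation[OF p rs \<gamma> lam, where 'd = 'd] by blast
  obtain B' where B': "0 \<le> B'" "\<And>\<sigma> Y (f :: real ^ 'd \<Rightarrow> real) c. 0 < \<sigma> \<Longrightarrow> separated (2 * \<gamma> / \<sigma>) Y
      \<Longrightarrow> pnorm_le lborel p f c \<Longrightarrow>
      pnorm_le (sample_measure \<sigma> Y) p (averaged (\<gamma> / \<sigma>) r f) (B' * c)"
    using sample_stable_averaged[OF p \<gamma>(1) rs(1)] unfolding sample_stable_def by blast
  have mod0: "modulus_le p s f0 (1 / \<sigma>) (modulus p s f (1 / \<sigma>))" for \<sigma>
    by (rule modulus_le_modulus[OF f p f0])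
  have m0: "0 \<le> modulus p s f (1 / \<sigma>)" if "0 < \<sigma>" for \<sigma>
    using modulus_le_nonneg[OF mod0] that by simp
  have F: "averaged \<delta> r f = averaged \<delta> r f0" for \<delta> by (rule averaged_cong_AE[OF fm f0(1,2)])
  \<comment> \<open>\<open>B * 2 ^ s\<close> absorbs the perturbed modulus, \<open>B'\<close> the
    change of the averaged samples under truncation, and 1 the change in p-norm.\<close>
  let ?K = "B * 2 ^ s + B + B' + 1"
  show ?thesis
  proof (rule that[of ?K "B' * Lp_norm p f"])
    show "0 \<le> ?K" using B(1) B'(1) by simp
    show "0 \<le> modulus p s f (1 / \<sigma>)" if "0 < \<sigma>" for \<sigma> by (rule m0[OF that])
    show "pnorm_le (sample_measure \<sigma> Y) p (averaged (\<gamma> / \<sigma>) r f) (B' * Lp_norm p f)"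
      if "0 < \<sigma>" "separated (2 * \<gamma> / \<sigma>) Y" for \<sigma> Y
      unfolding F by (rule B'(2)[OF that f0(3)])
    fix \<sigma> e :: real and Y :: "(real ^ 'd) set" assume \<sigma>: "0 < \<sigma>" and Y: "separated (2 * \<gamma> / \<sigma>) Y" and e: "0 < e"
    let ?m = "modulus p s f (1 / \<sigma>)"
    obtain R where "pnorm_le lborel p (\<lambda>x. f0 x - indicator (ball 0 R) x * f0 x) e"
      using truncation_converges[OF f0(3) p e] by blast
    define h where "h x = indicator (ball 0 R) x * f0 x" for x
    have "pnorm_le lborel p (\<lambda>x. f0 x - h x) e" unfolding h_def by fact
    from pnorm_le_uminus[OF this] have hf0: "pnorm_le lborel p (\<lambda>x. h x - f0 x) e" by simp
    have h: "integrable lborel h" "pnorm_le lborel p h (Lp_norm p f)"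
      unfolding h_def[abs_def] by (rule integrable_powr_truncate[OF f0(3) p])+
    have hm: "h \<in> borel_measurable borel" using h(1) by auto
    obtain g where g: "g \<in> bandlimited p (lam * \<sigma>)" "pnorm_le lborel p (\<lambda>x. g x - h x) (B * (?m + 2 ^ s * e))"
        "sobolev_seminorm p s g \<le> \<sigma> ^ s * (B * (?m + 2 ^ s * e))"
        "pnorm_le (sample_measure \<sigma> Y) p (\<lambda>x. g x - averaged (\<gamma> / \<sigma>) r h x) (B * (?m + 2 ^ s * e))"
      using B(2)[OF \<sigma> Y h modulus_le_perturb[OF mod0 hf0 p]] by blast
    have "0 \<le> B * 2 ^ s * ?m" "0 \<le> B * e" "0 \<le> B' * ?m" "0 \<le> B' * e"
      using B(1) B'(1) m0[OF \<sigma>] e by auto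
    then have K: "B * (?m + 2 ^ s * e) \<le> ?K * (?m + e)" "B * (?m + 2 ^ s * e) + e \<le> ?K * (?m + e)"
        "B * (?m + 2 ^ s * e) + B' * e \<le> ?K * (?m + e)"
      using m0[OF \<sigma>] e by (simp_all add: algebra_simps)
    have gm: "g \<in> borel_measurable borel"
      using g(1) by (auto simp: bandlimited_def intro: borel_measurable_continuous_onI)
    have "pnorm_le lborel p (\<lambda>x. (g x - h x) + (h x - f0 x)) (B * (?m + 2 ^ s * e) + e)"
      by (rule pnorm_le_add[OF g(2) hf0 p])
    from pnorm_le_mono[OF this K(2) p] have "pnorm_le lebesgue p (\<lambda>x. g x - f0 x) (?K * (?m + e))"
      using f0(1) gm by (subst pnorm_le_lebesgue_lborel) auto
    then have gf: "pnorm_le lebesgue p (\<lambda>x. g x - f x) (?K * (?m + e))"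
    proof (rule pnorm_le_cong_AE)
      show "AE x in lebesgue. g x - f0 x = g x - f x"
        using AE_completion[OF f0(2)] by eventually_elim simp
      show "(\<lambda>x. g x - f x) \<in> borel_measurable lebesgue"
        by (intro borel_measurable_diff fm measurable_completion) (simp add: gm)
    qed
    have avg: "averaged (\<gamma> / \<sigma>) r (\<lambda>x. h x - f0 x) x = averaged (\<gamma> / \<sigma>) r h x - averaged (\<gamma> / \<sigma>) r f x" for x
      unfolding F using \<gamma> \<sigma>
      by (intro averaged_diff[OF hm f0(1)] conv_integrable_Lp[OF ball_kernel_decaying[of 2] order_refl h(2) p]
          conv_integrable_Lp[OF ball_kernel_decaying[of 2] order_refl f0(3) p]) auto
    have "pnorm_le (sample_measure \<sigma> Y) p (\<lambda>x. averaged (\<gamma> / \<sigma>) r h x - averaged (\<gamma> / \<sigma>) r f x) (B' * e)"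
      using B'(2)[OF \<sigma> Y hf0] unfolding avg .
    from pnorm_le_mono[OF pnorm_le_add[OF g(4) this p] K(3) p]
    have "pnorm_le (sample_measure \<sigma> Y) p (\<lambda>x. g x - averaged (\<gamma> / \<sigma>) r f x) (?K * (?m + e))" by simp
    moreover have "sobolev_seminorm p s g \<le> \<sigma> ^ s * (?K * (?m + e))"
      using \<sigma> by (intro order_trans[OF g(3) mult_left_mono[OF K(1)]]) simp
    ultimately show "\<exists>g\<in>bandlimited p (lam * \<sigma>). pnorm_le lebesgue p (\<lambda>x. g x - f x) (?K * (?m + e)) \<and>
       sobolev_seminorm p s g \<le> \<sigma> ^ s * (?K * (?m + e)) \<and>
       pnorm_le (sample_measure \<sigma> Y) p (\<lambda>x. g x - averaged (\<gamma> / \<sigma>) r f x) (?K * (?m + e))"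
      using g(1) gf by blast
  qed
qed

theorem corollary4p3:
  fixes p \<gamma> \<kappa>\<^sub>1 \<kappa>\<^sub>2 \<kappa>\<^sub>3 lam :: real and r s :: nat
    and X :: "real \<Rightarrow> (real ^ 'd) set"
    and \<psi> :: "real \<Rightarrow> real ^ 'd \<Rightarrow> real ^ 'd \<Rightarrow> real"
    and f :: "real ^ 'd \<Rightarrow> real"
  assumes p: "1 \<le> p"
    and rs: "1 \<le> r" "1 \<le> s" "s \<le> 2 * r"
    and \<gamma>: "0 < \<gamma>" "\<gamma> \<le> 1"
    and \<kappa>: "0 < \<kappa>\<^sub>1" "0 < \<kappa>\<^sub>2" "0 < \<kappa>\<^sub>3"
    and lam: "0 < lam" "lam \<le> 1"
    and X: "\<And>\<sigma>. \<sigma> > 0 \<Longrightarrow> separated (2 * \<gamma> / \<sigma>) (X \<sigma>)"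
    and G: "\<And>\<sigma>. \<sigma> > 0 \<Longrightarrow> sampling_defined p (X \<sigma>) (\<psi> \<sigma>)"
    and A1: "\<And>\<sigma>. \<sigma> > 0 \<Longrightarrow> cond_A1 \<kappa>\<^sub>1 p \<sigma> (X \<sigma>) (\<psi> \<sigma>)"
    and A2: "\<And>\<sigma>. \<sigma> > 0 \<Longrightarrow> cond_A2 \<kappa>\<^sub>2 p \<sigma> (X \<sigma>) (\<psi> \<sigma>)"
    and A3: "\<And>\<sigma>. \<sigma> > 0 \<Longrightarrow> cond_A3 \<kappa>\<^sub>3 lam s p \<sigma> (X \<sigma>) (\<psi> \<sigma>)"
    and f: "f \<in> Lp p" "\<And>\<sigma>. \<sigma> > 0 \<Longrightarrow> f \<in> lp_sample p (X \<sigma>)"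
    and small: "(\<lambda>\<sigma>. modulus p s f (1 / \<sigma>))
      \<in> o[at_top](\<lambda>\<sigma>. lp_sample_norm p \<sigma> (X \<sigma>) (\<lambda>x. averaged (\<gamma> / \<sigma>) r f x - f x))"
  shows "\<exists>c C \<sigma>\<^sub>0. 0 < c \<and> 0 < C \<and> 0 < \<sigma>\<^sub>0 \<and> (\<forall>\<sigma>\<ge>\<sigma>\<^sub>0.
      c * lp_sample_norm p \<sigma> (X \<sigma>) (\<lambda>x. averaged (\<gamma> / \<sigma>) r f x - f x)
        \<le> Lp_norm p (\<lambda>x. f x - sampling_op (X \<sigma>) (\<psi> \<sigma>) f x) \<and>
      Lp_norm p (\<lambda>x. f x - sampling_op (X \<sigma>) (\<psi> \<sigma>) f x)
        \<le> C * lp_sample_norm p \<sigma> (X \<sigma>) (\<lambda>x. averaged (\<gamma> / \<sigma>) r f x - f x))"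
proof -
  let ?N = "\<lambda>\<sigma>. lp_sample_norm p \<sigma> (X \<sigma>) (\<lambda>x. averaged (\<gamma> / \<sigma>) r f x - f x)"
  let ?m = "\<lambda>\<sigma>. modulus p s f (1 / \<sigma>)"
  let ?E = "\<lambda>\<sigma>. Lp_norm p (\<lambda>x. f x - sampling_op (X \<sigma>) (\<psi> \<sigma>) f x)"
  obtain L N where L: "0 \<le> L" "\<And>\<sigma>. 0 < \<sigma> \<Longrightarrow> 0 \<le> ?m \<sigma>"
    "\<And>\<sigma> Y. 0 < \<sigma> \<Longrightarrow> separated (2 * \<gamma> / \<sigma>) Y \<Longrightarrow> pnorm_le (sample_measure \<sigma> Y) p (averaged (\<gamma> / \<sigma>) r f) N"
    "\<And>\<sigma> Y e. 0 < \<sigma> \<Longrightarrow> separated (2 * \<gamma> / \<sigma>) Y \<Longrightarrow> 0 < e \<Longrightarrow> \<exists>g\<in>bandlimited p (lam * \<sigma>).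
       pnorm_le lebesgue p (\<lambda>x. g x - f x) (L * (?m \<sigma> + e)) \<and>
       sobolev_seminorm p s g \<le> \<sigma> ^ s * (L * (?m \<sigma> + e)) \<and>
       pnorm_le (sample_measure \<sigma> Y) p (\<lambda>x. g x - averaged (\<gamma> / \<sigma>) r f x) (L * (?m \<sigma> + e))"
    using Lp_band_limited_approximation[OF p rs \<gamma> lam f(1)] by blast
  \<comment> \<open>One constant for both inequalities, collecting the approximation error, its
    image under the sampling estimate, and the sampled difference weighted by either stability
    constant.\<close>
  define K where "K = (1 + \<kappa>\<^sub>3 + \<kappa>\<^sub>1 + \<kappa>\<^sub>2) * L"
  have step: "?E \<sigma> \<le> (K * ?m \<sigma> + \<kappa>\<^sub>1 * ?N \<sigma>) + e * K \<and> \<kappa>\<^sub>2 * ?N \<sigma> \<le> (?E \<sigma> + K * ?m \<sigma>) + e * K"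
    if \<sigma>: "0 < \<sigma>" and e: "0 < e" for \<sigma> e
  proof -
    obtain g where g: "g \<in> bandlimited p (lam * \<sigma>)" "pnorm_le lebesgue p (\<lambda>x. g x - f x) (L * (?m \<sigma> + e))"
       "sobolev_seminorm p s g \<le> \<sigma> ^ s * (L * (?m \<sigma> + e))"
       "pnorm_le (sample_measure \<sigma> (X \<sigma>)) p (\<lambda>x. g x - averaged (\<gamma> / \<sigma>) r f x) (L * (?m \<sigma> + e))"
      using L(4)[OF \<sigma> X[OF \<sigma>] e] by blast
    note bounds = sampling_error_bounds[OF p \<sigma> \<kappa> G[OF \<sigma>] A1[OF \<sigma>] A2[OF \<sigma>] A3[OF \<sigma>] f(1) f(2)[OF \<sigma>] g L(3)[OF \<sigma> X[OF \<sigma>]]]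
    have "0 \<le> \<kappa>\<^sub>1 * (L * (?m \<sigma> + e))" "0 \<le> \<kappa>\<^sub>2 * (L * (?m \<sigma> + e))"
      using \<kappa> L(1) L(2)[OF \<sigma>] e by auto
    then show ?thesis using bounds by (auto simp: K_def algebra_simps)
  qed
  have K: "0 \<le> K" "\<And>\<sigma>. 0 < \<sigma> \<Longrightarrow> ?E \<sigma> \<le> K * ?m \<sigma> + \<kappa>\<^sub>1 * ?N \<sigma>"
    "\<And>\<sigma>. 0 < \<sigma> \<Longrightarrow> \<kappa>\<^sub>2 * ?N \<sigma> \<le> ?E \<sigma> + K * ?m \<sigma>"
  proof -
    show K: "0 \<le> K" using \<kappa> L(1) by (simp add: K_def)
    show "?E \<sigma> \<le> K * ?m \<sigma> + \<kappa>\<^sub>1 * ?N \<sigma>" if "0 < \<sigma>" for \<sigma>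
      by (rule le_of_le_add_all_scaled[OF conjunct1[OF step[OF that]] K])
    show "\<kappa>\<^sub>2 * ?N \<sigma> \<le> ?E \<sigma> + K * ?m \<sigma>" if "0 < \<sigma>" for \<sigma>
      by (rule le_of_le_add_all_scaled[OF conjunct2[OF step[OF that]] K])
  qed
  \<comment> \<open>Chosen so that the modulus term consumes at most half of the lower bound
    \<open>\<kappa>\<^sub>2 * ?N \<sigma>\<close>; \<open>K + 1\<close> avoids division by
    0.\<close>
  define \<eta> where "\<eta> = \<kappa>\<^sub>2 / (2 * (K + 1))"
  have \<eta>: "0 < \<eta>" using K \<kappa> by (simp add: \<eta>_def)
  have K\<eta>: "K * \<eta> \<le> \<kappa>\<^sub>2 / 2" using K \<kappa> by (simp add: \<eta>_def field_simps)
  have N0: "0 \<le> ?N \<sigma>" for \<sigma> by (simp add: lp_sample_norm_def)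
  have "eventually (\<lambda>\<sigma>. norm (?m \<sigma>) \<le> \<eta> * norm (?N \<sigma>)) at_top"
    using small \<eta> by (rule landau_o.smallD)
  then obtain \<sigma>\<^sub>1 where \<sigma>\<^sub>1: "\<And>\<sigma>. \<sigma>\<^sub>1 \<le> \<sigma> \<Longrightarrow> norm (?m \<sigma>) \<le> \<eta> * norm (?N \<sigma>)"
    by (auto simp: eventually_at_top_linorder)
  have "\<kappa>\<^sub>2 / 2 * ?N \<sigma> \<le> ?E \<sigma> \<and> ?E \<sigma> \<le> (\<kappa>\<^sub>1 + \<kappa>\<^sub>2) * ?N \<sigma>" if "max \<sigma>\<^sub>1 1 \<le> \<sigma>" for \<sigma>
  proof -
    have \<sigma>: "0 < \<sigma>" using that by simp
    have "?m \<sigma> \<le> \<eta> * ?N \<sigma>" using \<sigma>\<^sub>1[of \<sigma>] that N0[of \<sigma>] by simp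
    then have "K * ?m \<sigma> \<le> K * (\<eta> * ?N \<sigma>)" using K(1) by (rule mult_left_mono)
    also have "\<dots> \<le> \<kappa>\<^sub>2 / 2 * ?N \<sigma>" using mult_right_mono[OF K\<eta> N0[of \<sigma>]] by (simp add: mult.assoc)
    finally have Km: "K * ?m \<sigma> \<le> \<kappa>\<^sub>2 / 2 * ?N \<sigma>" .
    have "0 \<le> \<kappa>\<^sub>2 * ?N \<sigma>" using \<kappa> N0 by simp
    then show ?thesis
      using K(2)[OF \<sigma>] K(3)[OF \<sigma>] Km by (simp add: algebra_simps)
  qed
  \<comment> \<open>The maximum with 1 makes the threshold positive.\<close>
  then show ?thesis
    using \<kappa> by (intro exI[of _ "\<kappa>\<^sub>2 / 2"] exI[of _ "\<kappa>\<^sub>1 + \<kappa>\<^sub>2"] exI[of _ "max \<sigma>\<^sub>1 1"]) auto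
qed

end
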